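(* Let $0<q<1$. For each of the six choices of $\left(\tau^{\alpha\beta}_{2n+1}(q),\ \mathrm{TAB},\ M,\ I,\ (A,B)/(C,D)\right)$ listed below, and every integer $n\ge 0$, we have \[ f_{2n+1}:=\frac{\tau_{2n+1}^{\alpha\beta}(q)}{(1-q)^{2n+1}}=\sum_{\pi\in \mathrm{TAB}}q^{|\pi|} = \frac{M}{(q;q)_{2n+1}} = \frac{I}{(q;q)_{2n+1}} , \] and, as power series in $x$, \[ \sum_{n\ge0} f_{2n+1} x^{2n+1} = \frac{\sum_{n\ge0} (-1)^nq^{An^2+Bn}x^{2n+1}/(q;q)_{2n+1}} {\sum_{n\ge0}(-1)^nq^{Cn^2+Dn}x^{2n}/(q;q)_{2n}}. \] In the list, $\mathrm{Alt}^*_{2n+1}$ may be taken to be either $\mathrm{Alt}_{2n+1}$ or $\mathrm{Ralt}_{2n+1}$ (the assertion holds for both choices). (1) $\tau^{\ge<}_{2n+1}(q)$; $\mathrm{TAB}=\mathrm{SSYT}(\delta_{n+2}/\delta_n)$; $M=\sum_{\pi\in\mathrm{Alt}_{2n+1}}q^{\mathrm{maj}(\pi^{-1})}$; $I=\sum_{\pi\in\mathrm{Alt}^*_{2n+1}}q^{\mathrm{inv}(\pi)}$; $(A,B)=(0,0)$, $(C,D)=(0,0)$. (2) $\tau^{\ge\le}_{2n+1}(q)$; $\mathrm{TAB}=\mathrm{RPP}(\delta_{n+2}/\delta_n)$; $M=\sum_{\pi\in\mathrm{Alt}_{2n+1}}q^{\mathrm{maj}(\kappa_{2n+1}\pi^{-1})}$;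 $I=\sum_{\pi\in\mathrm{Alt}^*_{2n+1}}q^{\mathrm{inv}(\pi)-\mathrm{ndes}(\pi_e)}$; $(A,B)=(1,1)$, $(C,D)=(1,-1)$. (3) $\tau^{><}_{2n+1}(q)$; $\mathrm{TAB}=\mathrm{ST}(\delta_{n+2}/\delta_n)$; $M=\sum_{\pi\in\mathrm{Alt}_{2n+1}}q^{\mathrm{maj}(\eta_{2n+1}\pi^{-1})}$; $I=\sum_{\pi\in\mathrm{Alt}^*_{2n+1}}q^{\mathrm{inv}(\pi)+\mathrm{nasc}(\pi_e)}$; $(A,B)=(1,0)$, $(C,D)=(1,0)$. (4) $\tau^{<\ge}_{2n+1}(q)$; $\mathrm{TAB}=\mathrm{SSYT}(\delta^{(1,1)}_{n+3}/\delta_{n+1})$; $M=\sum_{\pi\in\mathrm{Ralt}_{2n+1}}q^{\mathrm{maj}(\pi^{-1})}$; $I=\sum_{\pi\in\mathrm{Alt}^*_{2n+1}}q^{\mathrm{inv}(\pi)}$; $(A,B)=(0,0)$, $(C,D)=(0,0)$. (5) $\tau^{\le\ge}_{2n+1}(q)$; $\mathrm{TAB}=\mathrm{RPP}(\delta^{(1,1)}_{n+3}/\delta_{n+1})$; $M=\sum_{\pi\in\mathrm{Ralt}_{2n+1}}q^{\mathrm{maj}(\eta_{2n+1}\pi^{-1})}$; $I=\sum_{\pi\in\mathrm{Alt}^*_{2n+1}}q^{\mathrm{inv}(\pi)-\mathrm{asc}(\pi_o)}$; $(A,B)=(1,0)$, $(C,D)=(1,-1)$. (6) $\tau^{<>}_{2n+1}(q)$;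 $\mathrm{TAB}=\mathrm{ST}(\delta^{(1,1)}_{n+3}/\delta_{n+1})$; $M=\sum_{\pi\in\mathrm{Ralt}_{2n+1}}q^{\mathrm{maj}(\kappa_{2n+1}\pi^{-1})}$; $I=\sum_{\pi\in\mathrm{Alt}^*_{2n+1}}q^{\mathrm{inv}(\pi)+\mathrm{des}(\pi_o)}$; $(A,B)=(1,1)$, $(C,D)=(1,0)$.
   Context: $(a;q)_m=(1-a)(1-aq)\cdots(1-aq^{m-1})$. For inequality symbols $\alpha,\beta$, $\tau_m^{\alpha\beta}(q)$ is the probability that a random word $w_1\cdots w_m$ of positive integers, whose letters are chosen independently with $\Pr(w_i=k)=q^{k-1}(1-q)$ for $k\ge1$, satisfies $w_1\,\alpha\, w_2\,\beta\, w_3\,\alpha\, w_4\,\beta\cdots$ (alternating relations). Shapes: $\delta_m=(m-1,m-2,\dots,1)$ (with $\delta_0=\delta_1=\emptyset$), and for $a,b\in\{0,1\}$, $\delta_m^{(a,b)}=(m-1-a,m-2,m-3,\dots,2,1-b)$; so $\delta_m^{(1,1)}=(m-2,m-2,m-3,\dots,2)$, and $\delta_3^{(1,1)}=(1)$. For partitions $\mu\subset\lambda$, $\lambda/\mu$ is the set difference of Young diagrams. Fillings of $\lambda/\mu$ are by nonnegative integers: $\mathrm{SSYT}(\lambda/\mu)$: weakly increasing in rows and strictly increasing in columns; $\mathrm{RPP}(\lambda/\mu)$: weakly increasing in rows and columns; $\mathrm{ST}(\lambda/\mu)$: strictly increasing in rows and columns. $|\pi|$ is the sum of the entries of a filling.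 Permutations: $\mathfrak S_m$ is the set of permutations of $\{1,\dots,m\}$, also written as words $\pi_1\cdots\pi_m$, $\pi_i=\pi(i)$, with product $\pi\sigma(i)=\pi(\sigma(i))$. $\mathrm{Alt}_m$: those with $\pi_1<\pi_2>\pi_3<\cdots$; $\mathrm{Ralt}_m$: those with $\pi_1>\pi_2<\pi_3>\cdots$. $\pi_o=\pi_1\pi_3\pi_5\cdots$ (odd positions), $\pi_e=\pi_2\pi_4\pi_6\cdots$ (even positions), as words. $\eta_{2n+1}=(1,2)(3,4)\cdots(2n-1,2n)(2n+1)$ and $\kappa_{2n+1}=(1)(2,3)(4,5)\cdots(2n,2n+1)$ in cycle notation. For a word $w=w_1\cdots w_m$ of integers: $\mathrm{des}(w)$ (resp. $\mathrm{asc}(w)$) is the number of $i\in\{1,\dots,m-1\}$ with $w_i>w_{i+1}$ (resp. $w_i<w_{i+1}$); $\mathrm{ndes}(w)=m-\mathrm{des}(w)$ and $\mathrm{nasc}(w)=m-\mathrm{asc}(w)$; $\mathrm{maj}(w)$ is the sum of the $i\in\{1,\dots,m-1\}$ with $w_i>w_{i+1}$; $\mathrm{inv}(w)$ is the number of pairs $i<j$ with $w_i>w_j$. *)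

theory Defs
  imports "HOL-Probability.Probability" "HOL-Combinatorics.Combinatorics"
    "HOL-Computational_Algebra.Formal_Power_Series"
begin

definition qpoch :: "real \<Rightarrow> real \<Rightarrow> nat \<Rightarrow> real" where
  "qpoch a q m = (\<Prod>i<m. 1 - a * q ^ i)"


subsection \<open>Random words with alternating relations\<close>

text \<open>Words are lists, so the letter \<open>w ! i\<close> is \<open>w\<^sub>i\<^sub>+\<^sub>1\<close>: the relation
  \<open>\<alpha>\<close> applies at the even list positions \<open>i = 0, 2, \<dots>\<close>.\<close>

definition alternating :: "(nat \<Rightarrow> nat \<Rightarrow> bool) \<Rightarrow> (nat \<Rightarrow> nat \<Rightarrow> bool) \<Rightarrow> nat list \<Rightarrow> bool" where
  "alternating \<alpha> \<beta> w \<longleftrightarrow>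
     (\<forall>i. Suc i < length w \<longrightarrow> (if even i then \<alpha> (w ! i) (w ! Suc i) else \<beta> (w ! i) (w ! Suc i)))"

text \<open>\<open>geometric_pmf (1 - q)\<close> gives mass \<open>q ^ k * (1 - q)\<close> to \<open>k = 0, 1, \<dots>\<close>; the shift by
  \<open>Suc\<close> makes the letters positive.\<close>

definition letter_pmf :: "real \<Rightarrow> nat pmf" where
  "letter_pmf q = map_pmf Suc (geometric_pmf (1 - q))"

definition tau :: "(nat \<Rightarrow> nat \<Rightarrow> bool) \<Rightarrow> (nat \<Rightarrow> nat \<Rightarrow> bool) \<Rightarrow> nat \<Rightarrow> real \<Rightarrow> real" where
  "tau \<alpha> \<beta> m q = measure_pmf.prob (replicate_pmf m (letter_pmf q)) {w. alternating \<alpha> \<beta> w}"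


subsection \<open>Skew shapes and their fillings\<close>

text \<open>Partitions are lists of parts, possibly with trailing zeros. Cells are (row, column) pairs,
  both counted from 0, with row 0 the longest.\<close>

definition young_diagram :: "nat list \<Rightarrow> (nat \<times> nat) set" where
  "young_diagram p = {(i, j). i < length p \<and> j < p ! i}"

definition skew_shape :: "nat list \<Rightarrow> nat list \<Rightarrow> (nat \<times> nat) set" where
  "skew_shape p r = young_diagram p - young_diagram r"

definition staircase :: "nat \<Rightarrow> nat list" where
  "staircase m = rev [1..<m]"

text \<open>The list \<open>(m - 1 - a, m - 2, m - 3, \<dots>, 2, 1 - b)\<close> of length \<open>m - 1\<close>, meant for
  \<open>m \<ge> 3\<close> and \<open>a, b \<in> {0, 1}\<close>.\<close>

definition trimmed_staircase :: "nat \<Rightarrow> nat \<Rightarrow> nat \<Rightarrow> nat list" where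
  "trimmed_staircase a b m = (m - 1 - a) # rev [2..<m - 1] @ [1 - b]"

text \<open>Fillings are extensional functions (\<open>undefined\<close> outside the shape), so that each filling
  is represented by exactly one function.\<close>

definition tableaux ::
  "(nat \<Rightarrow> nat \<Rightarrow> bool) \<Rightarrow> (nat \<Rightarrow> nat \<Rightarrow> bool) \<Rightarrow> (nat \<times> nat) set \<Rightarrow> (nat \<times> nat \<Rightarrow> nat) set" where
  "tableaux R C S = {\<pi> \<in> S \<rightarrow>\<^sub>E UNIV.
     (\<forall>i j j'. (i, j) \<in> S \<and> (i, j') \<in> S \<and> j < j' \<longrightarrow> R (\<pi> (i, j)) (\<pi> (i, j'))) \<and>
     (\<forall>i i' j. (i, j) \<in> S \<and> (i', j) \<in> S \<and> i < i' \<longrightarrow> C (\<pi> (i, j)) (\<pi> (i', j)))}"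

definition SSYT :: "(nat \<times> nat) set \<Rightarrow> (nat \<times> nat \<Rightarrow> nat) set" where
  "SSYT = tableaux (\<le>) (<)"

definition RPP :: "(nat \<times> nat) set \<Rightarrow> (nat \<times> nat \<Rightarrow> nat) set" where
  "RPP = tableaux (\<le>) (\<le>)"

definition ST :: "(nat \<times> nat) set \<Rightarrow> (nat \<times> nat \<Rightarrow> nat) set" where
  "ST = tableaux (<) (<)"

definition filling_size :: "(nat \<times> nat) set \<Rightarrow> (nat \<times> nat \<Rightarrow> nat) \<Rightarrow> nat" where
  "filling_size S \<pi> = (\<Sum>c\<in>S. \<pi> c)"

abbreviation outer_strip :: "nat \<Rightarrow> (nat \<times> nat) set" where
  "outer_strip n \<equiv> skew_shape (staircase (n + 2)) (staircase n)"

abbreviation inner_strip :: "nat \<Rightarrow> (nat \<times> nat) set" where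
  "inner_strip n \<equiv> skew_shape (trimmed_staircase 1 1 (n + 3)) (staircase (n + 1))"


subsection \<open>Word statistics\<close>

definition des :: "nat list \<Rightarrow> nat" where
  "des w = card {i \<in> {1..<length w}. w ! (i - 1) > w ! i}"

definition asc :: "nat list \<Rightarrow> nat" where
  "asc w = card {i \<in> {1..<length w}. w ! (i - 1) < w ! i}"

definition ndes :: "nat list \<Rightarrow> nat" where
  "ndes w = length w - des w"

definition nasc :: "nat list \<Rightarrow> nat" where
  "nasc w = length w - asc w"

definition maj :: "nat list \<Rightarrow> nat" where
  "maj w = \<Sum> {i \<in> {1..<length w}. w ! (i - 1) > w ! i}"

definition invs :: "nat list \<Rightarrow> nat" where
  "invs w = card {(i, j). i < j \<and> j < length w \<and> w ! i > w ! j}"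


subsection \<open>Permutations\<close>

definition word :: "nat \<Rightarrow> (nat \<Rightarrow> nat) \<Rightarrow> nat list" where
  "word m \<pi> = map \<pi> [1..<m + 1]"

definition odd_word :: "nat \<Rightarrow> (nat \<Rightarrow> nat) \<Rightarrow> nat list" where
  "odd_word m \<pi> = map \<pi> (filter odd [1..<m + 1])"

definition even_word :: "nat \<Rightarrow> (nat \<Rightarrow> nat) \<Rightarrow> nat list" where
  "even_word m \<pi> = map \<pi> (filter even [1..<m + 1])"

definition Alt :: "nat \<Rightarrow> (nat \<Rightarrow> nat) set" where
  "Alt m = {\<pi>. \<pi> permutes {1..m} \<and> alternating (<) (>) (word m \<pi>)}"

definition Ralt :: "nat \<Rightarrow> (nat \<Rightarrow> nat) set" where
  "Ralt m = {\<pi>. \<pi> permutes {1..m} \<and> alternating (>) (<) (word m \<pi>)}"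

text \<open>\<open>eta n = (1,2)(3,4)\<cdots>(2n-1,2n)\<close> and \<open>kappa n = (2,3)(4,5)\<cdots>(2n,2n+1)\<close>,
  both as permutations of \<open>{1..2n+1}\<close>.\<close>

primrec eta :: "nat \<Rightarrow> nat \<Rightarrow> nat" where
  "eta 0 = id"
| "eta (Suc n) = eta n \<circ> Transposition.transpose (2 * n + 1) (2 * n + 2)"

primrec kappa :: "nat \<Rightarrow> nat \<Rightarrow> nat" where
  "kappa 0 = id"
| "kappa (Suc n) = kappa n \<circ> Transposition.transpose (2 * n + 2) (2 * n + 3)"


subsection \<open>Odd and even formal power series\<close>

text \<open>\<open>\<Sum>n. a n x^(2n+1)\<close> and \<open>\<Sum>n. a n x^(2n)\<close>.\<close>

definition odd_fps :: "(nat \<Rightarrow> real) \<Rightarrow> real fps" where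
  "odd_fps a = Abs_fps (\<lambda>k. if odd k then a (k div 2) else 0)"

definition even_fps :: "(nat \<Rightarrow> real) \<Rightarrow> real fps" where
  "even_fps a = Abs_fps (\<lambda>k. if even k then a (k div 2) else 0)"

end

theory Submission
  imports Defs
begin

text \<open>Shifting every letter down by one turns \<open>tau \<alpha> \<beta> m q / (1 - q) ^ m\<close> into the generating
function, by sum of letters, of the words of natural numbers of length \<open>m\<close> whose relations
alternate between \<open>\<alpha>\<close> and \<open>\<beta>\<close> (\<open>tau_eq_gf\<close>). Write \<open>F n\<close> for it when \<open>m = 2 * n + 1\<close>.
Walking along the strip of cells turns a filling into such a word
(\<open>has_sum_outer_tableaux\<close>, \<open>has_sum_inner_tableaux\<close>). Each of the other expressions
belongs to one way of taking these words apart.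

Power series: replace \<open>\<alpha>\<close> by its negation from some point on. The negation of \<open>\<alpha>\<close> points in the
same direction as \<open>\<beta>\<close>, so this part of the word becomes a monotone chain. Dropping the
relation at the first replaced place allows \<open>\<alpha>\<close> as well as its negation there, and it factors the
word into an alternating word of odd length and a chain of even length. The alternating sum of these
products telescopes (\<open>alternating_words_recurrence\<close>), which says that the series of the \<open>F n\<close>
times the series of even chains is the series of odd chains. Chains are counted by \<open>gf_chain\<close>.

Major index: sort the positions of a word by decreasing letter, breaking ties by a
labelling \<open>\<omega>\<close> of the positions. The words that are sorted by a given permutation correspond to the decreasing sequences
with strict descents at prescribed places, so they contribute
\<open>q ^ maj (\<omega> \<circ> inv \<pi>) / qpoch q q m\<close>, as in Stanley's theory of \<open>P\<close>-partitions (\<open>gf_std_perm\<close>).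
The labellings \<open>id\<close>, \<open>eta n\<close> and \<open>kappa n\<close> resolve ties exactly as weak and strict relations
demand, so that alternating words are sorted by the alternating permutations.

Inversions: words and permutations satisfy the same quadratic recurrence. A word
is cut at its first zero in a valley (\<open>zigwords_recurrence\<close>), a permutation at its minimum
(\<open>zigperms_recurrence\<close>). The inversions between the two sides of the minimum sum to a
Gaussian binomial coefficient (\<open>sum_cross_subsets\<close>), which becomes a product after division by
\<open>qpoch\<close>. A power of \<open>q\<close> for a side of length one distinguishes weak from strict relations on
the side of words; descents of the valley letters produce the same power on the side of permutations
(\<open>vstat_split\<close>). Reversing and complementing a permutation of odd degree keeps all statistics
and exchanges \<open>Alt\<close> with \<open>Ralt\<close>, which explains why both are allowed.\<close>


section \<open>Words and their generating functions\<close>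

definition altwords :: "(nat \<Rightarrow> nat \<Rightarrow> bool) \<Rightarrow> (nat \<Rightarrow> nat \<Rightarrow> bool) \<Rightarrow> nat \<Rightarrow> nat list set" where
  "altwords \<alpha> \<beta> m = {w. length w = m \<and> alternating \<alpha> \<beta> w}"

definition gf :: "real \<Rightarrow> nat list set \<Rightarrow> real" where
  "gf q S = (\<Sum>\<^sub>\<infinity>w\<in>S. q ^ sum_list w)"

lemma pmf_replicate_Cons:
  "pmf (replicate_pmf (Suc m) p) (x # w) = pmf p x * pmf (replicate_pmf m p) w"
proof -
  have "replicate_pmf (Suc m) p = map_pmf (\<lambda>(x, w). x # w) (pair_pmf p (replicate_pmf m p))"
    by (simp add: pair_pmf_def map_pmf_def bind_assoc_pmf bind_return_pmf)
  moreover have "inj (\<lambda>(x, w). x # w)" by (auto simp: inj_def)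
  ultimately show ?thesis
    using pmf_map_inj'[of "\<lambda>(x, w). x # w" "pair_pmf p (replicate_pmf m p)" "(x, w)"]
    by (simp add: pmf_pair)
qed

lemma replicate_pmf_map: "replicate_pmf m (map_pmf f p) = map_pmf (map f) (replicate_pmf m p)"
  by (induction m) (simp_all add: map_pmf_def bind_assoc_pmf bind_return_pmf)

lemma alternating_map_Suc:
  assumes "\<And>x y. \<alpha> (Suc x) (Suc y) = \<alpha> x y" "\<And>x y. \<beta> (Suc x) (Suc y) = \<beta> x y"
  shows "alternating \<alpha> \<beta> (map Suc w) = alternating \<alpha> \<beta> w"
  unfolding alternating_def using assms by (auto simp: nth_map)

context
  fixes q :: real
  assumes q: "0 < q" "q < 1"
begin

lemma pmf_replicate_geometric:
  "pmf (replicate_pmf m (geometric_pmf (1 - q))) w =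
     (if length w = m then (1 - q) ^ m * q ^ sum_list w else 0)"
proof (induction m arbitrary: w)
  case 0
  show ?case by (auto simp: indicator_def)
next
  case (Suc m)
  show ?case
  proof (cases w)
    case Nil
    then show ?thesis by (simp add: pmf_eq_0_set_pmf set_replicate_pmf del: replicate_pmf.simps)
  next
    case (Cons x v)
    then show ?thesis using q
      by (simp add: pmf_replicate_Cons Suc power_add del: replicate_pmf.simps)
  qed
qed

text \<open>Up to the factor \<open>(1 - q) ^ m\<close> the weights are the probabilities of a distribution, so they are
summable on every set of words of one length.\<close>

lemma summable_on_words: 
  assumes "S \<subseteq> {w. length w = m}"
  shows "(\<lambda>w. q ^ sum_list w) summable_on S"
proof -
  let ?p = "replicate_pmf m (geometric_pmf (1 - q))"
  have "(pmf ?p) summable_on S"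
    using pmf_abs_summable[of ?p S] by (simp add: abs_summable_equivalent[symmetric])
  then have "(\<lambda>w. (1 - q) ^ m * q ^ sum_list w) summable_on S"
    using assms by (subst summable_on_cong[of _ _ "pmf ?p"]) (auto simp: pmf_replicate_geometric)
  then show ?thesis
    using q by (simp add: summable_on_cmult_right')
qed

lemma has_sum_gf:
  assumes "S \<subseteq> {w. length w = m}"
  shows "((\<lambda>w. q ^ sum_list w) has_sum gf q S) S"
  unfolding gf_def using summable_on_words[OF assms] by (rule has_sum_infsum)

lemma tau_eq_gf:
  assumes "\<And>x y. \<alpha> (Suc x) (Suc y) = \<alpha> x y" "\<And>x y. \<beta> (Suc x) (Suc y) = \<beta> x y"
  shows "tau \<alpha> \<beta> m q / (1 - q) ^ m = gf q (altwords \<alpha> \<beta> m)"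
proof -
  let ?p = "replicate_pmf m (geometric_pmf (1 - q))"
  have "tau \<alpha> \<beta> m q = measure ?p {w. alternating \<alpha> \<beta> w}"
    by (simp add: tau_def letter_pmf_def replicate_pmf_map vimage_def alternating_map_Suc assms)
  also have "\<dots> = (\<Sum>\<^sub>\<infinity>w\<in>{w. alternating \<alpha> \<beta> w}. pmf ?p w)"
    by (simp add: measure_pmf_conv_infsetsum infsetsum_infsum pmf_abs_summable)
  also have "\<dots> = (\<Sum>\<^sub>\<infinity>w\<in>altwords \<alpha> \<beta> m. (1 - q) ^ m * q ^ sum_list w)"
    by (rule infsum_cong_neutral) (auto simp: altwords_def pmf_replicate_geometric)
  also have "\<dots> = (1 - q) ^ m * gf q (altwords \<alpha> \<beta> m)"
    by (simp add: gf_def infsum_cmult_right')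
  finally show ?thesis using q by simp
qed

lemma gf_Un:
  assumes "A \<subseteq> {w. length w = m}" "B \<subseteq> {w. length w = m}" "A \<inter> B = {}"
  shows "gf q (A \<union> B) = gf q A + gf q B"
  unfolding gf_def using assms by (intro infsum_Un_disjoint summable_on_words)

lemma gf_UN:
  assumes "finite X" "\<And>x. x \<in> X \<Longrightarrow> A x \<subseteq> {w. length w = m}"
    and "\<And>x y. x \<in> X \<Longrightarrow> y \<in> X \<Longrightarrow> x \<noteq> y \<Longrightarrow> A x \<inter> A y = {}"
  shows "gf q (\<Union>x\<in>X. A x) = (\<Sum>x\<in>X. gf q (A x))"
  unfolding gf_def
proof (rule sum_infsum[symmetric])
  show "(\<lambda>w. q ^ sum_list w) summable_on A x" if "x \<in> X" for x
    using assms(2)[OF that] by (rule summable_on_words)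
qed (use assms in auto)

lemma gf_bij:
  assumes "bij_betw g A B" "\<And>w. w \<in> A \<Longrightarrow> sum_list (g w) = sum_list w"
  shows "gf q B = gf q A"
  unfolding gf_def infsum_reindex_bij_betw[OF assms(1), symmetric]
  by (rule infsum_cong) (simp add: assms(2))

lemma gf_rev: "gf q (rev ` A) = gf q A"
  by (rule gf_bij[of rev]) (auto simp: bij_betw_def sum_list_rev)

lemma gf_map_Suc:
  assumes "A \<subseteq> {w. length w = m}"
  shows "gf q (map Suc ` A) = q ^ m * gf q A"
proof -
  have "gf q (map Suc ` A) = (\<Sum>\<^sub>\<infinity>w\<in>A. q ^ sum_list (map Suc w))"
    unfolding gf_def by (subst infsum_reindex) (auto simp: o_def inj_on_def)
  also have "\<dots> = (\<Sum>\<^sub>\<infinity>w\<in>A. q ^ m * q ^ sum_list w)"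
    using assms by (intro infsum_cong) (auto simp: sum_list_Suc power_add subset_iff)
  finally show ?thesis by (simp add: gf_def infsum_cmult_right')
qed

text \<open>The middle part \<open>s\<close> is empty when a word is cut between two letters, and \<open>[0]\<close> when a word is
cut at a zero. The lengths make the decomposition unique.\<close>

lemma gf_append:
  assumes "A \<subseteq> {w. length w = a}" "B \<subseteq> {w. length w = b}"
  shows "gf q ((\<lambda>(u, v). u @ s @ v) ` (A \<times> B)) = q ^ sum_list s * (gf q A * gf q B)"
proof -
  have inj: "inj_on (\<lambda>(u, v). u @ s @ v) (A \<times> B)"
    using assms by (auto simp: inj_on_def subset_iff)
  have 1: "((\<lambda>v. q ^ sum_list u * q ^ sum_list v) has_sum (q ^ sum_list u * gf q B)) B" for u
    by (intro has_sum_cmult_right has_sum_gf[OF assms(2)])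
  have 2: "((\<lambda>u. q ^ sum_list u * gf q B) has_sum (gf q A * gf q B)) A"
    by (intro has_sum_cmult_left has_sum_gf[OF assms(1)])
  have "((\<lambda>(u, v). q ^ sum_list u * q ^ sum_list v) has_sum (gf q A * gf q B)) (A \<times> B)"
    using 1 2 q by (intro has_sum_SigmaI[where g = "\<lambda>u. q ^ sum_list u * gf q B"] 
      summable_on_SigmaI[where g = "\<lambda>u. q ^ sum_list u * gf q B"])
      (auto intro: has_sum_imp_summable)
  then have "((\<lambda>z. q ^ sum_list s * (\<lambda>(u, v). q ^ sum_list u * q ^ sum_list v) z)
      has_sum (q ^ sum_list s * (gf q A * gf q B))) (A \<times> B)"
    by (rule has_sum_cmult_right)
  also have "?this \<longleftrightarrow> ((\<lambda>z. q ^ sum_list ((\<lambda>(u, v). u @ s @ v) z))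
      has_sum (q ^ sum_list s * (gf q A * gf q B))) (A \<times> B)"
    by (intro has_sum_cong) (auto simp: power_add)
  finally show ?thesis
    unfolding gf_def infsum_reindex[OF inj] by (simp add: infsumI o_def)
qed

lemma gf_Nil: "gf q {[]} = 1"
  by (simp add: gf_def)

end


section \<open>Decreasing sequences with prescribed strict descents\<close>

definition chain :: "(nat \<Rightarrow> bool) \<Rightarrow> nat list \<Rightarrow> bool" where
  "chain r w \<longleftrightarrow> (\<forall>i. Suc i < length w \<longrightarrow> (if r i then w ! i > w ! Suc i else w ! i \<ge> w ! Suc i))"

lemma chain_mono:
  assumes "chain r w" "i \<le> j" "j < length w"
  shows "w ! j \<le> w ! i"
  using assms(2,3)
proof (induction j rule: dec_induct)
  case (step j)
  then show ?case using assms(1) unfolding chain_def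
    by (metis Suc_lessD less_or_eq_imp_le order_trans)
qed simp

lemma chain_map_Suc [simp]: "chain r (map Suc w) = chain r w"
  unfolding chain_def by (auto simp: nth_map)

lemma chain_snoc:
  "chain r (v @ [x]) \<longleftrightarrow> chain r v \<and> (v \<noteq> [] \<longrightarrow> (if r (length v - 1) then x < last v else x \<le> last v))"
    (is "?l \<longleftrightarrow> ?r")
proof
  assume l: ?l
  have "chain r v" unfolding chain_def
  proof (intro allI impI)
    fix i assume "Suc i < length v"
    with l show "if r i then v ! i > v ! Suc i else v ! i \<ge> v ! Suc i"
      unfolding chain_def by (auto simp: nth_append dest!: spec[of _ i])
  qed
  moreover have "if r (length v - 1) then x < last v else x \<le> last v" if "v \<noteq> []"
    using l that unfolding chain_def
    by (auto simp: nth_append last_conv_nth dest!: spec[of _ "length v - 1"])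
  ultimately show ?r by blast
next
  assume r: ?r
  show ?l unfolding chain_def
  proof (intro allI impI)
    fix i assume i: "Suc i < length (v @ [x])"
    show "if r i then (v @ [x]) ! i > (v @ [x]) ! Suc i else (v @ [x]) ! i \<ge> (v @ [x]) ! Suc i"
    proof (cases "Suc i < length v")
      case True
      then show ?thesis using r unfolding chain_def by (auto simp: nth_append)
    next
      case False
      with i have "i = length v - 1" "v \<noteq> []" by auto
      then show ?thesis using r by (auto simp: nth_append last_conv_nth split: if_splits)
    qed
  qed
qed

lemma positive_iff_map_Suc:
  "(\<forall>x\<in>set w. 0 < (x::nat)) \<longleftrightarrow> (\<exists>u. w = map Suc u)"
proof
  assume "\<forall>x\<in>set w. 0 < x"
  then have "w = map Suc (map (\<lambda>x. x - 1) w)" by (induction w) auto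
  then show "\<exists>u. w = map Suc u" by blast
qed auto

lemma qpoch_Suc: "qpoch a q (Suc m) = qpoch a q m * (1 - a * q ^ m)"
  by (simp add: qpoch_def)

lemma qpoch_pos:
  assumes "0 < q" "q < 1"
  shows "0 < qpoch q q m"
  unfolding qpoch_def
proof (intro prod_pos ballI)
  fix i show "0 < 1 - q * q ^ i"
    using assms power_less_one_iff[of q "Suc i"] by simp
qed

text \<open>Let \<open>m > 0\<close>. A sequence without a zero is one of the same kind shifted up by one, which accounts for
the factor \<open>1 - q ^ m\<close>. Otherwise the last entry is zero and can be removed; if the last step is a
strict one, the remaining \<open>m - 1\<close> entries are positive, which costs the factor \<open>q ^ (m - 1)\<close>.\<close>

lemma gf_chain:
  assumes q: "0 < q" "q < 1"
  shows "gf q {w. length w = m \<and> chain r w} = q ^ (\<Sum>i | Suc i < m \<and> r i. Suc i) / qpoch q q m"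
proof (induction m)
  case 0
  have "{w. length w = 0 \<and> chain r w} = {[]}" by (auto simp: chain_def)
  then show ?case by (simp add: gf_Nil[OF q] qpoch_def)
next
  case (Suc m)
  define A where "A k = {w. length w = k \<and> chain r w}" for k
  define B where "B = (if m > 0 \<and> r (m - 1) then map Suc ` A m else A m)"
  have A_sub: "A k \<subseteq> {w. length w = k}" for k by (auto simp: A_def)
  have B_sub: "B \<subseteq> {w. length w = m}" by (auto simp: B_def A_def)
  \<comment> \<open>The last entry is the smallest one: either it is positive and all entries are, or it is zero.\<close>
  have split: "A (Suc m) = map Suc ` A (Suc m) \<union> (\<lambda>(u, v). u @ [0] @ v) ` (B \<times> {[]})" (is "_ = ?P \<union> ?Z")
  proof (intro equalityI subsetI)
    fix w assume w: "w \<in> A (Suc m)"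
    then obtain v x where vx: "w = v @ [x]" by (cases w rule: rev_cases) (auto simp: A_def)
    with w have v: "length v = m" "chain r v"
      "v \<noteq> [] \<Longrightarrow> if r (length v - 1) then x < last v else x \<le> last v"
      by (auto simp: A_def chain_snoc)
    show "w \<in> ?P \<union> ?Z"
    proof (cases "x = 0")
      case False
      have "\<forall>y\<in>set w. 0 < y"
      proof
        fix y assume "y \<in> set w"
        then obtain i where i: "i < length w" "y = w ! i" by (auto simp: in_set_conv_nth)
        then have "w ! (length w - 1) \<le> y" using w by (auto simp: A_def intro!: chain_mono)
        then show "0 < y" using False vx by (simp add: nth_append)
      qed
      then obtain u where "w = map Suc u" using positive_iff_map_Suc by blast
      then show ?thesis using w by (auto simp: A_def)
    next
      case True
      have "v \<in> B"
      proof (cases "m > 0 \<and> r (m - 1)")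
        case r: True
        have "\<forall>y\<in>set v. 0 < y"
        proof
          fix y assume "y \<in> set v"
          then obtain i where i: "i < length v" "y = v ! i" by (auto simp: in_set_conv_nth)
          then have "v ! (length v - 1) \<le> y" using v by (auto intro!: chain_mono)
          moreover have "last v > 0" "v \<noteq> []" using v r by auto
          ultimately show "0 < y" by (simp add: last_conv_nth)
        qed
        then obtain u where "v = map Suc u" using positive_iff_map_Suc by blast
        then show ?thesis using v r by (auto simp: A_def B_def)
      next
        case False
        then show ?thesis using v by (auto simp: A_def B_def)
      qed
      then show ?thesis using vx True by (auto simp: image_iff)
    qed
  next
    fix w assume "w \<in> ?P \<union> ?Z"
    then show "w \<in> A (Suc m)"
    proof
      assume "w \<in> ?Z"
      then obtain v where v: "w = v @ [0]" "v \<in> B" by auto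
      then have "length v = m" "chain r v" by (auto simp: B_def A_def split: if_splits)
      moreover have "last v > 0" if "m > 0" "r (m - 1)"
      proof -
        from v(2) that obtain u where "v = map Suc u" "u \<in> A m" by (auto simp: B_def)
        then show ?thesis using that(1) by (auto simp: A_def last_map)
      qed
      ultimately show ?thesis using v(1) by (auto simp: A_def chain_snoc)
    qed (auto simp: A_def)
  qed
  have "0 \<notin> set w" if "w \<in> ?P" for w using that by auto
  moreover have "0 \<in> set w" if "w \<in> ?Z" for w using that by auto
  ultimately have "?P \<inter> ?Z = {}" by blast
  then have "gf q (A (Suc m)) = gf q ?P + gf q ?Z"
    by (subst split, intro gf_Un[OF q, of _ "Suc m"]) (use B_sub in \<open>auto simp: A_def\<close>)
  also have "gf q ?P = q ^ Suc m * gf q (A (Suc m))"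
    by (rule gf_map_Suc[OF q A_sub])
  also have "gf q ?Z = gf q B"
    by (subst gf_append[OF q B_sub, of _ 0]) (auto simp: gf_Nil[OF q])
  also have "gf q B = q ^ (if m > 0 \<and> r (m - 1) then m else 0) * gf q (A m)"
    by (simp add: B_def gf_map_Suc[OF q A_sub])
  finally have *: "gf q (A (Suc m)) * (1 - q ^ Suc m) = q ^ (if m > 0 \<and> r (m - 1) then m else 0) * gf q (A m)"
    by (simp add: algebra_simps)
  have exponent: "(\<Sum>i | Suc i < Suc m \<and> r i. Suc i)
      = (if m > 0 \<and> r (m - 1) then m else 0) + (\<Sum>i | Suc i < m \<and> r i. Suc i)"
  proof (cases "m > 0 \<and> r (m - 1)")
    case True
    then have "{i. Suc i < Suc m \<and> r i} = insert (m - 1) {i. Suc i < m \<and> r i}"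
      by (auto simp: less_Suc_eq)
    moreover have "finite {i. Suc i < m \<and> r i}" by (rule finite_subset[of _ "{..<m}"]) auto
    ultimately show ?thesis using True by simp
  next
    case False
    then have "{i. Suc i < Suc m \<and> r i} = {i. Suc i < m \<and> r i}"
      by (auto simp: less_Suc_eq)
    then show ?thesis using False by simp
  qed
  have "1 - q ^ Suc m > 0" using q power_less_one_iff[of q "Suc m"] by simp
  then have "gf q (A (Suc m)) = q ^ (if m > 0 \<and> r (m - 1) then m else 0) * gf q (A m) / (1 - q ^ Suc m)"
    using * by (simp add: field_simps)
  then show ?case using Suc unfolding exponent
    by (simp add: A_def qpoch_Suc power_add mult_ac)
qed


section \<open>The quotient of power series\<close>

lemma alternating_append:
  "alternating \<alpha> \<beta> (u @ v) \<longleftrightarrow> alternating \<alpha> \<beta> u \<and>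
     (if even (length u) then alternating \<alpha> \<beta> v else alternating \<beta> \<alpha> v) \<and>
     (u \<noteq> [] \<and> v \<noteq> [] \<longrightarrow> (if odd (length u) then \<alpha> (last u) (hd v) else \<beta> (last u) (hd v)))"
  (is "?l \<longleftrightarrow> ?r")
proof -
  define R where "R i = (if even i then \<alpha> else \<beta>)" for i :: nat
  have alt: "alternating \<alpha> \<beta> w \<longleftrightarrow> (\<forall>i. Suc i < length w \<longrightarrow> R i (w ! i) (w ! Suc i))" for w
    by (simp add: alternating_def R_def)
  have alt_v: "(if even (length u) then alternating \<alpha> \<beta> v else alternating \<beta> \<alpha> v)
      \<longleftrightarrow> (\<forall>i. Suc i < length v \<longrightarrow> R (length u + i) (v ! i) (v ! Suc i))"
    by (auto simp: alternating_def R_def)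
  have joint: "(if odd (length u) then \<alpha> (last u) (hd v) else \<beta> (last u) (hd v))
      \<longleftrightarrow> R (length u - 1) (last u) (hd v)" if "u \<noteq> []"
    using that by (cases "length u") (auto simp: R_def)
  show ?thesis
  proof (unfold alt_v, unfold alt, intro iffI conjI allI impI)
    assume l: "\<forall>i. Suc i < length (u @ v) \<longrightarrow> R i ((u @ v) ! i) ((u @ v) ! Suc i)"
    {
      fix i assume "Suc i < length u"
      with l show "R i (u ! i) (u ! Suc i)" by (auto simp: nth_append dest!: spec[of _ i])
    next
      fix i assume "Suc i < length v"
      with l show "R (length u + i) (v ! i) (v ! Suc i)"
        by (auto simp: nth_append dest!: spec[of _ "length u + i"])
    next
      assume "u \<noteq> [] \<and> v \<noteq> []"
      then show "if odd (length u) then \<alpha> (last u) (hd v) else \<beta> (last u) (hd v)"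
        using spec[OF l, of "length u - 1"]
        by (subst joint) (auto simp: nth_append last_conv_nth hd_conv_nth)
    }
  next
    fix i
    assume r: "(\<forall>i. Suc i < length u \<longrightarrow> R i (u ! i) (u ! Suc i)) \<and>
      (\<forall>i. Suc i < length v \<longrightarrow> R (length u + i) (v ! i) (v ! Suc i)) \<and>
      (u \<noteq> [] \<and> v \<noteq> [] \<longrightarrow> (if odd (length u) then \<alpha> (last u) (hd v) else \<beta> (last u) (hd v)))"
      and i: "Suc i < length (u @ v)"
    consider "Suc i < length u" | "Suc i = length u" "u \<noteq> []" "v \<noteq> []" | "length u \<le> i"
      using i by (cases "Suc i < length u"; cases "length u \<le> i") (simp_all, fastforce)
    then show "R i ((u @ v) ! i) ((u @ v) ! Suc i)"
    proof cases
      case 1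
      then show ?thesis using r by (auto simp: nth_append)
    next
      case 2
      then have "i = length u - 1" by simp
      then show ?thesis using 2 r joint by (auto simp: nth_append last_conv_nth hd_conv_nth)
    next
      case 3
      then obtain j where "i = length u + j" using le_Suc_ex by blast
      then show ?thesis using r i by (auto simp: nth_append)
    qed
  qed
qed

lemma alternating_short [simp]: "length w \<le> 1 \<Longrightarrow> alternating \<alpha> \<beta> w"
  by (auto simp: alternating_def)

text \<open>The relations are read backwards, and for even length the last relation is again \<open>\<alpha>\<close>, for odd
length it is \<open>\<beta>\<close>.\<close>

lemma alternating_rev:
  "alternating \<alpha> \<beta> (rev w) \<longleftrightarrow>
     (if even (length w) then alternating (\<lambda>x y. \<alpha> y x) (\<lambda>x y. \<beta> y x) w
      else alternating (\<lambda>x y. \<beta> y x) (\<lambda>x y. \<alpha> y x) w)"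
proof (induction w arbitrary: \<alpha> \<beta> rule: rev_induct)
  case (snoc x w)
  have "alternating \<alpha> \<beta> (rev (w @ [x])) \<longleftrightarrow> alternating \<alpha> \<beta> ([x] @ rev w)" by simp
  also have "\<dots> \<longleftrightarrow> alternating \<beta> \<alpha> (rev w) \<and> (w \<noteq> [] \<longrightarrow> \<alpha> x (last w))"
    by (subst alternating_append) (simp add: hd_rev)
  finally show ?case
    using snoc[of \<beta> \<alpha>] by (auto simp: alternating_append)
qed simp

lemma rev_altwords_even:
  "even m \<Longrightarrow> rev ` altwords \<alpha> \<beta> m = altwords (\<lambda>x y. \<alpha> y x) (\<lambda>x y. \<beta> y x) m"
  unfolding altwords_def
  by (auto simp: alternating_rev image_iff intro!: exI[of _ "rev _"])

lemma rev_altwords_odd: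
  "odd m \<Longrightarrow> rev ` altwords \<alpha> \<beta> m = altwords (\<lambda>x y. \<beta> y x) (\<lambda>x y. \<alpha> y x) m"
  unfolding altwords_def
  by (auto simp: alternating_rev image_iff intro!: exI[of _ "rev _"])

text \<open>The strict steps of a chain that alternates between \<open>>\<close> and \<open>\<ge>\<close> are at the positions
\<open>1, 3, 5, \<dots>\<close>; those of a chain that alternates between \<open>\<ge>\<close> and \<open>>\<close> are at \<open>2, 4, 6, \<dots>\<close>, which is the next
lemma.\<close>

lemma sum_odd_indices: "(\<Sum>i | Suc i < m \<and> even i. Suc i) = (m div 2) ^ 2"
proof (induction m)
  case (Suc m)
  have "{i. Suc i < Suc m \<and> even i} = {i. Suc i < m \<and> even i} \<union> (if m > 0 \<and> odd m then {m - 1} else {})"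
    by (cases m) (auto simp: less_Suc_eq)
  moreover have "finite {i. Suc i < m \<and> even i}" by (rule finite_subset[of _ "{..<m}"]) auto
  ultimately have "(\<Sum>i | Suc i < Suc m \<and> even i. Suc i) = (m div 2) ^ 2 + (if odd m then m else 0)"
    using Suc by (cases "odd m") (auto simp: odd_pos)
  then show ?case by (auto elim!: evenE oddE simp: power2_eq_square)
qed simp

lemma sum_even_indices: "(\<Sum>i | Suc i < m \<and> odd i. Suc i) = ((m - 1) div 2) * ((m + 1) div 2)"
proof (induction m)
  case (Suc m)
  have "{i. Suc i < Suc m \<and> odd i} = {i. Suc i < m \<and> odd i} \<union> (if m > 0 \<and> even m then {m - 1} else {})"
    by (cases m) (auto simp: less_Suc_eq)
  moreover have "finite {i. Suc i < m \<and> odd i}" by (rule finite_subset[of _ "{..<m}"]) auto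
  ultimately have *: "(\<Sum>i | Suc i < Suc m \<and> odd i. Suc i) = ((m - 1) div 2) * ((m + 1) div 2) + (if even m then m else 0)"
    using Suc by (cases "m > 0 \<and> even m") auto
  show ?case
  proof (cases "even m")
    case True
    then obtain k where "m = 2 * k" by (rule evenE)
    then show ?thesis using * by (cases k) auto
  next
    case False
    then obtain k where "m = 2 * k + 1" by (rule oddE)
    then show ?thesis using * by simp
  qed
qed simp

context
  fixes q :: real
  assumes q: "0 < q" "q < 1"
begin

lemma gf_weak_chain: "gf q (altwords (\<ge>) (\<ge>) m) = 1 / qpoch q q m"
proof -
  have "altwords (\<ge>) (\<ge>) m = {w. length w = m \<and> chain (\<lambda>i. False) w}"
    by (auto simp: altwords_def alternating_def chain_def)
  then show ?thesis by (simp add: gf_chain[OF q])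
qed

lemma gf_strict_weak_chain: "gf q (altwords (>) (\<ge>) m) = q ^ ((m div 2) ^ 2) / qpoch q q m"
proof -
  have "altwords (>) (\<ge>) m = {w. length w = m \<and> chain even w}"
    by (auto simp: altwords_def alternating_def chain_def)
  then show ?thesis by (simp add: gf_chain[OF q] sum_odd_indices)
qed

lemma gf_weak_strict_chain:
  "gf q (altwords (\<ge>) (>) m) = q ^ (((m - 1) div 2) * ((m + 1) div 2)) / qpoch q q m"
proof -
  have "altwords (\<ge>) (>) m = {w. length w = m \<and> chain odd w}"
    by (auto simp: altwords_def alternating_def chain_def)
  then show ?thesis by (simp add: gf_chain[OF q] sum_even_indices)
qed

lemma gf_ascending_chains:
  "gf q (altwords (\<le>) (\<le>) m) = gf q (altwords (\<ge>) (\<ge>) m)"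
  "even m \<Longrightarrow> gf q (altwords (<) (\<le>) m) = gf q (altwords (>) (\<ge>) m)"
  "even m \<Longrightarrow> gf q (altwords (\<le>) (<) m) = gf q (altwords (\<ge>) (>) m)"
  "odd m \<Longrightarrow> gf q (altwords (<) (\<le>) m) = gf q (altwords (\<ge>) (>) m)"
  "odd m \<Longrightarrow> gf q (altwords (\<le>) (<) m) = gf q (altwords (>) (\<ge>) m)"
  using rev_altwords_even[of m] rev_altwords_odd[of m] gf_rev[OF q]
  by (metis)+

text \<open>Let \<open>H k\<close> be the set of words of length \<open>2 * n + 1\<close> whose relations at even indices are \<open>\<alpha>\<close> below index
\<open>2 * k\<close> and \<open>\<alpha>'\<close> from there on, with \<open>\<beta>\<close> at all odd indices. Cutting at index \<open>2 * k\<close> imposes no relation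
there, and exactly one of \<open>\<alpha>\<close> and \<open>\<alpha>'\<close> holds, so the \<open>k\<close>-th product counts \<open>H k\<close> together with
\<open>H (Suc k)\<close>. The alternating sum therefore telescopes to \<open>H 0\<close>.\<close>

lemma alternating_words_recurrence:
  fixes \<alpha> \<beta> :: "nat \<Rightarrow> nat \<Rightarrow> bool" and n :: nat
  defines "\<alpha>' \<equiv> \<lambda>x y. \<not> \<alpha> x y"
  shows "(\<Sum>k\<le>n. (-1) ^ k * (gf q (altwords \<alpha> \<beta> (2 * k + 1)) * gf q (altwords \<beta> \<alpha>' (2 * (n - k)))))
    = gf q (altwords \<alpha>' \<beta> (2 * n + 1))"
proof -
  define R where "R k i = (if odd i then \<beta> else if i < 2 * k then \<alpha> else \<alpha>')" for k i :: nat
  define H where "H k = {w. length w = 2 * n + 1 \<and> (\<forall>i<2 * n. R k i (w ! i) (w ! Suc i))}" for k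
  have alt_iff: "w \<in> altwords \<rho> \<sigma> m \<longleftrightarrow> length w = m \<and>
      (\<forall>i. Suc i < m \<longrightarrow> (if even i then \<rho> else \<sigma>) (w ! i) (w ! Suc i))" for w \<rho> \<sigma> m
    unfolding altwords_def alternating_def by (simp add: if_distribR cong: conj_cong)
  have H0: "H 0 = altwords \<alpha>' \<beta> (2 * n + 1)"
    by (rule set_eqI) (auto simp: alt_iff H_def R_def if_distribR)
  have "R n i = (if even i then \<alpha> else \<beta>)" if "i < 2 * n" for i
    using that by (simp add: R_def)
  then have Hn: "H n = altwords \<alpha> \<beta> (2 * n + 1)"
    by (intro set_eqI) (simp add: alt_iff H_def)
  have step: "gf q (altwords \<alpha> \<beta> (2 * k + 1)) * gf q (altwords \<beta> \<alpha>' (2 * (n - k))) = gf q (H k) + gf q (H (Suc k))"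
    if k: "k < n" for k
  proof -
    have eq: "(\<lambda>(u, v). u @ [] @ v) ` (altwords \<alpha> \<beta> (2 * k + 1) \<times> altwords \<beta> \<alpha>' (2 * (n - k)))
        = H k \<union> H (Suc k)" (is "?A = ?B")
    proof (intro equalityI subsetI)
      fix w assume "w \<in> ?A"
      then obtain u v where w: "w = u @ v" "u \<in> altwords \<alpha> \<beta> (2 * k + 1)" "v \<in> altwords \<beta> \<alpha>' (2 * (n - k))"
        by auto
      have lens: "length u = 2 * k + 1" "length v = 2 * (n - k)" "length w = 2 * n + 1"
        using w k by (auto simp: altwords_def)
      \<comment> \<open>The relation that happens to hold at the cut decides between the two sets.\<close>
      define b where "b = (if \<alpha> (w ! (2 * k)) (w ! Suc (2 * k)) then Suc k else k)"
      have "R b i (w ! i) (w ! Suc i)" if i: "i < 2 * n" for i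
      proof -
        consider "i < 2 * k" | "i = 2 * k" | j where "i = 2 * k + 1 + j"
          by (metis Suc_eq_plus1 less_Suc_eq less_iff_Suc_add add_Suc nat_neq_iff)
        then show ?thesis
        proof cases
          case 1
          then have "R b i = (if even i then \<alpha> else \<beta>)" by (simp add: R_def b_def)
          moreover have "w ! i = u ! i" "w ! Suc i = u ! Suc i"
            using 1 lens by (auto simp: w(1) nth_append)
          ultimately show ?thesis using w(2) 1 unfolding alt_iff by simp
        next
          case 2
          then show ?thesis by (simp add: R_def b_def \<alpha>'_def)
        next
          case 3
          then have "R b i = (if even j then \<beta> else \<alpha>')" by (simp add: R_def b_def)
          moreover have "w ! i = v ! j" "w ! Suc i = v ! Suc j"
            using 3 lens by (auto simp: w(1) nth_append)
          ultimately show ?thesis using w(3) 3 i lens unfolding alt_iff by simp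
        qed
      qed
      then have "w \<in> H b" using lens unfolding H_def by blast
      then show "w \<in> ?B" by (auto simp: b_def split: if_splits)
    next
      fix w assume "w \<in> ?B"
      then obtain b where b: "w \<in> H b" "b = k \<or> b = Suc k" by blast
      have len: "length w = 2 * n + 1" using b by (simp add: H_def)
      have R: "R b i (w ! i) (w ! Suc i)" if "i < 2 * n" for i
        using b that by (simp add: H_def)
      have "take (2 * k + 1) w \<in> altwords \<alpha> \<beta> (2 * k + 1)"
        unfolding alt_iff
      proof (intro conjI allI impI)
        fix i assume i: "Suc i < 2 * k + 1"
        then have "R b i = (if even i then \<alpha> else \<beta>)" using b(2) by (auto simp: R_def)
        then show "(if even i then \<alpha> else \<beta>) (take (2 * k + 1) w ! i) (take (2 * k + 1) w ! Suc i)"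
          using R[of i] i k by simp
      qed (use len k in simp)
      moreover have "drop (2 * k + 1) w \<in> altwords \<beta> \<alpha>' (2 * (n - k))"
        unfolding alt_iff
      proof (intro conjI allI impI)
        fix i assume i: "Suc i < 2 * (n - k)"
        then have "R b (2 * k + 1 + i) = (if even i then \<beta> else \<alpha>')" using b(2) by (auto simp: R_def)
        then show "(if even i then \<beta> else \<alpha>') (drop (2 * k + 1) w ! i) (drop (2 * k + 1) w ! Suc i)"
          using R[of "2 * k + 1 + i"] i k len by simp
      qed (use len k in simp)
      ultimately show "w \<in> ?A"
        by (intro image_eqI[of _ _ "(take (2 * k + 1) w, drop (2 * k + 1) w)"]) simp_all
    qed
    have disj: "H k \<inter> H (Suc k) = {}"
    proof (rule ccontr)
      assume "H k \<inter> H (Suc k) \<noteq> {}"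
      then obtain w where w: "w \<in> H k" "w \<in> H (Suc k)" by blast
      then have "\<alpha>' (w ! (2 * k)) (w ! Suc (2 * k))" "\<alpha> (w ! (2 * k)) (w ! Suc (2 * k))"
        using k by (auto simp: H_def R_def dest!: spec[of _ "2 * k"])
      then show False by (simp add: \<alpha>'_def)
    qed
    have "gf q (altwords \<alpha> \<beta> (2 * k + 1)) * gf q (altwords \<beta> \<alpha>' (2 * (n - k))) = gf q ?A"
      by (subst gf_append[OF q, of _ "2 * k + 1" _ "2 * (n - k)"]) (auto simp: altwords_def)
    also have "\<dots> = gf q (H k) + gf q (H (Suc k))"
      unfolding eq by (rule gf_Un[OF q _ _ disj, of "2 * n + 1"]) (auto simp: H_def)
    finally show ?thesis .
  qed
  have telescope: "(\<Sum>k<m. (-1) ^ k * (gf q (H k) + gf q (H (Suc k)))) = gf q (H 0) - (-1) ^ m * gf q (H m)" for m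
    by (induction m) (simp_all add: algebra_simps)
  have empty: "altwords \<beta> \<alpha>' 0 = {[]}" by (auto simp: altwords_def)
  have "(\<Sum>k\<le>n. (-1) ^ k * (gf q (altwords \<alpha> \<beta> (2 * k + 1)) * gf q (altwords \<beta> \<alpha>' (2 * (n - k)))))
     = (\<Sum>k<n. (-1) ^ k * (gf q (H k) + gf q (H (Suc k)))) + (-1) ^ n * gf q (H n)"
    by (simp add: lessThan_Suc_atMost[symmetric] step[simplified] empty gf_Nil[OF q] Hn)
  then show ?thesis by (simp add: telescope H0)
qed

end

lemma even_fps_nonzero: "a 0 \<noteq> 0 \<Longrightarrow> even_fps a \<noteq> 0"
  by (auto simp: even_fps_def fps_eq_iff intro!: exI[of _ 0])

lemma odd_fps_mult_even_fps:
  "odd_fps a * even_fps b = odd_fps (\<lambda>n. \<Sum>k\<le>n. a k * b (n - k))"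
proof (rule fps_ext)
  fix N
  let ?t = "\<lambda>i. fps_nth (odd_fps a) i * fps_nth (even_fps b) (N - i)"
  have lhs: "fps_nth (odd_fps a * even_fps b) N = (\<Sum>i\<in>{0..N}. ?t i)"
    by (simp add: fps_mult_nth)
  show "fps_nth (odd_fps a * even_fps b) N = fps_nth (odd_fps (\<lambda>n. \<Sum>k\<le>n. a k * b (n - k))) N"
  proof (cases "odd N")
    case False
    have "?t i = 0" if "i \<le> N" for i
      using False that by (auto simp: odd_fps_def even_fps_def)
    then have "(\<Sum>i\<in>{0..N}. ?t i) = 0" by (intro sum.neutral) auto
    then show ?thesis using False lhs by (simp add: odd_fps_def)
  next
    case True
    then obtain n where n: "N = 2 * n + 1" by (rule oddE)
    have "(\<Sum>i\<in>{0..N}. ?t i) = (\<Sum>i\<in>(\<lambda>k. 2 * k + 1) ` {..n}. ?t i)"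
      by (rule sum.mono_neutral_right)
        (auto simp: odd_fps_def n image_iff elim!: oddE)
    also have "\<dots> = (\<Sum>k\<le>n. ?t (2 * k + 1))"
      by (subst sum.reindex) (auto simp: inj_on_def)
    also have "\<dots> = (\<Sum>k\<le>n. a k * b (n - k))"
      by (rule sum.cong) (auto simp: odd_fps_def even_fps_def n diff_mult_distrib2[symmetric])
    finally show ?thesis using lhs by (simp add: n odd_fps_def)
  qed
qed

text \<open>The convolution identity is brought into the form of a product of power series by multiplying with
\<open>(-1) ^ n\<close>, which moves the sign from \<open>f k\<close> to the factor with index \<open>n - k\<close>.\<close>

lemma odd_fps_eq_divide:
  assumes "\<And>n. (\<Sum>k\<le>n. (-1) ^ k * (f k * c (n - k))) = d n" "c 0 \<noteq> 0"
  shows "odd_fps f = odd_fps (\<lambda>n. (-1) ^ n * d n) / even_fps (\<lambda>n. (-1) ^ n * c n)"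
proof -
  have "odd_fps f * even_fps (\<lambda>n. (-1) ^ n * c n) = odd_fps (\<lambda>n. (-1) ^ n * d n)"
    unfolding odd_fps_mult_even_fps
  proof (intro arg_cong[where f = odd_fps] ext)
    fix n
    have "f k * ((-1) ^ (n - k) * c (n - k)) = (-1) ^ n * ((-1) ^ k * (f k * c (n - k)))" if "k \<le> n" for k
    proof -
      have "(-1 :: real) ^ (n - k) = (-1) ^ n * (-1) ^ k"
        using that by (simp add: power_diff power_one_over[symmetric] minus_one_power_iff)
      then show ?thesis by simp
    qed
    then show "(\<Sum>k\<le>n. f k * ((-1) ^ (n - k) * c (n - k))) = (-1) ^ n * d n"
      unfolding assms(1)[symmetric] sum_distrib_left by (intro sum.cong) auto
  qed
  moreover have "even_fps (\<lambda>n. (-1) ^ n * c n) \<noteq> 0"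
    by (rule even_fps_nonzero) (simp add: assms(2))
  ultimately show ?thesis by (metis nonzero_mult_div_cancel_right)
qed


section \<open>Fillings of the strips as words\<close>

lemma alternating_odd_length:
  "alternating \<alpha> \<beta> (map g [0..<2 * n + 1]) \<longleftrightarrow>
     (\<forall>i<n. \<alpha> (g (2 * i)) (g (2 * i + 1)) \<and> \<beta> (g (2 * i + 1)) (g (2 * i + 2)))" (is "?l \<longleftrightarrow> ?r")
proof
  assume l: ?l
  show ?r
  proof (intro allI impI)
    fix i assume i: "i < n"
    then show "\<alpha> (g (2 * i)) (g (2 * i + 1)) \<and> \<beta> (g (2 * i + 1)) (g (2 * i + 2))"
      using spec[OF l[unfolded alternating_def], of "2 * i"]
        spec[OF l[unfolded alternating_def], of "2 * i + 1"] by (simp del: upt_Suc)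
  qed
next
  assume r: ?r
  show ?l unfolding alternating_def
  proof (intro allI impI)
    fix k assume k: "Suc k < length (map g [0..<2 * n + 1])"
    show "if even k then \<alpha> (map g [0..<2 * n + 1] ! k) (map g [0..<2 * n + 1] ! Suc k)
      else \<beta> (map g [0..<2 * n + 1] ! k) (map g [0..<2 * n + 1] ! Suc k)"
    proof (cases "even k")
      case True
      then obtain i where "k = 2 * i" by (rule evenE)
      then show ?thesis using r k by (simp del: upt_Suc)
    next
      case False
      then obtain i where "k = 2 * i + 1" by (rule oddE)
      then show ?thesis using r k by (simp del: upt_Suc)
    qed
  qed
qed

text \<open>The enumeration \<open>c\<close> lists the cells in the order in which the letters are read. Extensionality of the
fillings is what makes reading injective.\<close>

lemma has_sum_fillings:
  assumes q: "0 < q" "q < 1"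
    and c: "bij_betw c {..<m} S"
    and T: "T \<subseteq> S \<rightarrow>\<^sub>E UNIV"
    and cond: "\<And>\<pi>. \<pi> \<in> S \<rightarrow>\<^sub>E UNIV \<Longrightarrow> \<pi> \<in> T \<longleftrightarrow> alternating \<alpha> \<beta> (map (\<lambda>k. \<pi> (c k)) [0..<m])"
  shows "((\<lambda>\<pi>. q ^ filling_size S \<pi>) has_sum gf q (altwords \<alpha> \<beta> m)) T"
proof -
  define rd where "rd \<pi> = map (\<lambda>k. \<pi> (c k)) [0..<m]" for \<pi> :: "_ \<Rightarrow> nat"
  define wr where "wr w = (\<lambda>x\<in>S. w ! (inv_into {..<m} c x))" for w :: "nat list"
  have inv_c: "inv_into {..<m} c (c k) = k" if "k < m" for k
    using c that by (simp add: bij_betw_def)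
  have c_inv: "c (inv_into {..<m} c x) = x" "inv_into {..<m} c x < m" if "x \<in> S" for x
    using c that by (auto simp: bij_betw_def f_inv_into_f inv_into_into[of x c "{..<m}", simplified])
  have c_in: "c k \<in> S" if "k < m" for k using c that by (auto simp: bij_betw_def)
  have rd_wr: "rd (wr w) = w" if "length w = m" for w
    using that by (intro nth_equalityI) (simp_all add: rd_def wr_def c_in inv_c)
  have wr_rd: "wr (rd \<pi>) = \<pi>" if "\<pi> \<in> S \<rightarrow>\<^sub>E UNIV" for \<pi>
    using that by (auto simp: rd_def wr_def c_inv PiE_def extensional_def restrict_def fun_eq_iff)
  have wr_ext: "wr w \<in> S \<rightarrow>\<^sub>E UNIV" for w by (simp add: wr_def)
  have bij: "bij_betw rd T (altwords \<alpha> \<beta> m)"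
  proof (rule bij_betw_byWitness[where f' = wr])
    show "\<forall>\<pi>\<in>T. wr (rd \<pi>) = \<pi>" using T wr_rd by blast
    show "\<forall>w\<in>altwords \<alpha> \<beta> m. rd (wr w) = w" by (auto simp: altwords_def rd_wr)
    show "rd ` T \<subseteq> altwords \<alpha> \<beta> m"
      using T cond by (auto simp: altwords_def rd_def)
    show "wr ` altwords \<alpha> \<beta> m \<subseteq> T"
      using cond[OF wr_ext] rd_wr by (auto simp: altwords_def rd_def)
  qed
  have size: "sum_list (rd \<pi>) = filling_size S \<pi>" for \<pi>
  proof -
    have "sum_list (rd \<pi>) = (\<Sum>k<m. \<pi> (c k))"
      by (simp add: rd_def interv_sum_list_conv_sum_set_nat atLeast0LessThan)
    then show ?thesis by (simp add: filling_size_def sum.reindex_bij_betw[OF c])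
  qed
  have "((\<lambda>w. q ^ sum_list w) has_sum gf q (altwords \<alpha> \<beta> m)) (altwords \<alpha> \<beta> m)"
    by (rule has_sum_gf[OF q, of _ m]) (auto simp: altwords_def)
  then have "((\<lambda>\<pi>. q ^ sum_list (rd \<pi>)) has_sum gf q (altwords \<alpha> \<beta> m)) T"
    by (subst has_sum_reindex_bij_betw[OF bij, where f = "\<lambda>w. q ^ sum_list w"])
  then show ?thesis by (simp add: size)
qed

lemma mem_young_diagram_staircase:
  "(i, j) \<in> young_diagram (staircase m) \<longleftrightarrow> i + j + 1 < m"
  by (auto simp: young_diagram_def staircase_def rev_nth)

text \<open>The strip consists of the two outermost antidiagonals of the staircase.\<close>

lemma mem_outer_strip:
  "(i, j) \<in> outer_strip n \<longleftrightarrow> i \<le> n \<and> j \<le> n \<and> (i + j = n \<or> i + j + 1 = n)"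
  unfolding skew_shape_def Diff_iff mem_young_diagram_staircase by auto

lemma mem_inner_strip:
  "(i, j) \<in> inner_strip n \<longleftrightarrow> i \<le> n \<and> j \<le> n \<and> (i + j = n \<or> i + j = n + 1)"
proof -
  let ?p = "trimmed_staircase 1 1 (n + 3)"
  have part: "?p ! Suc i = n + 1 - i" if "i < n" for i
    using that by (simp add: trimmed_staircase_def nth_append rev_nth del: upt_Suc)
  have ends: "?p ! 0 = n + 1" "?p ! Suc n = 0" "length ?p = n + 2"
    by (simp_all add: trimmed_staircase_def nth_append del: upt_Suc)
  have "(i, j) \<in> young_diagram ?p \<longleftrightarrow> i \<le> n \<and> j < (if i = 0 then n + 1 else n + 2 - i)"
  proof -
    consider "i = 0" | k where "i = Suc k" "k < n" | "i = Suc n" | "i > Suc n"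
      by (cases i) (auto, metis linorder_neqE_nat)
    then show ?thesis
      by cases (use ends part in \<open>auto simp: young_diagram_def simp del: One_nat_def\<close>)
  qed
  then show ?thesis
    unfolding skew_shape_def Diff_iff mem_young_diagram_staircase by auto
qed

text \<open>The cells are read from the top right corner \<open>(0, n)\<close> to the bottom left corner \<open>(n, 0)\<close>, alternately one
step to the left and one step down. A step to the left reverses the row relation.\<close>

lemma has_sum_outer_tableaux:
  assumes q: "0 < q" "q < 1"
  shows "((\<lambda>\<pi>. q ^ filling_size (outer_strip n) \<pi>) has_sum
           gf q (altwords (\<lambda>x y. R y x) C (2 * n + 1))) (tableaux R C (outer_strip n))"
proof (rule has_sum_fillings[OF q])
  let ?c = "\<lambda>k. (k div 2, n - (k + 1) div 2)"
  \<comment> \<open>The number of a cell in the reading order is its distance from \<open>(0, n)\<close>.\<close>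
  let ?d = "\<lambda>(i, j). i + (n - j)"
  show "bij_betw ?c {..<2 * n + 1} (outer_strip n)"
  proof (rule bij_betw_byWitness[where f' = ?d])
    show "\<forall>k\<in>{..<2 * n + 1}. ?d (?c k) = k" by auto
    show "\<forall>x\<in>outer_strip n. ?c (?d x) = x"
    proof
      fix x assume x: "x \<in> outer_strip n"
      obtain i j where ij: "x = (i, j)" by force
      then have *: "i \<le> n" "j \<le> n" "i + j = n \<or> i + j + 1 = n" using x mem_outer_strip by blast+
      show "?c (?d x) = x"
      proof (cases "i + j = n")
        case True
        then have "i + (n - j) = 2 * i" "n - i = j" by auto
        then show ?thesis by (simp add: ij)
      next
        case False
        with * have "i + (n - j) = 2 * i + 1" "n - (i + 1) = j" by auto
        then show ?thesis by (simp add: ij)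
      qed
    qed
    show "?c ` {..<2 * n + 1} \<subseteq> outer_strip n"
    proof
      fix x assume "x \<in> ?c ` {..<2 * n + 1}"
      then obtain k where k: "k < 2 * n + 1" "x = ?c k" by auto
      obtain i where "k = 2 * i \<or> k = 2 * i + 1" by (metis evenE oddE)
      then show "x \<in> outer_strip n" unfolding k(2) mem_outer_strip using k(1) by auto
    qed
    show "?d ` outer_strip n \<subseteq> {..<2 * n + 1}"
    proof
      fix k assume "k \<in> ?d ` outer_strip n"
      then obtain i j where "(i, j) \<in> outer_strip n" "k = i + (n - j)" by auto
      then show "k \<in> {..<2 * n + 1}" unfolding mem_outer_strip by auto
    qed
  qed
  show "tableaux R C (outer_strip n) \<subseteq> outer_strip n \<rightarrow>\<^sub>E UNIV" by (auto simp: tableaux_def)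
  fix \<pi> :: "nat \<times> nat \<Rightarrow> nat" assume "\<pi> \<in> outer_strip n \<rightarrow>\<^sub>E UNIV"
  then have "\<pi> \<in> tableaux R C (outer_strip n) \<longleftrightarrow>
     (\<forall>i j j'. (i, j) \<in> outer_strip n \<and> (i, j') \<in> outer_strip n \<and> j < j' \<longrightarrow> R (\<pi> (i, j)) (\<pi> (i, j'))) \<and>
     (\<forall>i i' j. (i, j) \<in> outer_strip n \<and> (i', j) \<in> outer_strip n \<and> i < i' \<longrightarrow> C (\<pi> (i, j)) (\<pi> (i', j)))"
    by (simp add: tableaux_def)
  also have "(\<forall>i j j'. (i, j) \<in> outer_strip n \<and> (i, j') \<in> outer_strip n \<and> j < j' \<longrightarrow> R (\<pi> (i, j)) (\<pi> (i, j')))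
      \<longleftrightarrow> (\<forall>i<n. R (\<pi> (i, n - Suc i)) (\<pi> (i, n - i)))"
  proof -
    have "(i, j) \<in> outer_strip n \<and> (i, j') \<in> outer_strip n \<and> j < j' \<longleftrightarrow> i < n \<and> j = n - Suc i \<and> j' = n - i" for i j j'
      unfolding mem_outer_strip by auto
    then show ?thesis by auto
  qed
  also have "(\<forall>i i' j. (i, j) \<in> outer_strip n \<and> (i', j) \<in> outer_strip n \<and> i < i' \<longrightarrow> C (\<pi> (i, j)) (\<pi> (i', j)))
      \<longleftrightarrow> (\<forall>i<n. C (\<pi> (i, n - Suc i)) (\<pi> (Suc i, n - Suc i)))"
  proof -
    have "(i, j) \<in> outer_strip n \<and> (i', j) \<in> outer_strip n \<and> i < i' \<longleftrightarrow> i < n \<and> i' = Suc i \<and> j = n - Suc i" for i i' j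
      unfolding mem_outer_strip by auto
    then show ?thesis by auto
  qed
  finally show "\<pi> \<in> tableaux R C (outer_strip n) \<longleftrightarrow>
      alternating (\<lambda>x y. R y x) C (map (\<lambda>k. \<pi> (?c k)) [0..<2 * n + 1])"
    unfolding alternating_odd_length by auto
qed

text \<open>The reading order again leads from \<open>(0, n)\<close> to \<open>(n, 0)\<close>, but the first step goes down.\<close>

lemma has_sum_inner_tableaux:
  assumes q: "0 < q" "q < 1"
  shows "((\<lambda>\<pi>. q ^ filling_size (inner_strip n) \<pi>) has_sum
           gf q (altwords C (\<lambda>x y. R y x) (2 * n + 1))) (tableaux R C (inner_strip n))"
proof (rule has_sum_fillings[OF q])
  let ?c = "\<lambda>k. ((k + 1) div 2, n - k div 2)"
  let ?d = "\<lambda>(i, j). i + (n - j)"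
  show "bij_betw ?c {..<2 * n + 1} (inner_strip n)"
  proof (rule bij_betw_byWitness[where f' = ?d])
    show "\<forall>k\<in>{..<2 * n + 1}. ?d (?c k) = k" by auto
    show "\<forall>x\<in>inner_strip n. ?c (?d x) = x"
    proof
      fix x assume x: "x \<in> inner_strip n"
      obtain i j where ij: "x = (i, j)" by force
      then have *: "i \<le> n" "j \<le> n" "i + j = n \<or> i + j = n + 1" using x mem_inner_strip by blast+
      show "?c (?d x) = x"
      proof (cases "i + j = n")
        case True
        then have "i + (n - j) = 2 * i" "n - i = j" by auto
        then show ?thesis by (simp add: ij)
      next
        case False
        with * obtain k where "i = Suc k" "k + j = n" by (cases i) auto
        then have "i + (n - j) = 2 * k + 1" "n - k = j" by auto
        then show ?thesis using \<open>i = Suc k\<close> by (simp add: ij)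
      qed
    qed
    show "?c ` {..<2 * n + 1} \<subseteq> inner_strip n"
    proof
      fix x assume "x \<in> ?c ` {..<2 * n + 1}"
      then obtain k where k: "k < 2 * n + 1" "x = ?c k" by auto
      obtain i where "k = 2 * i \<or> k = 2 * i + 1" by (metis evenE oddE)
      then show "x \<in> inner_strip n" unfolding k(2) mem_inner_strip using k(1) by auto
    qed
    show "?d ` inner_strip n \<subseteq> {..<2 * n + 1}"
    proof
      fix k assume "k \<in> ?d ` inner_strip n"
      then obtain i j where "(i, j) \<in> inner_strip n" "k = i + (n - j)" by auto
      then show "k \<in> {..<2 * n + 1}" unfolding mem_inner_strip by auto
    qed
  qed
  show "tableaux R C (inner_strip n) \<subseteq> inner_strip n \<rightarrow>\<^sub>E UNIV" by (auto simp: tableaux_def)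
  fix \<pi> :: "nat \<times> nat \<Rightarrow> nat" assume "\<pi> \<in> inner_strip n \<rightarrow>\<^sub>E UNIV"
  then have "\<pi> \<in> tableaux R C (inner_strip n) \<longleftrightarrow>
     (\<forall>i j j'. (i, j) \<in> inner_strip n \<and> (i, j') \<in> inner_strip n \<and> j < j' \<longrightarrow> R (\<pi> (i, j)) (\<pi> (i, j'))) \<and>
     (\<forall>i i' j. (i, j) \<in> inner_strip n \<and> (i', j) \<in> inner_strip n \<and> i < i' \<longrightarrow> C (\<pi> (i, j)) (\<pi> (i', j)))"
    by (simp add: tableaux_def)
  also have "(\<forall>i j j'. (i, j) \<in> inner_strip n \<and> (i, j') \<in> inner_strip n \<and> j < j' \<longrightarrow> R (\<pi> (i, j)) (\<pi> (i, j')))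
      \<longleftrightarrow> (\<forall>i<n. R (\<pi> (Suc i, n - Suc i)) (\<pi> (Suc i, n - i)))"
  proof -
    have "(i, j) \<in> inner_strip n \<and> (i, j') \<in> inner_strip n \<and> j < j' \<longleftrightarrow>
        (\<exists>k<n. i = Suc k \<and> j = n - Suc k \<and> j' = n - k)" for i j j'
      unfolding mem_inner_strip by (cases i) auto
    then show ?thesis by auto
  qed
  also have "(\<forall>i i' j. (i, j) \<in> inner_strip n \<and> (i', j) \<in> inner_strip n \<and> i < i' \<longrightarrow> C (\<pi> (i, j)) (\<pi> (i', j)))
      \<longleftrightarrow> (\<forall>i<n. C (\<pi> (i, n - i)) (\<pi> (Suc i, n - i)))"
  proof -
    have "(i, j) \<in> inner_strip n \<and> (i', j) \<in> inner_strip n \<and> i < i' \<longleftrightarrow> i < n \<and> i' = Suc i \<and> j = n - i" for i i' j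
      unfolding mem_inner_strip by auto
    then show ?thesis by auto
  qed
  finally show "\<pi> \<in> tableaux R C (inner_strip n) \<longleftrightarrow>
      alternating C (\<lambda>x y. R y x) (map (\<lambda>k. \<pi> (?c k)) [0..<2 * n + 1])"
    unfolding alternating_odd_length by auto
qed


section \<open>Standardization and the major index\<close>

definition precedes :: "(nat \<Rightarrow> nat) \<Rightarrow> nat list \<Rightarrow> nat \<Rightarrow> nat \<Rightarrow> bool" where
  "precedes \<omega> w i j \<longleftrightarrow> w ! (i - 1) > w ! (j - 1) \<or> w ! (i - 1) = w ! (j - 1) \<and> \<omega> i < \<omega> j"

text \<open>The letter at position \<open>j\<close> is the \<open>std_perm \<omega> w j\<close>-th in the sorted order. Outside the positions of \<open>w\<close> the
function is the identity, so that it permutes \<open>{1..length w}\<close>.\<close>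

definition std_perm :: "(nat \<Rightarrow> nat) \<Rightarrow> nat list \<Rightarrow> nat \<Rightarrow> nat" where
  "std_perm \<omega> w j = (if j \<in> {1..length w} then card {i \<in> {1..length w}. i = j \<or> precedes \<omega> w i j} else j)"

lemma precedes_irrefl: "\<not> precedes \<omega> w i i"
  by (simp add: precedes_def)

lemma precedes_trans: "precedes \<omega> w i j \<Longrightarrow> precedes \<omega> w j k \<Longrightarrow> precedes \<omega> w i k"
  by (auto simp: precedes_def)

lemma precedes_total: "inj \<omega> \<Longrightarrow> i \<noteq> j \<Longrightarrow> precedes \<omega> w i j \<or> precedes \<omega> w j i"
  unfolding precedes_def by (metis injD linorder_neqE_nat)

lemma permutation_eq_rank:
  fixes less :: "nat \<Rightarrow> nat \<Rightarrow> bool"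
  assumes \<pi>: "\<pi> permutes {1..m}" and less: "\<And>i j. i \<in> {1..m} \<Longrightarrow> j \<in> {1..m} \<Longrightarrow> \<pi> i < \<pi> j \<longleftrightarrow> less i j"
    and j: "j \<in> {1..m}"
  shows "\<pi> j = card {i \<in> {1..m}. i = j \<or> less i j}"
proof -
  have "{i \<in> {1..m}. i = j \<or> less i j} = {i \<in> {1..m}. \<pi> i \<le> \<pi> j}"
    using less j permutes_inj[OF \<pi>] by (auto simp: le_less inj_eq)
  moreover have "\<pi> ` {i \<in> {1..m}. \<pi> i \<le> \<pi> j} = {1..\<pi> j}"
  proof (intro equalityI subsetI)
    fix x assume "x \<in> \<pi> ` {i \<in> {1..m}. \<pi> i \<le> \<pi> j}"
    then show "x \<in> {1..\<pi> j}" using permutes_in_image[OF \<pi>] by force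
  next
    fix x assume x: "x \<in> {1..\<pi> j}"
    then have "x \<in> {1..m}" using permutes_in_image[OF \<pi>, of j] j by auto
    then obtain i where "i \<in> {1..m}" "x = \<pi> i" using permutes_image[OF \<pi>] by blast
    then show "x \<in> \<pi> ` {i \<in> {1..m}. \<pi> i \<le> \<pi> j}" using x by auto
  qed
  ultimately show ?thesis
    by (metis card_atLeastAtMost card_image diff_Suc_1 permutes_inj_on[OF \<pi>])
qed

lemma std_perm_less_iff:
  assumes "inj \<omega>" "i \<in> {1..length w}" "j \<in> {1..length w}"
  shows "std_perm \<omega> w i < std_perm \<omega> w j \<longleftrightarrow> precedes \<omega> w i j"
proof -
  have mono: "std_perm \<omega> w i < std_perm \<omega> w j"
    if "precedes \<omega> w i j" "i \<in> {1..length w}" "j \<in> {1..length w}" for i j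
  proof -
    have "{k \<in> {1..length w}. k = i \<or> precedes \<omega> w k i} \<subset> {k \<in> {1..length w}. k = j \<or> precedes \<omega> w k j}"
    proof
      show "{k \<in> {1..length w}. k = i \<or> precedes \<omega> w k i} \<subseteq> {k \<in> {1..length w}. k = j \<or> precedes \<omega> w k j}"
        using that precedes_trans by blast
      have "j \<noteq> i" "\<not> precedes \<omega> w j i"
        using that(1) precedes_irrefl precedes_trans by blast+
      then show "{k \<in> {1..length w}. k = i \<or> precedes \<omega> w k i} \<noteq> {k \<in> {1..length w}. k = j \<or> precedes \<omega> w k j}"
        using that(3) by blast
    qed
    then have "card {k \<in> {1..length w}. k = i \<or> precedes \<omega> w k i}
        < card {k \<in> {1..length w}. k = j \<or> precedes \<omega> w k j}"
      by (rule psubset_card_mono[rotated]) simp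
    then show ?thesis unfolding std_perm_def using that by simp
  qed
  show ?thesis
    using mono[of i j] mono[of j i] precedes_total[OF assms(1), of i j w] assms(2,3)
    by (cases "i = j") (auto simp: precedes_irrefl)
qed

lemma std_perm_permutes:
  assumes "inj \<omega>"
  shows "std_perm \<omega> w permutes {1..length w}"
proof (rule bij_imp_permutes)
  have inj: "inj_on (std_perm \<omega> w) {1..length w}"
  proof (rule inj_onI)
    fix i j assume ij: "i \<in> {1..length w}" "j \<in> {1..length w}" "std_perm \<omega> w i = std_perm \<omega> w j"
    show "i = j"
    proof (rule ccontr)
      assume "i \<noteq> j"
      then have "precedes \<omega> w i j \<or> precedes \<omega> w j i" by (rule precedes_total[OF assms])
      then show False using std_perm_less_iff[OF assms, of i w j] std_perm_less_iff[OF assms, of j w i] ij by auto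
    qed
  qed
  have "std_perm \<omega> w j \<in> {1..length w}" if j: "j \<in> {1..length w}" for j
  proof -
    let ?X = "{i \<in> {1..length w}. i = j \<or> precedes \<omega> w i j}"
    have "card ?X \<le> card {1..length w}" by (rule card_mono) auto
    moreover have "card ?X > 0" using j by (auto simp: card_gt_0_iff)
    ultimately show ?thesis unfolding std_perm_def using j by simp
  qed
  then have "std_perm \<omega> w ` {1..length w} \<subseteq> {1..length w}" by blast
  then show "bij_betw (std_perm \<omega> w) {1..length w} {1..length w}"
    using inj endo_inj_surj[of "{1..length w}"] by (simp add: bij_betw_def)
qed (auto simp: std_perm_def)

text \<open>The word \<open>map (\<lambda>i. w ! (\<sigma> i - 1)) [1..<length w + 1]\<close> lists the letters in the order that the
permutation prescribes. It is the sorted order exactly when it decreases weakly and every place at which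
the labels would break a tie the wrong way has a strict descent.\<close>

lemma std_perm_eq_iff_chain:
  assumes \<pi>: "\<pi> permutes {1..length w}" and \<omega>: "inj \<omega>"
  defines "\<sigma> \<equiv> inv \<pi>"
  shows "std_perm \<omega> w = \<pi> \<longleftrightarrow>
    chain (\<lambda>i. \<omega> (\<sigma> (i + 1)) > \<omega> (\<sigma> (i + 2))) (map (\<lambda>i. w ! (\<sigma> i - 1)) [1..<length w + 1])"
    (is "_ \<longleftrightarrow> chain ?r ?v")
proof -
  let ?m = "length w"
  have \<sigma>: "\<sigma> permutes {1..?m}" unfolding \<sigma>_def by (rule permutes_inv[OF \<pi>])
  have \<pi>\<sigma>: "\<pi> (\<sigma> i) = i" and \<sigma>\<pi>: "\<sigma> (\<pi> i) = i" for i
    unfolding \<sigma>_def using permutes_inverses[OF \<pi>] by auto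
  have \<sigma>_in: "\<sigma> i \<in> {1..?m} \<longleftrightarrow> i \<in> {1..?m}" for i by (rule permutes_in_image[OF \<sigma>])
  have nth: "?v ! i = w ! (\<sigma> (i + 1) - 1)" if "i < ?m" for i
    using that by (simp del: upt_Suc)
  have chain_iff: "chain ?r ?v \<longleftrightarrow> (\<forall>i. Suc i < ?m \<longrightarrow> precedes \<omega> w (\<sigma> (i + 1)) (\<sigma> (i + 2)))"
  proof -
    have "(if ?r i then ?v ! i > ?v ! Suc i else ?v ! i \<ge> ?v ! Suc i)
        \<longleftrightarrow> precedes \<omega> w (\<sigma> (i + 1)) (\<sigma> (i + 2))" if i: "Suc i < ?m" for i
    proof -
      have "\<sigma> (i + 1) \<noteq> \<sigma> (i + 2)" using permutes_inj[OF \<sigma>] by (simp add: inj_eq)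
      then have "\<omega> (\<sigma> (i + 1)) \<noteq> \<omega> (\<sigma> (i + 2))" using \<omega> by (simp add: inj_eq)
      moreover have "?v ! i = w ! (\<sigma> (i + 1) - 1)" "?v ! Suc i = w ! (\<sigma> (i + 2) - 1)"
        using nth[of i] nth[of "Suc i"] i by simp_all
      ultimately show ?thesis unfolding precedes_def by auto
    qed
    moreover have "length ?v = ?m" by (simp del: upt_Suc)
    ultimately show ?thesis unfolding chain_def by simp
  qed
  show ?thesis unfolding chain_iff
  proof
    assume eq: "std_perm \<omega> w = \<pi>"
    show "\<forall>i. Suc i < ?m \<longrightarrow> precedes \<omega> w (\<sigma> (i + 1)) (\<sigma> (i + 2))"
    proof (intro allI impI)
      fix i assume "Suc i < ?m"
      then have "\<sigma> (i + 1) \<in> {1..?m}" "\<sigma> (i + 2) \<in> {1..?m}" unfolding \<sigma>_in by auto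
      then show "precedes \<omega> w (\<sigma> (i + 1)) (\<sigma> (i + 2))"
        using std_perm_less_iff[OF \<omega>, of "\<sigma> (i + 1)" w "\<sigma> (i + 2)"] by (simp add: eq \<pi>\<sigma>)
    qed
  next
    assume step: "\<forall>i. Suc i < ?m \<longrightarrow> precedes \<omega> w (\<sigma> (i + 1)) (\<sigma> (i + 2))"
    have mono: "precedes \<omega> w (\<sigma> a) (\<sigma> b)" if "1 \<le> a" "Suc a \<le> b" "b \<le> ?m" for a b
      using that(2,3)
    proof (induction b rule: dec_induct)
      case base
      then show ?case using step[rule_format, of "a - 1"] that(1) by simp
    next
      case (step b)
      have "precedes \<omega> w (\<sigma> b) (\<sigma> (Suc b))"
        using \<open>\<forall>i. _ i\<close>[rule_format, of "b - 1"] step that(1) by simp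
      then show ?case using step precedes_trans by auto
    qed
    have less: "\<pi> i < \<pi> j \<longleftrightarrow> precedes \<omega> w i j" if ij: "i \<in> {1..?m}" "j \<in> {1..?m}" for i j
    proof -
      have fwd: "precedes \<omega> w i j" if "\<pi> i < \<pi> j" "i \<in> {1..?m}" "j \<in> {1..?m}" for i j
      proof -
        have "\<pi> i \<in> {1..?m}" "\<pi> j \<in> {1..?m}"
          using that(2,3) unfolding permutes_in_image[OF \<pi>] by blast+
        then have "precedes \<omega> w (\<sigma> (\<pi> i)) (\<sigma> (\<pi> j))" using that(1) by (intro mono) auto
        then show ?thesis by (simp only: \<sigma>\<pi>)
      qed
      consider "\<pi> i < \<pi> j" | "\<pi> j < \<pi> i" | "i = j"
        using permutes_inj[OF \<pi>] by (metis injD linorder_neqE_nat)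
      then show ?thesis
      proof cases
        case 2
        then have "precedes \<omega> w j i" using fwd ij by blast
        then have "\<not> precedes \<omega> w i j" using precedes_irrefl precedes_trans by blast
        then show ?thesis using 2 by simp
      qed (use fwd ij in \<open>simp_all add: precedes_irrefl\<close>)
    qed
    show "std_perm \<omega> w = \<pi>"
    proof
      fix j
      show "std_perm \<omega> w j = \<pi> j"
      proof (cases "j \<in> {1..?m}")
        case True
        then show ?thesis
          using permutation_eq_rank[OF \<pi> less, of j] by (simp add: std_perm_def)
      next
        case False
        then show ?thesis using permutes_not_in[OF \<pi>] by (simp add: std_perm_def del: atLeastAtMost_iff)
      qed
    qed
  qed
qed

context
  fixes q :: real
  assumes q: "0 < q" "q < 1"
begin

text \<open>Permuting the letters of a word keeps their sum, so the words sorted by \<open>\<pi>\<close> have the same generating function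
as the decreasing sequences with strict descents at the descents of \<open>\<omega> \<circ> inv \<pi>\<close>. The positions of these
descents add up to the major index.\<close>

lemma gf_std_perm_fibre:
  assumes \<pi>: "\<pi> permutes {1..m}" and \<omega>: "inj \<omega>"
  shows "gf q {w. length w = m \<and> std_perm \<omega> w = \<pi>} = q ^ maj (word m (\<omega> \<circ> inv \<pi>)) / qpoch q q m"
proof -
  define r where "r i \<longleftrightarrow> \<omega> (inv \<pi> (i + 1)) > \<omega> (inv \<pi> (i + 2))" for i
  define permute where "permute \<tau> w = map (\<lambda>i. w ! (\<tau> i - 1)) [1..<m + 1]" for \<tau> and w :: "nat list"
  have inv_\<pi>: "inv \<pi> permutes {1..m}" by (rule permutes_inv[OF \<pi>])
  have in_range: "\<tau> (Suc k) - 1 < m \<and> Suc (\<tau> (Suc k) - 1) = \<tau> (Suc k)" if "\<tau> permutes {1..m}" "k < m" for \<tau> k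
    using permutes_in_image[OF that(1), of "Suc k"] that(2) by auto
  have nth: "permute \<tau> w ! k = w ! (\<tau> (Suc k) - 1)" if "k < m" for \<tau> w k
    using that by (simp add: permute_def del: upt_Suc)
  have len: "length (permute \<tau> w) = m" for \<tau> w by (simp add: permute_def)
  have cancel: "permute \<tau> (permute \<rho> w) = w"
    if "\<tau> permutes {1..m}" "\<rho> permutes {1..m}" "\<And>i. \<rho> (\<tau> i) = i" "length w = m" for \<tau> \<rho> w
  proof (rule nth_equalityI)
    fix k assume "k < length (permute \<tau> (permute \<rho> w))"
    then have k: "k < m" by (simp add: len)
    then show "permute \<tau> (permute \<rho> w) ! k = w ! k"
      using in_range[OF that(1) k] by (simp add: nth that(3))
  qed (simp add: len that)
  have "bij_betw (permute (inv \<pi>)) {w. length w = m \<and> std_perm \<omega> w = \<pi>} {v. length v = m \<and> chain r v}"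
  proof (rule bij_betw_byWitness[where f' = "permute \<pi>"])
    have std: "std_perm \<omega> w = \<pi> \<longleftrightarrow> chain r (permute (inv \<pi>) w)" if "length w = m" for w
      using std_perm_eq_iff_chain[of \<pi> w \<omega>] \<pi> \<omega> that by (simp add: r_def[abs_def] permute_def del: upt_Suc)
    have c1: "permute \<pi> (permute (inv \<pi>) w) = w" if "length w = m" for w
      by (rule cancel[OF \<pi> inv_\<pi> _ that]) (simp add: permutes_inverses[OF \<pi>])
    have c2: "permute (inv \<pi>) (permute \<pi> w) = w" if "length w = m" for w
      by (rule cancel[OF inv_\<pi> \<pi> _ that]) (simp add: permutes_inverses[OF \<pi>])
    show "\<forall>w\<in>{w. length w = m \<and> std_perm \<omega> w = \<pi>}. permute \<pi> (permute (inv \<pi>) w) = w"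
      "\<forall>v\<in>{v. length v = m \<and> chain r v}. permute (inv \<pi>) (permute \<pi> v) = v"
      using c1 c2 by simp_all
    show "permute (inv \<pi>) ` {w. length w = m \<and> std_perm \<omega> w = \<pi>} \<subseteq> {v. length v = m \<and> chain r v}"
      using std by (auto simp: len)
    show "permute \<pi> ` {v. length v = m \<and> chain r v} \<subseteq> {w. length w = m \<and> std_perm \<omega> w = \<pi>}"
      using std[of "permute \<pi> _"] c2 by (auto simp: len)
  qed
  moreover have "sum_list (permute (inv \<pi>) w) = sum_list w" if "length w = m" for w
  proof -
    have "sum_list (permute (inv \<pi>) w) = (\<Sum>i\<in>{1..m}. w ! (inv \<pi> i - 1))"
      by (simp add: permute_def interv_sum_list_conv_sum_set_nat atLeastLessThanSuc_atLeastAtMost del: upt_Suc)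
    also have "\<dots> = (\<Sum>i\<in>{1..m}. w ! (i - 1))"
      using sum.permute[OF inv_\<pi>, of "\<lambda>i. w ! (i - 1)"] by (simp add: o_def)
    also have "\<dots> = (\<Sum>k<m. w ! k)"
      by (rule sum.reindex_bij_witness[of _ Suc "\<lambda>i. i - 1"]) auto
    also have "\<dots> = sum_list w" using that by (simp add: sum_list_sum_nth atLeast0LessThan)
    finally show ?thesis .
  qed
  ultimately have "gf q {w. length w = m \<and> std_perm \<omega> w = \<pi>} = gf q {v. length v = m \<and> chain r v}"
    by (intro gf_bij[OF q, where g = "permute (inv \<pi>)", symmetric]) auto
  moreover have "(\<Sum>i | Suc i < m \<and> r i. Suc i) = maj (word m (\<omega> \<circ> inv \<pi>))"
  proof -
    have w: "word m (\<omega> \<circ> inv \<pi>) ! k = \<omega> (inv \<pi> (Suc k))" if "k < m" for k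
      using that by (simp add: word_def del: upt_Suc)
    have "{i \<in> {1..<m}. word m (\<omega> \<circ> inv \<pi>) ! (i - 1) > word m (\<omega> \<circ> inv \<pi>) ! i} = Suc ` {i. Suc i < m \<and> r i}"
    proof (intro equalityI subsetI)
      fix i assume i: "i \<in> {i \<in> {1..<m}. word m (\<omega> \<circ> inv \<pi>) ! (i - 1) > word m (\<omega> \<circ> inv \<pi>) ! i}"
      then obtain k where "i = Suc k" by (cases i) auto
      with i show "i \<in> Suc ` {i. Suc i < m \<and> r i}" by (auto simp: w r_def)
    qed (auto simp: w r_def)
    moreover have "length (word m (\<omega> \<circ> inv \<pi>)) = m" by (simp add: word_def)
    ultimately show ?thesis
      by (simp add: maj_def sum.reindex)
  qed
  ultimately show ?thesis by (simp add: gf_chain[OF q])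
qed

lemma gf_std_perm:
  assumes \<omega>: "inj \<omega>" and S: "S \<subseteq> {\<pi>. \<pi> permutes {1..m}}"
  shows "gf q {w. length w = m \<and> std_perm \<omega> w \<in> S} = (\<Sum>\<pi>\<in>S. q ^ maj (word m (\<omega> \<circ> inv \<pi>))) / qpoch q q m"
proof -
  have "finite S" by (rule finite_subset[OF S]) (simp add: finite_permutations)
  moreover have "{w. length w = m \<and> std_perm \<omega> w \<in> S} = (\<Union>\<pi>\<in>S. {w. length w = m \<and> std_perm \<omega> w = \<pi>})"
    by auto
  ultimately have "gf q {w. length w = m \<and> std_perm \<omega> w \<in> S} = (\<Sum>\<pi>\<in>S. gf q {w. length w = m \<and> std_perm \<omega> w = \<pi>})"
    by (simp only:) (rule gf_UN[OF q, of _ _ m]; auto)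
  then show ?thesis
    using S gf_std_perm_fibre[OF _ \<omega>] by (simp add: sum_divide_distrib subset_iff)
qed

text \<open>The hypotheses say how ties have to be broken: if \<open>\<alpha>\<close> allows equal letters, the first of the two positions
must have the smaller label, otherwise the larger one; for \<open>\<beta>\<close> it is the other way round. Then the
alternation of \<open>w\<close> depends only on the permutation that sorts \<open>w\<close>.\<close>

lemma gf_altwords_maj_Alt:
  assumes \<omega>: "inj \<omega>"
    and \<alpha>: "\<And>k x y. k < n \<Longrightarrow> \<alpha> x y \<longleftrightarrow> x > y \<or> x = y \<and> \<omega> (2 * k + 1) < \<omega> (2 * k + 2)"
    and \<beta>: "\<And>k x y. k < n \<Longrightarrow> \<beta> x y \<longleftrightarrow> x < y \<or> x = y \<and> \<omega> (2 * k + 3) < \<omega> (2 * k + 2)"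
  shows "gf q (altwords \<alpha> \<beta> (2 * n + 1)) =
    (\<Sum>\<pi>\<in>Alt (2 * n + 1). q ^ maj (word (2 * n + 1) (\<omega> \<circ> inv \<pi>))) / qpoch q q (2 * n + 1)"
proof -
  have "alternating \<alpha> \<beta> w \<longleftrightarrow> std_perm \<omega> w \<in> Alt (2 * n + 1)" if len: "length w = 2 * n + 1" for w
  proof -
    have w: "w = map (nth w) [0..<2 * n + 1]" using len map_nth[of w] by simp
    have word: "word (2 * n + 1) \<pi> = map (\<lambda>k. \<pi> (k + 1)) [0..<2 * n + 1]" for \<pi>
      by (rule nth_equalityI) (simp_all add: word_def del: upt_Suc)
    have "std_perm \<omega> w permutes {1..2 * n + 1}" using std_perm_permutes[OF \<omega>, of w] len by simp
    then have "std_perm \<omega> w \<in> Alt (2 * n + 1) \<longleftrightarrow>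
      (\<forall>k<n. precedes \<omega> w (2 * k + 1) (2 * k + 2) \<and> precedes \<omega> w (2 * k + 3) (2 * k + 2))"
      unfolding Alt_def word alternating_odd_length
      by (simp add: std_perm_less_iff[OF \<omega>] len numeral_3_eq_3)
    moreover have "precedes \<omega> w (2 * k + 1) (2 * k + 2) \<longleftrightarrow> \<alpha> (w ! (2 * k)) (w ! (2 * k + 1))"
      "precedes \<omega> w (2 * k + 3) (2 * k + 2) \<longleftrightarrow> \<beta> (w ! (2 * k + 1)) (w ! (2 * k + 2))" if "k < n" for k
      using \<alpha>[OF that] \<beta>[OF that] by (auto simp: precedes_def)
    moreover have "alternating \<alpha> \<beta> w \<longleftrightarrow> (\<forall>k<n. \<alpha> (w ! (2 * k)) (w ! (2 * k + 1)) \<and> \<beta> (w ! (2 * k + 1)) (w ! (2 * k + 2)))"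
      by (subst w, subst alternating_odd_length) simp
    ultimately show ?thesis by simp
  qed
  then have "altwords \<alpha> \<beta> (2 * n + 1) = {w. length w = 2 * n + 1 \<and> std_perm \<omega> w \<in> Alt (2 * n + 1)}"
    by (auto simp: altwords_def)
  then show ?thesis by (simp only:) (rule gf_std_perm[OF \<omega>], auto simp: Alt_def)
qed

lemma gf_altwords_maj_Ralt:
  assumes \<omega>: "inj \<omega>"
    and \<alpha>: "\<And>k x y. k < n \<Longrightarrow> \<alpha> x y \<longleftrightarrow> x < y \<or> x = y \<and> \<omega> (2 * k + 2) < \<omega> (2 * k + 1)"
    and \<beta>: "\<And>k x y. k < n \<Longrightarrow> \<beta> x y \<longleftrightarrow> x > y \<or> x = y \<and> \<omega> (2 * k + 2) < \<omega> (2 * k + 3)"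
  shows "gf q (altwords \<alpha> \<beta> (2 * n + 1)) =
    (\<Sum>\<pi>\<in>Ralt (2 * n + 1). q ^ maj (word (2 * n + 1) (\<omega> \<circ> inv \<pi>))) / qpoch q q (2 * n + 1)"
proof -
  have "alternating \<alpha> \<beta> w \<longleftrightarrow> std_perm \<omega> w \<in> Ralt (2 * n + 1)" if len: "length w = 2 * n + 1" for w
  proof -
    have w: "w = map (nth w) [0..<2 * n + 1]" using len map_nth[of w] by simp
    have word: "word (2 * n + 1) \<pi> = map (\<lambda>k. \<pi> (k + 1)) [0..<2 * n + 1]" for \<pi>
      by (rule nth_equalityI) (simp_all add: word_def del: upt_Suc)
    have "std_perm \<omega> w permutes {1..2 * n + 1}" using std_perm_permutes[OF \<omega>, of w] len by simp
    then have "std_perm \<omega> w \<in> Ralt (2 * n + 1) \<longleftrightarrow>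
      (\<forall>k<n. precedes \<omega> w (2 * k + 2) (2 * k + 1) \<and> precedes \<omega> w (2 * k + 2) (2 * k + 3))"
      unfolding Ralt_def word alternating_odd_length
      by (simp add: std_perm_less_iff[OF \<omega>] len numeral_3_eq_3)
    moreover have "precedes \<omega> w (2 * k + 2) (2 * k + 1) \<longleftrightarrow> \<alpha> (w ! (2 * k)) (w ! (2 * k + 1))"
      "precedes \<omega> w (2 * k + 2) (2 * k + 3) \<longleftrightarrow> \<beta> (w ! (2 * k + 1)) (w ! (2 * k + 2))" if "k < n" for k
      using \<alpha>[OF that] \<beta>[OF that] by (auto simp: precedes_def)
    moreover have "alternating \<alpha> \<beta> w \<longleftrightarrow> (\<forall>k<n. \<alpha> (w ! (2 * k)) (w ! (2 * k + 1)) \<and> \<beta> (w ! (2 * k + 1)) (w ! (2 * k + 2)))"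
      by (subst w, subst alternating_odd_length) simp
    ultimately show ?thesis by simp
  qed
  then have "altwords \<alpha> \<beta> (2 * n + 1) = {w. length w = 2 * n + 1 \<and> std_perm \<omega> w \<in> Ralt (2 * n + 1)}"
    by (auto simp: altwords_def)
  then show ?thesis by (simp only:) (rule gf_std_perm[OF \<omega>], auto simp: Ralt_def)
qed

end

lemma eta_apply: "eta n i = (if i \<in> {1..2 * n} then if odd i then i + 1 else i - 1 else i)"
proof (induction n arbitrary: i)
  case (Suc n)
  have "eta (Suc n) i = eta n (Transposition.transpose (2 * n + 1) (2 * n + 2) i)" by simp
  then show ?case unfolding Suc Transposition.transpose_def by auto
qed simp

lemma kappa_apply: "kappa n i = (if i \<in> {2..2 * n + 1} then if even i then i + 1 else i - 1 else i)"
proof (induction n arbitrary: i)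
  case (Suc n)
  have "kappa (Suc n) i = kappa n (Transposition.transpose (2 * n + 2) (2 * n + 3) i)" by simp
  then show ?case unfolding Suc Transposition.transpose_def by auto
qed simp

lemma inj_eta: "inj (eta n)"
  by (induction n) (simp_all only: eta.simps inj_on_id inj_compose inj_transpose)

lemma inj_kappa: "inj (kappa n)"
  by (induction n) (simp_all only: kappa.simps inj_on_id inj_compose inj_transpose)


section \<open>Words cut at the first zero in a valley\<close>

text \<open>The flag \<open>p\<close> tells whether the first letter is a peak; peaks fall to the next letter by \<open>dn\<close> and valleys
rise to it by \<open>up\<close>.\<close>

definition zigzag :: "(nat \<Rightarrow> nat \<Rightarrow> bool) \<Rightarrow> (nat \<Rightarrow> nat \<Rightarrow> bool) \<Rightarrow> bool \<Rightarrow> nat list \<Rightarrow> bool" where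
  "zigzag dn up p = alternating (if p then dn else up) (if p then up else dn)"

lemma zigzag_iff:
  "zigzag dn up p w \<longleftrightarrow> (\<forall>i. Suc i < length w \<longrightarrow> (if p \<longleftrightarrow> even i then dn else up) (w ! i) (w ! Suc i))"
  by (auto simp: zigzag_def alternating_def)

lemma zigzag_nth:
  assumes "zigzag dn up p w" "Suc i < length w"
  shows "(if p \<longleftrightarrow> even i then dn else up) (w ! i) (w ! Suc i)"
  using assms unfolding zigzag_iff by blast

text \<open>The assumption says that \<open>x\<close> stands in a valley. The part to the right of a valley starts at a
peak, and the recurrences use this: the right factor always has the index \<open>True\<close>.\<close>

lemma zigzag_valley_split:
  assumes "p \<longleftrightarrow> odd (length u)"
  shows "zigzag dn up p (u @ x # v) \<longleftrightarrow> zigzag dn up p u \<and> zigzag dn up True v \<and>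
     (u \<noteq> [] \<longrightarrow> dn (last u) x) \<and> (v \<noteq> [] \<longrightarrow> up x (hd v))"
proof -
  have "zigzag dn up p (u @ x # v) \<longleftrightarrow> zigzag dn up p u \<and> alternating up dn ([x] @ v) \<and> (u \<noteq> [] \<longrightarrow> dn (last u) x)"
    using assms unfolding zigzag_def by (subst alternating_append) auto
  also have "alternating up dn ([x] @ v) \<longleftrightarrow> zigzag dn up True v \<and> (v \<noteq> [] \<longrightarrow> up x (hd v))"
    unfolding zigzag_def by (subst alternating_append) auto
  finally show ?thesis by blast
qed

definition fall :: "bool \<Rightarrow> nat \<Rightarrow> nat \<Rightarrow> bool" where
  "fall s = (if s then (>) else (\<ge>))"

definition rise :: "bool \<Rightarrow> nat \<Rightarrow> nat \<Rightarrow> bool" where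
  "rise s = (if s then (<) else (\<le>))"

definition zigwords :: "bool \<Rightarrow> bool \<Rightarrow> bool \<Rightarrow> nat \<Rightarrow> nat list set" where
  "zigwords ds us p m = {w. length w = m \<and> zigzag (fall ds) (rise us) p w}"

lemma zigzag_map_Suc: "zigzag (fall ds) (rise us) p (map Suc w) = zigzag (fall ds) (rise us) p w"
  unfolding zigzag_def by (rule alternating_map_Suc) (auto simp: fall_def rise_def)

lemma zigzag_short: "length w \<le> 1 \<Longrightarrow> zigzag dn up p w"
  by (simp add: zigzag_def)

lemma fall_imp_le: "fall s x y \<Longrightarrow> y \<le> x" and rise_imp_le: "rise s x y \<Longrightarrow> x \<le> y"
  by (auto simp: fall_def rise_def split: if_splits)

text \<open>If no valley to the left of the cut holds a zero, every letter that has a valley as a neighbour on the left,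
and the first letter whenever a second one follows, is positive too. The only letter that may vanish is
a peak that forms the left part on its own and falls weakly to the cut.\<close>

lemma positive_left_part:
  assumes u: "zigzag (fall ds) (rise us) p u" and p: "p \<longleftrightarrow> odd (length u)"
  shows "(u \<noteq> [] \<longrightarrow> fall ds (last u) 0) \<and> (\<forall>i<length u. (p \<longleftrightarrow> odd i) \<longrightarrow> u ! i \<noteq> 0)
    \<longleftrightarrow> (length u = 1 \<and> \<not> ds) \<or> (\<forall>x\<in>set u. 0 < x)" (is "?l \<longleftrightarrow> ?r")
proof
  assume l: ?l
  have "0 < u ! i" if i: "i < length u" and not_single: "\<not> (length u = 1 \<and> \<not> ds)" for i
  proof -
    consider "p \<longleftrightarrow> odd i" | "p \<longleftrightarrow> even i" "i > 0" | "p" "i = 0" "length u \<ge> 2" | "i = 0" "length u = 1"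
    proof -
      have "length u = 1 \<or> length u \<ge> 2" using i by linarith
      then show thesis using that by (cases "p = odd i"; cases "i = 0") auto
    qed
    then show ?thesis
    proof cases
      case 1
      then show ?thesis using l i by auto
    next
      case 2
      have "rise us (u ! (i - 1)) (u ! i)"
        using zigzag_nth[OF u, of "i - 1"] 2 i by (auto split: if_splits)
      moreover have "u ! (i - 1) \<noteq> 0" using l i 2 by auto
      ultimately show ?thesis using rise_imp_le by fastforce
    next
      case 3
      have "fall ds (u ! 0) (u ! 1)" using zigzag_nth[OF u, of 0] 3 by simp
      moreover have "u ! 1 \<noteq> 0" using l 3 by auto
      ultimately show ?thesis using 3 fall_imp_le by fastforce
    next
      case 4
      then have "u \<noteq> []" by auto
      moreover from this have "last u = u ! 0" using 4 by (simp add: last_conv_nth)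
      ultimately have "ds" "fall ds (last u) 0" "last u = u ! 0" using not_single l 4 by auto
      then show ?thesis using 4 by (simp add: fall_def)
    qed
  qed
  then show ?r unfolding all_set_conv_all_nth by blast
next
  assume r: ?r
  show ?l
  proof (cases "length u = 1 \<and> \<not> ds")
    case True
    then show ?thesis using p by (auto simp: fall_def)
  next
    case False
    with r have pos: "\<forall>x\<in>set u. 0 < x" by blast
    then have "fall ds (last u) 0" if "u \<noteq> []" using that by (auto simp: fall_def)
    moreover have "u ! i \<noteq> 0" if "i < length u" for i using pos nth_mem[OF that] by force
    ultimately show ?thesis by blast
  qed
qed

text \<open>The first letter of the right part is a peak. If it is followed by another letter and rises strictly from
the cut, its fall is strict as well and already forces it to be positive; only a single letter
needs the condition explicitly. This fails for a strict rise combined with a weak fall, and words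
of that kind are reversed before the recurrence is applied.\<close>

lemma positive_right_part:
  assumes v: "zigzag (fall ds) (rise us) True v" and "us \<longrightarrow> ds"
  shows "(v \<noteq> [] \<longrightarrow> rise us 0 (hd v)) \<longleftrightarrow> \<not> (length v = 1 \<and> us) \<or> (\<forall>x\<in>set v. 0 < x)"
proof -
  consider "v = []" | x where "v = [x]" | x y v' where "v = x # y # v'"
    by (cases v; cases "tl v") auto
  then show ?thesis
  proof cases
    case 3
    then have "fall ds x y" using zigzag_nth[OF v, of 0] by simp
    then show ?thesis using 3 assms(2) by (auto simp: fall_def rise_def)
  qed (auto simp: rise_def)
qed

text \<open>A zero at a peak forces the neighbouring letter to be zero as well. The excluded case is a single
letter that counts as a peak.\<close>

lemma zero_at_valley:
  assumes w: "zigzag (fall ds) (rise us) p w" and "0 \<in> set w" and "2 \<le> length w \<or> \<not> p"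
  shows "\<exists>i<length w. (p \<longleftrightarrow> odd i) \<and> w ! i = 0"
proof -
  obtain i where i: "i < length w" "w ! i = 0" using assms(2) by (auto simp: in_set_conv_nth)
  consider "p \<longleftrightarrow> odd i" | "p \<longleftrightarrow> even i" "i > 0" | "p" "i = 0" "length w \<ge> 2"
    using i(1) assms(3) by (cases "i = 0"; cases "length w \<ge> 2") auto
  then show ?thesis
  proof cases
    case 1
    then show ?thesis using i by blast
  next
    case 2
    have "rise us (w ! (i - 1)) (w ! i)"
      using zigzag_nth[OF w, of "i - 1"] 2 i by (auto split: if_splits)
    then have "w ! (i - 1) = 0" using rise_imp_le i by fastforce
    then show ?thesis using 2 i by (intro exI[of _ "i - 1"]) auto
  next
    case 3
    have "fall ds (w ! 0) (w ! 1)" using zigzag_nth[OF w, of 0] 3 by simp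
    then have "w ! 1 = 0" using fall_imp_le i 3 by fastforce
    then show ?thesis using 3 by (intro exI[of _ 1]) auto
  qed
qed

text \<open>The number of letters on both sides of a zero at a valley that have to be lowered by one: all \<open>L\<close> letters on the
left, except a single peak that falls weakly, and on the right only a single peak that rises strictly.\<close>

definition split_exponent :: "bool \<Rightarrow> bool \<Rightarrow> nat \<Rightarrow> nat \<Rightarrow> nat" where
  "split_exponent ds us L R = (if L = 1 \<and> \<not> ds then 0 else L) + (if R = 1 \<and> us then 1 else 0)"

context
  fixes q :: real
  assumes q: "0 < q" "q < 1"
begin

text \<open>Words without a zero are words of the same kind shifted up by one, which gives the factor \<open>1 - q ^ m\<close>.
All others are cut at the first valley that holds a zero; \<open>positive_left_part\<close> and
\<open>positive_right_part\<close> describe which letters of the two sides are forced to be positive.\<close>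

lemma zigwords_recurrence:
  assumes "us \<longrightarrow> ds" and m: "2 \<le> m \<or> m = 1 \<and> \<not> p"
  shows "(1 - q ^ m) * gf q (zigwords ds us p m) =
    (\<Sum>L | L < m \<and> (p \<longleftrightarrow> odd L). q ^ split_exponent ds us L (m - 1 - L) *
       (gf q (zigwords ds us p L) * gf q (zigwords ds us True (m - 1 - L))))"
proof -
  let ?Z = "zigwords ds us" and ?X = "{L. L < m \<and> (p \<longleftrightarrow> odd L)}"
  \<comment> \<open>\<open>P L\<close>: the first valley with a zero is at index \<open>L\<close>. \<open>U\<close> and \<open>V\<close> contain the left and right parts of such words.\<close>
  define P where "P L = {w \<in> ?Z p m. w ! L = 0 \<and> (\<forall>i<L. (p \<longleftrightarrow> odd i) \<longrightarrow> w ! i \<noteq> 0)}" for L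
  define U where "U L = (if L = 1 \<and> \<not> ds then ?Z p L else map Suc ` ?Z p L)" for L
  define V where "V R = (if R = 1 \<and> us then map Suc ` ?Z True R else ?Z True R)" for R
  have Z_sub: "?Z r k \<subseteq> {w. length w = k}" for r k by (auto simp: zigwords_def)
  have shifted: "w \<in> map Suc ` ?Z r k \<longleftrightarrow> w \<in> ?Z r k \<and> (\<forall>x\<in>set w. 0 < x)" for w r k
    unfolding positive_iff_map_Suc by (auto simp: zigwords_def zigzag_map_Suc)
  have U_sub: "U L \<subseteq> {w. length w = L}" and V_sub: "V R \<subseteq> {w. length w = R}" for L R
    by (auto simp: U_def V_def zigwords_def)
  have P_eq: "P L = (\<lambda>(u, v). u @ [0] @ v) ` (U L \<times> V (m - 1 - L))" if L: "L \<in> ?X" for L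
  proof -
    have *: "u @ [0] @ v \<in> P L \<longleftrightarrow> u \<in> U L \<and> v \<in> V (m - 1 - L)" if len: "length u = L" "length v = m - 1 - L" for u v
    proof -
      have p: "p \<longleftrightarrow> odd (length u)" and len_m: "length (u @ [0] @ v) = m" using L len by auto
      have zero: "(u @ [0] @ v) ! L = 0" using len by (simp add: nth_append)
      have low: "(\<forall>i<L. (p \<longleftrightarrow> odd i) \<longrightarrow> (u @ [0] @ v) ! i \<noteq> 0) \<longleftrightarrow> (\<forall>i<length u. (p \<longleftrightarrow> odd i) \<longrightarrow> u ! i \<noteq> 0)"
        using len by (simp add: nth_append)
      have zz: "zigzag (fall ds) (rise us) p (u @ [0] @ v) \<longleftrightarrow> zigzag (fall ds) (rise us) p u \<and>
          zigzag (fall ds) (rise us) True v \<and> (u \<noteq> [] \<longrightarrow> fall ds (last u) 0) \<and> (v \<noteq> [] \<longrightarrow> rise us 0 (hd v))"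
        using zigzag_valley_split[OF p, of "fall ds" "rise us" 0 v] by simp
      have "u @ [0] @ v \<in> P L \<longleftrightarrow> zigzag (fall ds) (rise us) p u \<and> zigzag (fall ds) (rise us) True v \<and>
        ((u \<noteq> [] \<longrightarrow> fall ds (last u) 0) \<and> (\<forall>i<length u. (p \<longleftrightarrow> odd i) \<longrightarrow> u ! i \<noteq> 0)) \<and>
        (v \<noteq> [] \<longrightarrow> rise us 0 (hd v))"
        unfolding P_def zigwords_def mem_Collect_eq len_m zero low zz by blast
      also have "\<dots> \<longleftrightarrow> zigzag (fall ds) (rise us) p u \<and> zigzag (fall ds) (rise us) True v \<and>
         ((length u = 1 \<and> \<not> ds) \<or> (\<forall>x\<in>set u. 0 < x)) \<and> (\<not> (length v = 1 \<and> us) \<or> (\<forall>x\<in>set v. 0 < x))"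
        by (simp only: positive_left_part[OF _ p] positive_right_part[OF _ assms(1)] cong: conj_cong)
      also have "\<dots> \<longleftrightarrow> u \<in> U L \<and> v \<in> V (m - 1 - L)"
      proof -
        have "u \<in> U L \<longleftrightarrow> zigzag (fall ds) (rise us) p u \<and> ((length u = 1 \<and> \<not> ds) \<or> (\<forall>x\<in>set u. 0 < x))"
          unfolding U_def if_distrib[of "\<lambda>S. u \<in> S"] shifted using len by (auto simp: zigwords_def)
        moreover have "v \<in> V (m - 1 - L) \<longleftrightarrow> zigzag (fall ds) (rise us) True v \<and>
            (\<not> (length v = 1 \<and> us) \<or> (\<forall>x\<in>set v. 0 < x))"
          unfolding V_def if_distrib[of "\<lambda>S. v \<in> S"] shifted using len by (auto simp: zigwords_def)
        ultimately show ?thesis by blast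
      qed
      finally show ?thesis .
    qed
    show ?thesis
    proof (intro equalityI subsetI)
      fix w assume w: "w \<in> P L"
      then have "length w = m" "w ! L = 0" by (auto simp: P_def zigwords_def)
      moreover from this L have "w = take L w @ [0] @ drop (Suc L) w" using id_take_nth_drop[of L w] by simp
      ultimately show "w \<in> (\<lambda>(u, v). u @ [0] @ v) ` (U L \<times> V (m - 1 - L))"
        using *[of "take L w" "drop (Suc L) w"] w L
        by (intro image_eqI[of _ _ "(take L w, drop (Suc L) w)"]) auto
    next
      fix w assume "w \<in> (\<lambda>(u, v). u @ [0] @ v) ` (U L \<times> V (m - 1 - L))"
      then show "w \<in> P L" using * U_sub[of L] V_sub[of "m - 1 - L"] by fastforce
    qed
  qed
  have gfU: "gf q (U L) = q ^ (if L = 1 \<and> \<not> ds then 0 else L) * gf q (?Z p L)" for L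
  proof (cases "L = 1 \<and> \<not> ds")
    case True
    show ?thesis unfolding U_def if_P[OF True] by simp
  next
    case False
    show ?thesis unfolding U_def if_not_P[OF False] by (rule gf_map_Suc[OF q Z_sub])
  qed
  have gfV: "gf q (V R) = q ^ (if R = 1 \<and> us then 1 else 0) * gf q (?Z True R)" for R
  proof (cases "R = 1 \<and> us")
    case True
    show ?thesis unfolding V_def if_P[OF True] using gf_map_Suc[OF q Z_sub, of True R] True by simp
  next
    case False
    show ?thesis unfolding V_def if_not_P[OF False] by simp
  qed
  have gfP: "gf q (P L) = q ^ split_exponent ds us L (m - 1 - L) * (gf q (?Z p L) * gf q (?Z True (m - 1 - L)))"
    if "L \<in> ?X" for L
    unfolding P_eq[OF that] gf_append[OF q U_sub V_sub]
    by (simp only: gfU gfV split_exponent_def power_add mult_ac) simp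
  have split: "?Z p m = map Suc ` ?Z p m \<union> (\<Union>L\<in>?X. P L)"
  proof (intro equalityI subsetI)
    fix w assume w: "w \<in> ?Z p m"
    show "w \<in> map Suc ` ?Z p m \<union> (\<Union>L\<in>?X. P L)"
    proof (cases "0 \<in> set w")
      case False
      then have "\<forall>x\<in>set w. 0 < x" by (metis gr0I)
      then show ?thesis using w shifted by blast
    next
      case True
      then have ex: "\<exists>i. i < length w \<and> (p \<longleftrightarrow> odd i) \<and> w ! i = 0"
        using zero_at_valley[of ds us p w] w m by (auto simp: zigwords_def)
      define L where "L = (LEAST i. i < length w \<and> (p \<longleftrightarrow> odd i) \<and> w ! i = 0)"
      have L: "L < length w" "p \<longleftrightarrow> odd L" "w ! L = 0" using LeastI_ex[OF ex] unfolding L_def by auto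
      have "w ! i \<noteq> 0" if "i < L" "p \<longleftrightarrow> odd i" for i
      proof -
        have "\<not> (i < length w \<and> (p \<longleftrightarrow> odd i) \<and> w ! i = 0)"
          using that(1) unfolding L_def by (rule not_less_Least)
        then show ?thesis using that L(1) by auto
      qed
      then have "w \<in> P L" using L w by (auto simp: P_def)
      moreover have "L \<in> ?X" using L w by (auto simp: zigwords_def)
      ultimately show ?thesis by blast
    qed
  qed (use shifted P_def in auto)
  have "gf q (?Z p m) = gf q (map Suc ` ?Z p m) + gf q (\<Union>L\<in>?X. P L)"
  proof (subst split, rule gf_Un[OF q])
    show "map Suc ` ?Z p m \<subseteq> {w. length w = m}" "(\<Union>L\<in>?X. P L) \<subseteq> {w. length w = m}"
      by (auto simp: P_def zigwords_def)
    show "map Suc ` ?Z p m \<inter> (\<Union>L\<in>?X. P L) = {}"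
    proof (rule ccontr)
      assume "map Suc ` ?Z p m \<inter> (\<Union>L\<in>?X. P L) \<noteq> {}"
      then obtain w L where w: "w \<in> map Suc ` ?Z p m" "w \<in> P L" "L < m" by blast
      have "\<forall>x\<in>set w. 0 < x" using w(1) shifted by blast
      moreover have "L < length w" "w ! L = 0" using w(2,3) by (simp_all add: P_def zigwords_def)
      ultimately show False using nth_mem[of L w] by (metis less_irrefl)
    qed
  qed
  also have "gf q (map Suc ` ?Z p m) = q ^ m * gf q (?Z p m)" by (rule gf_map_Suc[OF q Z_sub])
  also have "gf q (\<Union>L\<in>?X. P L) = (\<Sum>L\<in>?X. gf q (P L))"
  proof (rule gf_UN[OF q])
    show "P L \<subseteq> {w. length w = m}" for L by (auto simp: P_def zigwords_def)
    show "P L \<inter> P L' = {}" if "L \<in> ?X" "L' \<in> ?X" "L \<noteq> L'" for L L'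
    proof (rule ccontr)
      assume "P L \<inter> P L' \<noteq> {}"
      then obtain w where "w \<in> P L" "w \<in> P L'" by blast
      then show False using that by (cases L L' rule: linorder_cases) (auto simp: P_def)
    qed
  qed simp
  also have "(\<Sum>L\<in>?X. gf q (P L)) = (\<Sum>L\<in>?X. q ^ split_exponent ds us L (m - 1 - L) *
       (gf q (?Z p L) * gf q (?Z True (m - 1 - L))))"
    by (rule sum.cong) (use gfP in auto)
  finally show ?thesis by (simp add: algebra_simps)
qed

lemma gf_zigwords_0: "gf q (zigwords ds us p 0) = 1"
proof -
  have "zigwords ds us p 0 = {[]}" by (auto simp: zigwords_def zigzag_short)
  then show ?thesis by (simp add: gf_Nil[OF q])
qed

lemma gf_zigwords_1: "gf q (zigwords ds us p 1) = 1 / (1 - q)"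
proof -
  have "zigwords ds us p 1 = altwords (\<ge>) (\<ge>) 1" by (auto simp: zigwords_def zigzag_short altwords_def)
  then show ?thesis using gf_weak_chain[OF q, of 1] by (simp add: qpoch_def)
qed

end


section \<open>Statistics of permutations cut at the minimum\<close>

lemma card_steps:
  "card {i \<in> {1..<length w}. P (w ! (i - 1)) (w ! i)} = (\<Sum>i<length w - 1. of_bool (P (w ! i) (w ! Suc i)))"
proof -
  have "{i \<in> {1..<length w}. P (w ! (i - 1)) (w ! i)} = Suc ` {i \<in> {..<length w - 1}. P (w ! i) (w ! Suc i)}"
  proof (intro equalityI subsetI)
    fix i assume i: "i \<in> {i \<in> {1..<length w}. P (w ! (i - 1)) (w ! i)}"
    then obtain k where "i = Suc k" by (cases i) auto
    with i show "i \<in> Suc ` {i \<in> {..<length w - 1}. P (w ! i) (w ! Suc i)}" by auto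
  qed auto
  then have "card {i \<in> {1..<length w}. P (w ! (i - 1)) (w ! i)} = card {i \<in> {..<length w - 1}. P (w ! i) (w ! Suc i)}"
    by (simp add: card_image)
  also have "{i \<in> {..<length w - 1}. P (w ! i) (w ! Suc i)} = {..<length w - 1} \<inter> {i. P (w ! i) (w ! Suc i)}"
    by auto
  finally show ?thesis by simp
qed

lemma steps_Cons2:
  "card {i \<in> {1..<length (x # y # w)}. P ((x # y # w) ! (i - 1)) ((x # y # w) ! i)}
    = of_bool (P x y) + card {i \<in> {1..<length (y # w)}. P ((y # w) ! (i - 1)) ((y # w) ! i)}"
  unfolding card_steps by (simp add: sum.lessThan_Suc_shift del: sum.lessThan_Suc sum_of_bool_eq)

lemma des_simps [simp]: "des [] = 0" "des [x] = 0" "des (x # y # w) = of_bool (x > y) + des (y # w)"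
  unfolding des_def by (simp_all only: steps_Cons2[where P = "\<lambda>x y. x > y"]) auto

lemma asc_simps [simp]: "asc [] = 0" "asc [x] = 0" "asc (x # y # w) = of_bool (x < y) + asc (y # w)"
  unfolding asc_def by (simp_all only: steps_Cons2[where P = "\<lambda>x y. x < y"]) auto

lemma des_append: "des (u @ v) = des u + des v + of_bool (u \<noteq> [] \<and> v \<noteq> [] \<and> last u > hd v)"
proof (induction u)
  case (Cons x u)
  then show ?case by (cases u; cases v) auto
qed simp

lemma asc_append: "asc (u @ v) = asc u + asc v + of_bool (u \<noteq> [] \<and> v \<noteq> [] \<and> last u < hd v)"
proof (induction u)
  case (Cons x u)
  then show ?case by (cases u; cases v) auto
qed simp

lemma des_le: "des w \<le> length w" and asc_le: "asc w \<le> length w"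
proof -
  show "des w \<le> length w" by (induction w rule: induct_list012) auto
  show "asc w \<le> length w" by (induction w rule: induct_list012) auto
qed

lemma des_plus_asc: "distinct w \<Longrightarrow> w \<noteq> [] \<Longrightarrow> des w + asc w = length w - 1"
  by (induction w rule: induct_list012) auto

lemma des_rev: "des (rev w) = asc w"
  by (induction w) (auto simp: des_append last_rev asc_append[of "[_]", simplified])

lemma asc_rev: "asc (rev w) = des w"
  using des_rev[of "rev w"] by simp

lemma des_map_complement: "\<forall>x\<in>set w. x \<le> k \<Longrightarrow> des (map (\<lambda>x. k - x) w) = asc w"
  by (induction w rule: induct_list012) auto

lemma asc_map_complement: "\<forall>x\<in>set w. x \<le> k \<Longrightarrow> asc (map (\<lambda>x. k - x) w) = des w"
  by (induction w rule: induct_list012) auto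

text \<open>The number of inversions between a left part with letters \<open>U\<close> and a right part with letters \<open>V\<close>.\<close>

definition cross :: "nat set \<Rightarrow> nat set \<Rightarrow> nat" where
  "cross U V = (\<Sum>x\<in>U. card {y \<in> V. y < x})"

lemma invs_Nil [simp]: "invs [] = 0"
  by (simp add: invs_def)

lemma invs_Cons:
  assumes "distinct (x # w)"
  shows "invs (x # w) = card {y \<in> set w. y < x} + invs w"
proof -
  let ?A = "{(i, j). i < j \<and> j < length (x # w) \<and> (x # w) ! i > (x # w) ! j}"
  let ?B = "(\<lambda>j. (0::nat, Suc j)) ` {j. j < length w \<and> w ! j < x}"
  let ?C = "(\<lambda>(i, j). (Suc i, Suc j)) ` {(i, j). i < j \<and> j < length w \<and> w ! i > w ! j}"
  have "?A = ?B \<union> ?C"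
  proof (intro equalityI subsetI)
    fix z assume z: "z \<in> ?A"
    then obtain i j where "z = (i, Suc j)" by (cases z; cases "snd z") auto
    then show "z \<in> ?B \<union> ?C" using z by (cases i) auto
  qed auto
  moreover have "?B \<inter> ?C = {}" by auto
  moreover have "finite ?B" by simp
  moreover have "finite ?C"
    by (rule finite_imageI, rule finite_subset[of _ "{..<length w} \<times> {..<length w}"]) auto
  ultimately have "card ?A = card ?B + card ?C" by (simp add: card_Un_disjoint)
  moreover have "card ?C = invs w" unfolding invs_def by (rule card_image) (auto simp: inj_on_def)
  moreover have "card ?B = card {j. j < length w \<and> w ! j < x}" by (rule card_image) (auto simp: inj_on_def)
  moreover have "card {j. j < length w \<and> w ! j < x} = card ((!) w ` {j. j < length w \<and> w ! j < x})"
    using assms by (intro card_image[symmetric]) (auto simp: inj_on_def nth_eq_iff_index_eq)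
  moreover have "(!) w ` {j. j < length w \<and> w ! j < x} = {y \<in> set w. y < x}"
    by (auto simp: in_set_conv_nth)
  ultimately have "card ?A = card {y \<in> set w. y < x} + invs w" by (simp only:)
  then show ?thesis by (simp only: invs_def)
qed

lemma invs_append:
  assumes "distinct (u @ v)"
  shows "invs (u @ v) = invs u + invs v + cross (set u) (set v)"
  using assms
proof (induction u)
  case (Cons x u)
  have "{y \<in> set (u @ v). y < x} = {y \<in> set u. y < x} \<union> {y \<in> set v. y < x}" by auto
  moreover have "{y \<in> set u. y < x} \<inter> {y \<in> set v. y < x} = {}" using Cons.prems by auto
  ultimately have "card {y \<in> set (u @ v). y < x} = card {y \<in> set u. y < x} + card {y \<in> set v. y < x}"
    by (simp add: card_Un_disjoint)
  then show ?case using Cons by (simp add: invs_Cons cross_def)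
qed (simp add: cross_def)

text \<open>The minimum is smaller than each of the \<open>length u\<close> letters before it and than all letters after it.\<close>

lemma invs_remove_min:
  assumes "distinct (u @ x # v)" "\<forall>y\<in>set u \<union> set v. x < y"
  shows "invs (u @ x # v) = invs u + invs v + cross (set u) (set v) + length u"
proof -
  have "invs (u @ x # v) = invs u + invs (x # v) + cross (set u) (insert x (set v))"
    using invs_append[OF assms(1)] by simp
  also have "invs (x # v) = invs v"
  proof -
    have "{y \<in> set v. y < x} = {}" using assms(2) by (force dest: less_not_sym)
    then show ?thesis using assms(1) by (simp add: invs_Cons)
  qed
  also have "cross (set u) (insert x (set v)) = cross (set u) (set v) + length u"
  proof -
    have "card {y \<in> insert x (set v). y < z} = card {y \<in> set v. y < z} + 1" if "z \<in> set u" for z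
    proof -
      have "{y \<in> insert x (set v). y < z} = insert x {y \<in> set v. y < z}" using assms(2) that by auto
      moreover have "x \<notin> set v" using assms(1) by auto
      ultimately show ?thesis by simp
    qed
    then have "cross (set u) (insert x (set v)) = (\<Sum>z\<in>set u. card {y \<in> set v. y < z} + 1)"
      unfolding cross_def by (intro sum.cong) auto
    also have "\<dots> = cross (set u) (set v) + card (set u)" unfolding cross_def sum.distrib by simp
    finally show ?thesis using assms(1) by (simp add: distinct_card)
  qed
  finally show ?thesis by simp
qed

text \<open>As for \<open>zigzag\<close>, the flag tells whether the first letter counts as a peak.\<close>

primrec valleys :: "bool \<Rightarrow> nat list \<Rightarrow> nat list" where
  "valleys p [] = []"
| "valleys p (x # w) = (if p then [] else [x]) @ valleys (\<not> p) w"

lemma valleys_append: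
  "valleys p (u @ v) = valleys p u @ valleys (if even (length u) then p else \<not> p) v"
  by (induction u arbitrary: p) auto

lemma valleys_split:
  assumes "p \<longleftrightarrow> odd (length u)"
  shows "valleys p (u @ x # v) = valleys p u @ x # valleys True v"
  using assms by (auto simp: valleys_append)

lemma valleys_Nil_iff: "valleys p w = [] \<longleftrightarrow> w = [] \<or> p \<and> length w = 1"
  by (cases w; cases "tl w") auto

lemma set_valleys: "set (valleys p w) \<subseteq> set w"
proof (induction w arbitrary: p)
  case (Cons x w)
  show ?case using Cons[of "\<not> p"] by auto
qed simp

lemma distinct_valleys: "distinct w \<Longrightarrow> distinct (valleys p w)"
proof (induction w arbitrary: p)
  case (Cons x w)
  then show ?case using set_valleys[of "\<not> p" w] by auto
qed simp

lemma length_valleys: "length (valleys p w) = (if p then length w div 2 else (length w + 1) div 2)"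
  by (induction w arbitrary: p) auto

text \<open>A valley at the end of a word counts in \<open>nasc\<close> and one at the start counts in \<open>ndes\<close>, whereas an empty side
has no weight in the recurrence for words. The terms with \<open>of_bool\<close> correct this, so that \<open>vstat_split\<close>
holds for parts of all lengths.\<close>

definition vstat :: "bool \<Rightarrow> bool \<Rightarrow> bool \<Rightarrow> nat list \<Rightarrow> int" where
  "vstat ds us p w = int (invs w)
     + (if us then int (nasc (valleys p w)) - of_bool (w \<noteq> [] \<and> (p \<longleftrightarrow> even (length w))) else 0)
     - (if ds then 0 else int (ndes (valleys p w)) - of_bool (w \<noteq> [] \<and> \<not> p))"

text \<open>Removing the minimum from the valley letters changes the number of descents or ascents by one unless
the valley letters on one side are absent. On the right they are absent for length at most one, on the left
for length at most one if that side starts at a peak. The normalization terms of \<open>vstat\<close> cancel the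
contributions of empty sides, so that only sides of length one remain, as in the recurrence for
words.\<close>

lemma vstat_split:
  assumes dist: "distinct (u @ x # v)" and min: "\<forall>y\<in>set u \<union> set v. x < y"
    and p: "p \<longleftrightarrow> odd (length u)"
  shows "vstat ds us p (u @ x # v) = vstat ds us p u + vstat ds us True v
    + int (cross (set u) (set v)) + int (split_exponent ds us (length u) (length v))"
proof -
  let ?u = "valleys p u" and ?v = "valleys True v"
  have low: "x < last ?u" if "?u \<noteq> []"
  proof -
    have "last ?u \<in> set u" using set_valleys[of p u] last_in_set[OF that] by blast
    then show ?thesis using min by blast
  qed
  have high: "x < hd ?v" if "?v \<noteq> []"
  proof -
    have "hd ?v \<in> set v" using set_valleys[of True v] hd_in_set[OF that] by blast
    then show ?thesis using min by blast
  qed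
  have des: "des (?u @ x # ?v) = des ?u + des ?v + of_bool (?u \<noteq> [])"
    using low high by (cases ?v) (auto simp: des_append)
  have asc: "asc (?u @ x # ?v) = asc ?u + asc ?v + of_bool (?v \<noteq> [])"
    using low high by (cases ?v) (auto simp: asc_append)
  have ndes: "int (ndes (valleys p (u @ x # v))) = int (ndes ?u) + int (ndes ?v) + 1 - of_bool (?u \<noteq> [])"
    unfolding valleys_split[OF p] ndes_def des using des_le[of ?u] des_le[of ?v] by (auto simp: of_nat_diff)
  have nasc: "int (nasc (valleys p (u @ x # v))) = int (nasc ?u) + int (nasc ?v) + 1 - of_bool (?v \<noteq> [])"
    unfolding valleys_split[OF p] nasc_def asc using asc_le[of ?u] asc_le[of ?v] by (auto simp: of_nat_diff)
  show ?thesis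
    unfolding vstat_def ndes nasc invs_remove_min[OF dist min] valleys_Nil_iff split_exponent_def
    using p by (cases ds; cases us; cases p; cases "u = []"; cases "v = []"; cases "length u = 1"; cases "length v = 1") simp_all
qed


section \<open>Permutations cut at the minimum\<close>

definition zigperms :: "bool \<Rightarrow> nat set \<Rightarrow> nat list set" where
  "zigperms p A = {w. distinct w \<and> set w = A \<and> zigzag (>) (<) p w}"

lemma length_zigperms: "w \<in> zigperms p A \<Longrightarrow> length w = card A"
  by (auto simp: zigperms_def distinct_card)

lemma finite_zigperms: "finite A \<Longrightarrow> finite (zigperms p A)"
  by (rule finite_subset[OF _ finite_lists_length_eq[of A "card A"]])
    (auto simp: zigperms_def distinct_card)

lemma cross_insert_left:
  assumes "finite U" "b \<notin> U" "\<forall>x\<in>V. x < b"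
  shows "cross (insert b U) V = cross U V + card V"
proof -
  have "{y \<in> V. y < b} = V" using assms(3) by auto
  then show ?thesis using assms by (simp add: cross_def)
qed

lemma cross_insert_right:
  assumes "\<forall>x\<in>U. x < b"
  shows "cross U (insert b V) = cross U V"
  unfolding cross_def
proof (rule sum.cong)
  fix x assume "x \<in> U"
  then have "{y \<in> insert b V. y < x} = {y \<in> V. y < x}" using assms by force
  then show "card {y \<in> insert b V. y < x} = card {y \<in> V. y < x}" by simp
qed simp

text \<open>A minimum at a peak would have a smaller neighbour. The excluded case is again a single letter that
counts as a peak.\<close>

lemma zigzag_min_position:
  assumes w: "zigzag (>) (<) p (u @ x # v)" and min: "\<forall>y\<in>set u \<union> set v. x < y"
    and "2 \<le> length (u @ x # v) \<or> \<not> p"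
  shows "p \<longleftrightarrow> odd (length u)"
proof (rule ccontr)
  assume np: "\<not> (p \<longleftrightarrow> odd (length u))"
  show False
  proof (cases "u = []")
    case False
    then obtain u' y where u: "u = u' @ [y]" by (cases u rule: rev_cases) auto
    have "y < x" using zigzag_nth[OF w, of "length u'"] np u by (auto simp: nth_append split: if_splits)
    then show False using min u by auto
  next
    case True
    then obtain y v' where "v = y # v'" using np assms(3) by (cases v) auto
    then have "x > y" using zigzag_nth[OF w, of 0] True np by (auto split: if_splits)
    then show False using min \<open>v = y # v'\<close> by auto
  qed
qed

definition zigperms_gf :: "real \<Rightarrow> bool \<Rightarrow> bool \<Rightarrow> bool \<Rightarrow> nat set \<Rightarrow> real" where
  "zigperms_gf q ds us p A = (\<Sum>w\<in>zigperms p A. q powi vstat ds us p w)"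

context
  fixes q :: real
  assumes q: "0 < q" "q < 1"
begin

text \<open>This is the Gaussian binomial coefficient. Whether the largest element \<open>b\<close> belongs to \<open>U\<close> decides between
the two terms of the Pascal recurrence: if it does, it forms an inversion with every element outside \<open>U\<close>,
otherwise with none.\<close>

lemma sum_cross_subsets:
  assumes "finite B" "k \<le> card B"
  shows "(\<Sum>U | U \<subseteq> B \<and> card U = k. q ^ cross U (B - U)) =
    qpoch q q (card B) / (qpoch q q k * qpoch q q (card B - k))"
  using assms
proof (induction B arbitrary: k rule: finite_linorder_max_induct)
  case empty
  have k: "k = 0" using empty by simp
  have "{U :: nat set. U \<subseteq> {} \<and> card U = 0} = {{}}" by auto
  then show ?case unfolding k by (simp only:) (simp add: cross_def qpoch_def)
next
  case (insert b B)
  have b: "b \<notin> B" using insert.hyps by blast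
  \<comment> \<open>\<open>G\<close> is the sum for \<open>B\<close>; \<open>without\<close> and \<open>with\<close> are the contributions to the sum for \<open>insert b B\<close>.\<close>
  define G where "G k = (\<Sum>U | U \<subseteq> B \<and> card U = k. q ^ cross U (B - U))" for k
  define n where "n = card B"
  have card_bB: "card (insert b B) = Suc n" using b insert.hyps by (simp add: n_def)
  have fin: "finite {U. U \<subseteq> B \<and> card U = k}" for k using insert.hyps by simp
  have fin': "finite U" if "U \<subseteq> B" for U using insert.hyps that finite_subset by blast
  have without: "(\<Sum>U\<in>{U. U \<subseteq> B \<and> card U = k}. q ^ cross U (insert b B - U)) = G k" for k
    unfolding G_def
  proof (rule sum.cong)
    fix U assume "U \<in> {U. U \<subseteq> B \<and> card U = k}"
    then have "insert b B - U = insert b (B - U)" "\<forall>x\<in>U. x < b" using b insert.hyps by auto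
    then show "q ^ cross U (insert b B - U) = q ^ cross U (B - U)" by (simp add: cross_insert_right)
  qed simp
  have "with": "(\<Sum>U\<in>insert b ` {U. U \<subseteq> B \<and> card U = k}. q ^ cross U (insert b B - U)) = q ^ (n - k) * G k" for k
  proof -
    have "inj_on (insert b) {U. U \<subseteq> B \<and> card U = k}"
      using b by (auto simp: inj_on_def)
    then have "(\<Sum>U\<in>insert b ` {U. U \<subseteq> B \<and> card U = k}. q ^ cross U (insert b B - U))
      = (\<Sum>U | U \<subseteq> B \<and> card U = k. q ^ cross (insert b U) (insert b B - insert b U))"
      by (simp add: sum.reindex)
    also have "\<dots> = (\<Sum>U | U \<subseteq> B \<and> card U = k. q ^ (n - k) * q ^ cross U (B - U))"
    proof (rule sum.cong)
      fix U assume U: "U \<in> {U. U \<subseteq> B \<and> card U = k}"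
      then have "insert b B - insert b U = B - U" using b by auto
      moreover have "card (B - U) = n - k" using U fin' by (simp add: n_def card_Diff_subset)
      moreover have "cross (insert b U) (B - U) = cross U (B - U) + card (B - U)"
        using U b fin' insert.hyps by (intro cross_insert_left) auto
      ultimately show "q ^ cross (insert b U) (insert b B - insert b U) = q ^ (n - k) * q ^ cross U (B - U)"
        by (simp add: power_add)
    qed simp
    finally show ?thesis by (simp add: G_def sum_distrib_left)
  qed
  have pos: "qpoch q q i > 0" for i by (rule qpoch_pos[OF q])
  show ?case
  proof (cases k)
    case 0
    have "{U. U \<subseteq> insert b B \<and> card U = k} = {{}}"
      using insert.hyps 0 finite_subset[of _ "insert b B"] by auto
    then show ?thesis using pos[of "card (insert b B)"] 0 by (simp add: cross_def qpoch_def[of q q 0])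
  next
    case (Suc j)
    have j: "j \<le> n" using insert.prems card_bB Suc by simp
    have parts: "{U. U \<subseteq> insert b B \<and> card U = k} = {U. U \<subseteq> B \<and> card U = k} \<union> insert b ` {U. U \<subseteq> B \<and> card U = j}"
    proof (intro equalityI subsetI)
      fix U assume U: "U \<in> {U. U \<subseteq> insert b B \<and> card U = k}"
      show "U \<in> {U. U \<subseteq> B \<and> card U = k} \<union> insert b ` {U. U \<subseteq> B \<and> card U = j}"
      proof (cases "b \<in> U")
        case True
        have "finite U" using U insert.hyps finite_subset by blast
        then have "card (U - {b}) = j" using U True Suc by simp
        moreover have "U - {b} \<subseteq> B" "U = insert b (U - {b})" using U True by auto
        ultimately show ?thesis by blast
      qed (use U in auto)
    next
      fix U assume "U \<in> {U. U \<subseteq> B \<and> card U = k} \<union> insert b ` {U. U \<subseteq> B \<and> card U = j}"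
      then show "U \<in> {U. U \<subseteq> insert b B \<and> card U = k}"
      proof
        assume "U \<in> insert b ` {U. U \<subseteq> B \<and> card U = j}"
        then obtain U' where U': "U = insert b U'" "U' \<subseteq> B" "card U' = j" by blast
        then have "card (insert b U') = Suc (card U')" using b fin' by (intro card_insert_disjoint) auto
        then show ?thesis using U' Suc by auto
      qed auto
    qed
    have "(\<Sum>U | U \<subseteq> insert b B \<and> card U = k. q ^ cross U (insert b B - U)) = G k + q ^ (n - j) * G j"
      unfolding parts using b fin by (subst sum.union_disjoint) (auto simp: without "with")
    also have "\<dots> = qpoch q q (Suc n) / (qpoch q q k * qpoch q q (Suc n - k))"
    proof -
      have Gj: "G j = qpoch q q n / (qpoch q q j * qpoch q q (n - j))"
        unfolding G_def n_def by (rule insert.IH) (use j n_def in simp)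
      show ?thesis
      proof (cases "k \<le> n")
        case False
        then have "k = Suc n" "j = n" using j Suc by auto
        have "card U \<noteq> k" if "U \<subseteq> B" for U
          using card_mono[OF insert.hyps(1) that] \<open>k = Suc n\<close> by (simp add: n_def)
        then have none: "{U. U \<subseteq> B \<and> card U = k} = {}" by blast
        have "G k = 0" unfolding G_def none by simp
        then show ?thesis using Gj \<open>k = Suc n\<close> \<open>j = n\<close> pos[of n] pos[of "Suc n"]
          by (simp add: qpoch_def[of q q 0])
      next
        case True
        have Gk: "G k = qpoch q q n / (qpoch q q k * qpoch q q (n - k))"
          unfolding G_def n_def by (rule insert.IH) (use True n_def in simp)
        obtain l where l: "n = k + l" using True le_Suc_ex by blast
        then have nj: "n - j = Suc l" and "n - k = l" "Suc n - k = Suc l" using Suc by auto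
        have "qpoch q q k = qpoch q q j * (1 - q ^ k)" "qpoch q q (Suc l) = qpoch q q l * (1 - q ^ Suc l)"
          "qpoch q q (Suc n) = qpoch q q n * (1 - q ^ Suc n)"
          by (simp_all add: Suc qpoch_Suc)
        moreover have "1 - q ^ k > 0" "1 - q ^ Suc l > 0"
          using q power_less_one_iff[of q k] power_less_one_iff[of q "Suc l"] Suc by simp_all
        moreover have "q ^ Suc n = q ^ k * q ^ Suc l" using l by (simp add: power_add)
        ultimately show ?thesis
          unfolding Gj Gk nj \<open>n - k = l\<close> \<open>Suc n - k = Suc l\<close>
          using pos[of j] pos[of l] by (simp add: divide_simps del: power_Suc) (simp add: algebra_simps)
      qed
    qed
    finally show ?thesis by (simp add: card_bB)
  qed
qed

text \<open>A word is determined by the set of letters to the left of the minimum and by the words on both sides. Both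
sides are alternating again, and \<open>vstat\<close> is additive up to terms that depend only on the two sets.\<close>

lemma zigperms_recurrence:
  assumes A: "finite A" and m: "2 \<le> card A \<or> card A = 1 \<and> \<not> p"
  defines "B \<equiv> A - {Min A}"
  shows "zigperms_gf q ds us p A = (\<Sum>U | U \<subseteq> B \<and> (p \<longleftrightarrow> odd (card U)).
     q ^ cross U (B - U) * q ^ split_exponent ds us (card U) (card (B - U)) *
     (zigperms_gf q ds us p U * zigperms_gf q ds us True (B - U)))"
proof -
  define x where "x = Min A"
  have "A \<noteq> {}" using m by auto
  have xA: "x \<in> A" unfolding x_def by (rule Min_in[OF A \<open>A \<noteq> {}\<close>])
  then have xB: "\<And>y. y \<in> B \<Longrightarrow> x < y" and AB: "A = insert x B" "x \<notin> B"
    using Min_le[OF A] by (auto simp: x_def B_def order.strict_iff_order)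
  have B: "finite B" using A by (simp add: B_def)
  define Us where "Us = {U. U \<subseteq> B \<and> (p \<longleftrightarrow> odd (card U))}"
  have Us: "finite Us" using B by (auto simp: Us_def)
  have fU: "finite U" if "U \<in> Us" for U using that B finite_subset by (auto simp: Us_def)
  define T where "T = (SIGMA U:Us. zigperms p U \<times> zigperms True (B - U))"
  define glue where "glue = (\<lambda>(U :: nat set, (u, v)). u @ x # v)"
  have glue_in: "glue (U, (u, v)) \<in> zigperms p A"
    and stat: "q powi vstat ds us p (glue (U, (u, v))) = q ^ cross U (B - U) * q ^ split_exponent ds us (card U) (card (B - U))
        * (q powi vstat ds us p u * q powi vstat ds us True v)"
    if "U \<in> Us" "u \<in> zigperms p U" "v \<in> zigperms True (B - U)" for U u v
  proof -
    have u: "distinct u" "set u = U" "zigzag (>) (<) p u" "length u = card U"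
      and v: "distinct v" "set v = B - U" "zigzag (>) (<) True v" "length v = card (B - U)"
      using that length_zigperms by (auto simp: zigperms_def)
    have U: "U \<subseteq> B" "p \<longleftrightarrow> odd (length u)" using that u by (auto simp: Us_def)
    have min: "\<forall>y\<in>set u \<union> set v. x < y" using u v U xB by auto
    have dist: "distinct (u @ x # v)" using u v U AB by auto
    have "u \<noteq> [] \<longrightarrow> last u > x" "v \<noteq> [] \<longrightarrow> x < hd v" using min by auto
    then have "zigzag (>) (<) p (u @ x # v)" using zigzag_valley_split[OF U(2), of "(>)" "(<)" x v] u v by blast
    then show "glue (U, (u, v)) \<in> zigperms p A"
      using dist u v U AB by (auto simp: glue_def zigperms_def)
    show "q powi vstat ds us p (glue (U, (u, v))) = q ^ cross U (B - U) * q ^ split_exponent ds us (card U) (card (B - U))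
        * (q powi vstat ds us p u * q powi vstat ds us True v)"
      using q unfolding glue_def prod.case vstat_split[OF dist min U(2)]
      by (simp add: power_int_add u v mult_ac)
  qed
  have bij: "bij_betw glue T (zigperms p A)"
  proof (rule bij_betw_imageI)
    show "inj_on glue T"
    proof (rule inj_onI)
      fix s t assume st: "s \<in> T" "t \<in> T" "glue s = glue t"
      obtain U u v U' u' v' where s: "s = (U, (u, v))" and t: "t = (U', (u', v'))" by (metis prod.exhaust)
      have "x \<notin> set u" "x \<notin> set v" "x \<notin> set u'" "x \<notin> set v'" "set u = U" "set u' = U'"
        using st s t AB by (auto simp: T_def Us_def zigperms_def)
      then show "s = t" using st(3) unfolding s t glue_def by (auto simp: append_Cons_eq_iff)
    qed
    show "glue ` T = zigperms p A"
    proof (intro equalityI subsetI)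
      fix w assume "w \<in> glue ` T"
      then show "w \<in> zigperms p A" using glue_in by (auto simp: T_def)
    next
      fix w assume w: "w \<in> zigperms p A"
      then have "x \<in> set w" using xA by (auto simp: zigperms_def)
      then obtain u v where uv: "w = u @ x # v" by (auto simp: in_set_conv_decomp)
      have dist: "distinct (u @ x # v)" and set: "set u \<union> set v = B"
        using w uv AB by (auto simp: zigperms_def)
      then have min: "\<forall>y\<in>set u \<union> set v. x < y" using xB by simp
      have par: "p \<longleftrightarrow> odd (length u)"
        using w uv m length_zigperms[OF w] by (intro zigzag_min_position[OF _ min]) (auto simp: zigperms_def)
      have "zigzag (>) (<) p u" "zigzag (>) (<) True v"
        using zigzag_valley_split[OF par, of "(>)" "(<)" x v] w uv by (auto simp: zigperms_def)
      moreover have "set v = B - set u" using dist set by auto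
      ultimately have "(set u, (u, v)) \<in> T"
        using dist set par by (auto simp: T_def Us_def zigperms_def distinct_card)
      then show "w \<in> glue ` T" unfolding uv by (intro image_eqI[of _ _ "(set u, (u, v))"]) (simp_all add: glue_def)
    qed
  qed
  have "zigperms_gf q ds us p A = (\<Sum>t\<in>T. q powi vstat ds us p (glue t))"
    unfolding zigperms_gf_def by (rule sum.reindex_bij_betw[OF bij, symmetric])
  also have "\<dots> = (\<Sum>(U, z)\<in>T. q powi vstat ds us p (glue (U, z)))" by (simp add: case_prod_unfold)
  also have "\<dots> = (\<Sum>U\<in>Us. \<Sum>z\<in>zigperms p U \<times> zigperms True (B - U). q powi vstat ds us p (glue (U, z)))"
    unfolding T_def by (rule sum.Sigma[symmetric]) (use Us fU B finite_zigperms in auto)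
  also have "\<dots> = (\<Sum>U\<in>Us. q ^ cross U (B - U) * q ^ split_exponent ds us (card U) (card (B - U)) *
     (zigperms_gf q ds us p U * zigperms_gf q ds us True (B - U)))"
  proof (rule sum.cong)
    fix U assume U: "U \<in> Us"
    have "(\<Sum>z\<in>zigperms p U \<times> zigperms True (B - U). q powi vstat ds us p (glue (U, z)))
      = (\<Sum>(u, v)\<in>zigperms p U \<times> zigperms True (B - U). q ^ cross U (B - U) * q ^ split_exponent ds us (card U) (card (B - U))
        * (q powi vstat ds us p u * q powi vstat ds us True v))"
      using stat[OF U] by (intro sum.cong) auto
    also have "\<dots> = q ^ cross U (B - U) * q ^ split_exponent ds us (card U) (card (B - U)) *
       (zigperms_gf q ds us p U * zigperms_gf q ds us True (B - U))"
      by (simp only: zigperms_gf_def sum_product sum.cartesian_product) (subst sum_distrib_left, rule sum.cong, auto)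
    finally show "(\<Sum>z\<in>zigperms p U \<times> zigperms True (B - U). q powi vstat ds us p (glue (U, z))) =
       q ^ cross U (B - U) * q ^ split_exponent ds us (card U) (card (B - U)) *
       (zigperms_gf q ds us p U * zigperms_gf q ds us True (B - U))" .
  qed simp
  finally show ?thesis by (simp add: Us_def)
qed

text \<open>In the recurrence for permutations the terms depend on the set \<open>U\<close> only through \<open>cross U (B - U)\<close> and the size of
\<open>U\<close>. Summing over all sets of one size turns the factor \<open>qpoch q q L * qpoch q q (m - 1 - L)\<close> of the
induction hypotheses into \<open>qpoch q q (m - 1)\<close>, and the recurrence for words remains.\<close>

theorem zigperms_gf_eq_gf_zigwords:
  assumes "us \<longrightarrow> ds" "finite A"
  shows "zigperms_gf q ds us p A = qpoch q q (card A) * gf q (zigwords ds us p (card A))"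
  using assms(2)
proof (induction "card A" arbitrary: A p rule: less_induct)
  case less
  consider "card A = 0" | "card A = 1" "p" | "2 \<le> card A \<or> card A = 1 \<and> \<not> p" by linarith
  then show ?case
  proof cases
    case 1
    then have "A = {}" using less.prems by simp
    moreover have "zigperms p {} = {[]}" by (auto simp: zigperms_def zigzag_short)
    ultimately show ?thesis
      by (simp add: zigperms_gf_def gf_zigwords_0[OF q] qpoch_def vstat_def nasc_def ndes_def)
  next
    case 2
    then obtain a where "A = {a}" by (auto simp: card_1_singleton_iff)
    moreover have "zigperms p {a} = {[a]}"
    proof -
      have "w = [a]" if "distinct w" "set w = {a}" for w
        using that by (cases w; cases "tl w") auto
      then show ?thesis by (auto simp: zigperms_def zigzag_short)
    qed
    ultimately show ?thesis using 2 q gf_zigwords_1[OF q, of ds us True]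
      by (simp add: zigperms_gf_def qpoch_def vstat_def nasc_def ndes_def invs_Cons)
  next
    case 3
    define B where "B = A - {Min A}"
    define m where "m = card A"
    have m: "2 \<le> m \<or> m = 1 \<and> \<not> p" using 3 by (simp add: m_def)
    have "A \<noteq> {}" using 3 by auto
    then have B: "finite B" "card B = m - 1" using less.prems by (auto simp: B_def m_def)
    let ?Z = "\<lambda>p k. gf q (zigwords ds us p k)"
    let ?t = "\<lambda>L. q ^ split_exponent ds us L (m - 1 - L) * (?Z p L * ?Z True (m - 1 - L))"
    have pos: "qpoch q q i > 0" for i by (rule qpoch_pos[OF q])
    have card_diff: "card (B - U) = m - 1 - card U" "card U < m" if "U \<subseteq> B" for U
      using that B m finite_subset[OF that B(1)] card_mono[OF B(1) that] by (auto simp: card_Diff_subset)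
    have "zigperms_gf q ds us p A = (\<Sum>U | U \<subseteq> B \<and> (p \<longleftrightarrow> odd (card U)).
       q ^ cross U (B - U) * q ^ split_exponent ds us (card U) (card (B - U)) *
       (zigperms_gf q ds us p U * zigperms_gf q ds us True (B - U)))"
      unfolding B_def by (rule zigperms_recurrence[OF less.prems 3])
    also have "\<dots> = (\<Sum>U | U \<subseteq> B \<and> (p \<longleftrightarrow> odd (card U)). q ^ cross U (B - U) *
       (qpoch q q (card U) * qpoch q q (m - 1 - card U) * ?t (card U)))"
    proof (rule sum.cong)
      fix U assume "U \<in> {U. U \<subseteq> B \<and> (p \<longleftrightarrow> odd (card U))}"
      then have U: "U \<subseteq> B" by simp
      have "zigperms_gf q ds us p U = qpoch q q (card U) * ?Z p (card U)"
        using card_diff[OF U] finite_subset[OF U B(1)] by (intro less.hyps) (auto simp: m_def)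
      moreover have "zigperms_gf q ds us True (B - U) = qpoch q q (card (B - U)) * ?Z True (card (B - U))"
        using card_diff[OF U] B m by (intro less.hyps) (auto simp: m_def)
      ultimately show "q ^ cross U (B - U) * q ^ split_exponent ds us (card U) (card (B - U)) *
           (zigperms_gf q ds us p U * zigperms_gf q ds us True (B - U)) = q ^ cross U (B - U) *
         (qpoch q q (card U) * qpoch q q (m - 1 - card U) * ?t (card U))"
        by (simp only: card_diff[OF U] mult_ac)
    qed simp
    also have "\<dots> = (\<Sum>L | L < m \<and> (p \<longleftrightarrow> odd L). \<Sum>U | U \<subseteq> B \<and> card U = L. q ^ cross U (B - U) *
       (qpoch q q (card U) * qpoch q q (m - 1 - card U) * ?t (card U)))"
    proof -
      have group: "(\<Sum>L | L < m \<and> (p \<longleftrightarrow> odd L). \<Sum>U\<in>{U \<in> {U. U \<subseteq> B \<and> (p \<longleftrightarrow> odd (card U))}. card U = L}. q ^ cross U (B - U) *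
         (qpoch q q (card U) * qpoch q q (m - 1 - card U) * ?t (card U)))
        = (\<Sum>U | U \<subseteq> B \<and> (p \<longleftrightarrow> odd (card U)). q ^ cross U (B - U) *
         (qpoch q q (card U) * qpoch q q (m - 1 - card U) * ?t (card U)))"
        by (rule sum.group) (use B card_diff in auto)
      have sets: "{U \<in> {U. U \<subseteq> B \<and> (p \<longleftrightarrow> odd (card U))}. card U = L} = {U. U \<subseteq> B \<and> card U = L}"
        if "p \<longleftrightarrow> odd L" for L using that by auto
      show ?thesis by (subst group[symmetric], intro sum.cong refl) (use sets in auto)
    qed
    also have "\<dots> = (\<Sum>L | L < m \<and> (p \<longleftrightarrow> odd L). qpoch q q (m - 1) * ?t L)"
    proof (rule sum.cong)
      fix L assume "L \<in> {L. L < m \<and> (p \<longleftrightarrow> odd L)}"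
      then have L: "L \<le> m - 1" by auto
      have "(\<Sum>U | U \<subseteq> B \<and> card U = L. q ^ cross U (B - U) * (qpoch q q (card U) * qpoch q q (m - 1 - card U) * ?t (card U)))
        = (\<Sum>U | U \<subseteq> B \<and> card U = L. q ^ cross U (B - U)) * (qpoch q q L * qpoch q q (m - 1 - L) * ?t L)"
        unfolding sum_distrib_right by (intro sum.cong) auto
      also have "\<dots> = qpoch q q (m - 1) * ?t L"
        using sum_cross_subsets[OF B(1), of L] L B(2) pos[of L] pos[of "m - 1 - L"] by (simp add: field_simps)
      finally show "(\<Sum>U | U \<subseteq> B \<and> card U = L. q ^ cross U (B - U) * (qpoch q q (card U) * qpoch q q (m - 1 - card U) * ?t (card U)))
        = qpoch q q (m - 1) * ?t L" .
    qed simp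
    also have "\<dots> = qpoch q q (m - 1) * ((1 - q ^ m) * ?Z p m)"
      unfolding zigwords_recurrence[OF q assms(1) m] sum_distrib_left ..
    also have "\<dots> = qpoch q q m * ?Z p m"
      using m by (cases m) (auto simp: qpoch_Suc)
    finally show ?thesis by (simp add: m_def)
  qed
qed

end


section \<open>The six rows\<close>

lemma bij_betw_word:
  "bij_betw (word m) {\<pi>. \<pi> permutes {1..m} \<and> P (word m \<pi>)} {w. distinct w \<and> set w = {1..m} \<and> P w}"
proof -
  have nth: "word m \<pi> ! (j - 1) = \<pi> j" if "j \<in> {1..m}" for \<pi> j
    using that by (auto simp: word_def simp del: upt_Suc)
  have word: "distinct (word m \<pi>) \<and> set (word m \<pi>) = {1..m}" if "\<pi> permutes {1..m}" for \<pi>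
  proof -
    have "set [1..<m + 1] = {1..m}" by auto
    then show ?thesis
      using permutes_image[OF that] permutes_inj_on[OF that] by (simp add: word_def distinct_map del: upt_Suc)
  qed
  show ?thesis
  proof (rule bij_betw_imageI)
    show "inj_on (word m) {\<pi>. \<pi> permutes {1..m} \<and> P (word m \<pi>)}"
    proof (rule inj_onI)
      fix \<pi> \<sigma> assume ps: "\<pi> \<in> {\<pi>. \<pi> permutes {1..m} \<and> P (word m \<pi>)}"
        "\<sigma> \<in> {\<pi>. \<pi> permutes {1..m} \<and> P (word m \<pi>)}" "word m \<pi> = word m \<sigma>"
      show "\<pi> = \<sigma>"
      proof
        fix j show "\<pi> j = \<sigma> j"
        proof (cases "j \<in> {1..m}")
          case True
          then show ?thesis using nth[of j \<pi>] nth[of j \<sigma>] ps(3) by simp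
        next
          case False
          then show ?thesis using ps permutes_not_in by (metis mem_Collect_eq)
        qed
      qed
    qed
    show "word m ` {\<pi>. \<pi> permutes {1..m} \<and> P (word m \<pi>)} = {w. distinct w \<and> set w = {1..m} \<and> P w}"
    proof (intro equalityI subsetI)
      fix w assume "w \<in> {w. distinct w \<and> set w = {1..m} \<and> P w}"
      then have w: "distinct w" "set w = {1..m}" "P w" by auto
      have len: "length w = m" using distinct_card[OF w(1)] w(2) by simp
      define \<pi> where "\<pi> j = (if j \<in> {1..m} then w ! (j - 1) else j)" for j
      have eq: "word m \<pi> = w"
        by (rule nth_equalityI) (auto simp: word_def len \<pi>_def simp del: upt_Suc)
      have "\<pi> permutes {1..m}"
      proof (rule bij_imp_permutes)
        have inj: "inj_on \<pi> {1..m}"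
          using w(1) len by (auto simp: inj_on_def \<pi>_def nth_eq_iff_index_eq)
        have "\<pi> ` {1..m} \<subseteq> {1..m}"
        proof
          fix y assume "y \<in> \<pi> ` {1..m}"
          then obtain j where "j \<in> {1..m}" "y = w ! (j - 1)" by (auto simp: \<pi>_def)
          moreover from this have "y \<in> set w" using len by (auto intro!: nth_mem)
          ultimately show "y \<in> {1..m}" using w(2) by simp
        qed
        then show "bij_betw \<pi> {1..m} {1..m}" using inj endo_inj_surj[of "{1..m}" \<pi>] by (simp add: bij_betw_def)
      qed (simp add: \<pi>_def del: atLeastAtMost_iff)
      then show "w \<in> word m ` {\<pi>. \<pi> permutes {1..m} \<and> P (word m \<pi>)}" using eq w(3) by blast
    qed (use word in auto)
  qed
qed

lemma bij_betw_word_Alt: "bij_betw (word m) (Alt m) (zigperms False {1..m})"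
  using bij_betw_word[of m "alternating (<) (>)"] by (simp add: Alt_def zigperms_def zigzag_def)

lemma bij_betw_word_Ralt: "bij_betw (word m) (Ralt m) (zigperms True {1..m})"
  using bij_betw_word[of m "alternating (>) (<)"] by (simp add: Ralt_def zigperms_def zigzag_def)

lemma valleys_map_upt:
  "valleys p (map f [1..<m + 1]) = map f (filter (\<lambda>i. if p then even i else odd i) [1..<m + 1])"
proof (induction m)
  case (Suc m)
  have "[1..<Suc m + 1] = [1..<m + 1] @ [m + 1]" by simp
  then show ?case using Suc by (simp add: valleys_append del: upt_Suc)
qed simp

lemma even_word_eq_valleys: "even_word m \<pi> = valleys True (word m \<pi>)"
  unfolding even_word_def word_def valleys_map_upt by simp

lemma odd_word_eq_valleys: "odd_word m \<pi> = valleys False (word m \<pi>)"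
  unfolding odd_word_def word_def valleys_map_upt by simp

definition rev_compl :: "nat \<Rightarrow> nat list \<Rightarrow> nat list" where
  "rev_compl m w = rev (map (\<lambda>x. Suc m - x) w)"

lemma length_rev_compl [simp]: "length (rev_compl m w) = length w"
  by (simp add: rev_compl_def)

lemma rev_compl_rev_compl: "set w \<subseteq> {1..m} \<Longrightarrow> rev_compl m (rev_compl m w) = w"
  by (simp add: rev_compl_def rev_map o_def) (induction w; auto)

lemma rev_compl_perm:
  assumes "distinct w" "set w = {1..m}"
  shows "distinct (rev_compl m w)" "set (rev_compl m w) = {1..m}"
proof -
  have "inj_on (\<lambda>x. Suc m - x) {1..m}" by (auto simp: inj_on_def)
  then show "distinct (rev_compl m w)" using assms by (simp add: rev_compl_def distinct_map)
  have "x \<in> (\<lambda>x. Suc m - x) ` {1..m}" if "x \<in> {1..m}" for x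
    using that by (intro image_eqI[of _ _ "Suc m - x"]) auto
  then have "(\<lambda>x. Suc m - x) ` {1..m} = {1..m}" by auto
  then show "set (rev_compl m w) = {1..m}" using assms by (simp add: rev_compl_def)
qed

lemma zigzag_rev_compl:
  assumes "set w \<subseteq> {1..m}" "odd (length w)"
  shows "zigzag (>) (<) p (rev_compl m w) \<longleftrightarrow> zigzag (>) (<) (\<not> p) w"
proof -
  have nth: "w ! i \<in> {1..m}" if "i < length w" for i using assms(1) nth_mem[OF that] by blast
  have compl: "alternating \<alpha> \<beta> (map (\<lambda>x. Suc m - x) w) \<longleftrightarrow> alternating \<alpha>' \<beta>' w"
    if "\<And>x y. x \<in> {1..m} \<Longrightarrow> y \<in> {1..m} \<Longrightarrow> \<alpha> (Suc m - x) (Suc m - y) \<longleftrightarrow> \<alpha>' x y"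
      "\<And>x y. x \<in> {1..m} \<Longrightarrow> y \<in> {1..m} \<Longrightarrow> \<beta> (Suc m - x) (Suc m - y) \<longleftrightarrow> \<beta>' x y"
    for \<alpha> \<beta> \<alpha>' \<beta>' :: "nat \<Rightarrow> nat \<Rightarrow> bool"
    unfolding alternating_def using that nth by simp
  have "alternating (>) (<) (map (\<lambda>x. Suc m - x) w) \<longleftrightarrow> alternating (<) (>) w"
    by (rule compl) auto
  moreover have "alternating (<) (>) (map (\<lambda>x. Suc m - x) w) \<longleftrightarrow> alternating (>) (<) w"
    by (rule compl) auto
  ultimately show ?thesis
    using assms(2) by (simp add: zigzag_def rev_compl_def alternating_rev)
qed

text \<open>For odd length, reversal keeps peaks at peaks and the complement turns them into valleys.\<close>

lemma bij_betw_rev_compl: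
  assumes "odd m"
  shows "bij_betw (rev_compl m) (zigperms p {1..m}) (zigperms (\<not> p) {1..m})"
proof -
  have maps: "rev_compl m w \<in> zigperms (\<not> p) {1..m}" if w: "w \<in> zigperms p {1..m}" for p w
  proof -
    have "length w = m" using length_zigperms[OF w] by simp
    then show ?thesis using w rev_compl_perm[of w m] zigzag_rev_compl[of w m "\<not> p"] assms
      by (auto simp: zigperms_def)
  qed
  have inv: "rev_compl m (rev_compl m w) = w" if "w \<in> zigperms p {1..m}" for p w
    using that by (intro rev_compl_rev_compl) (auto simp: zigperms_def)
  show ?thesis
    by (rule bij_betw_byWitness[where f' = "rev_compl m"]) (use maps[of _ p] maps[of _ "\<not> p"] inv in auto)
qed

lemma valleys_map: "valleys p (map f w) = map f (valleys p w)"
  by (induction w arbitrary: p) auto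

lemma valleys_rev: "valleys p (rev w) = rev (valleys (if odd (length w) then p else \<not> p) w)"
  by (induction w arbitrary: p) (auto simp: valleys_append)

lemma valleys_rev_compl: "odd (length w) \<Longrightarrow> valleys p (rev_compl m w) = rev_compl m (valleys p w)"
  by (simp add: rev_compl_def valleys_rev valleys_map)

lemma des_rev_compl: "set w \<subseteq> {1..m} \<Longrightarrow> des (rev_compl m w) = des w"
  unfolding rev_compl_def des_rev by (rule asc_map_complement) auto

lemma asc_rev_compl: "set w \<subseteq> {1..m} \<Longrightarrow> asc (rev_compl m w) = asc w"
  unfolding rev_compl_def asc_rev by (rule des_map_complement) auto

text \<open>The pair of positions \<open>(i, j)\<close> corresponds to \<open>(k - 1 - j, k - 1 - i)\<close> in a word of length \<open>k\<close>: reversal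
and complement both turn the comparison around.\<close>

lemma invs_rev_compl:
  assumes "set w \<subseteq> {1..m}"
  shows "invs (rev_compl m w) = invs w"
proof -
  let ?k = "length w"
  define X where "X w = {(i, j). i < j \<and> j < length w \<and> w ! i > (w ! j :: nat)}" for w
  define F where "F = (\<lambda>(i, j). (?k - 1 - j, ?k - 1 - i))"
  have nth: "rev_compl m w ! i = Suc m - w ! (?k - 1 - i)" if "i < ?k" for i
    using that by (simp add: rev_compl_def rev_nth)
  have in_range: "w ! i \<in> {1..m}" if "i < ?k" for i using assms nth_mem[OF that] by blast
  have swap: "F z \<in> X w \<longleftrightarrow> z \<in> X (rev_compl m w)" if "fst z < snd z" "snd z < ?k" for z
  proof -
    obtain i j where z: "z = (i, j)" by force
    have ij: "i < ?k" "j < ?k" using that by (auto simp: z)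
    have "?k - 1 - j < ?k - 1 - i" "?k - 1 - i < ?k" using that by (auto simp: z)
    moreover have "rev_compl m w ! i > rev_compl m w ! j \<longleftrightarrow> w ! (?k - 1 - i) < w ! (?k - 1 - j)"
    proof -
      have "a \<in> {1..m} \<Longrightarrow> b \<in> {1..m} \<Longrightarrow> Suc m - b < Suc m - a \<longleftrightarrow> a < b" for a b by auto
      then show ?thesis
        using in_range[of "?k - 1 - i"] in_range[of "?k - 1 - j"] ij
        unfolding nth[OF ij(1)] nth[OF ij(2)] by simp
    qed
    ultimately show ?thesis using that by (simp add: z F_def X_def)
  qed
  have FF: "F (F z) = z" "fst (F z) < snd (F z)" "snd (F z) < ?k" if "fst z < snd z" "snd z < ?k" for z
    using that by (auto simp: F_def case_prod_unfold prod_eq_iff)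
  have bounds: "fst z < snd z" "snd z < ?k" if "z \<in> X (rev_compl m w) \<or> z \<in> X w" for z
    using that by (auto simp: X_def)
  have "bij_betw F (X (rev_compl m w)) (X w)"
  proof (rule bij_betw_byWitness[where f' = F])
    show "\<forall>z\<in>X (rev_compl m w). F (F z) = z" "\<forall>z\<in>X w. F (F z) = z" using FF(1) bounds by blast+
    show "F ` X (rev_compl m w) \<subseteq> X w" using swap bounds by blast
    show "F ` X w \<subseteq> X (rev_compl m w)"
    proof
      fix z assume "z \<in> F ` X w"
      then obtain y where y: "y \<in> X w" "z = F y" by blast
      then show "z \<in> X (rev_compl m w)" using swap[of z] FF[of y] bounds[of y] by simp
    qed
  qed
  then have "card (X (rev_compl m w)) = card (X w)" by (rule bij_betw_same_card)
  then show ?thesis by (simp only: invs_def X_def)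
qed

context
  fixes q :: real
  assumes q: "0 < q" "q < 1"
begin

text \<open>The statistic has to agree with \<open>vstat\<close> only on one of the two classes of alternating permutations;
invariance under \<open>rev_compl\<close> carries the result to the other class.\<close>

lemma sum_stat_alternating:
  assumes "us \<longrightarrow> ds" "odd m"
    and stat: "\<And>w. w \<in> zigperms p {1..m} \<Longrightarrow> vstat ds us p w = g w"
    and invariant: "\<And>w. distinct w \<Longrightarrow> set w = {1..m} \<Longrightarrow> g (rev_compl m w) = g w"
  shows "(\<Sum>\<pi>\<in>Alt m. q powi g (word m \<pi>)) = qpoch q q m * gf q (zigwords ds us p m)"
    and "(\<Sum>\<pi>\<in>Ralt m. q powi g (word m \<pi>)) = qpoch q q m * gf q (zigwords ds us p m)"
proof -
  let ?S = "\<lambda>p. \<Sum>w\<in>zigperms p {1..m}. q powi g w"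
  have base: "?S p = qpoch q q m * gf q (zigwords ds us p m)"
  proof -
    have "?S p = zigperms_gf q ds us p {1..m}"
      unfolding zigperms_gf_def by (rule sum.cong) (simp_all add: stat)
    then show ?thesis using zigperms_gf_eq_gf_zigwords[OF q assms(1), of "{1..m}" p] by simp
  qed
  have "?S (\<not> p) = (\<Sum>w\<in>zigperms p {1..m}. q powi g (rev_compl m w))"
    by (rule sum.reindex_bij_betw[OF bij_betw_rev_compl[OF assms(2)], symmetric])
  also have "\<dots> = ?S p" by (rule sum.cong) (auto simp: zigperms_def invariant)
  finally have "?S r = qpoch q q m * gf q (zigwords ds us p m)" for r
    using base by (cases "r = p") auto
  then show "(\<Sum>\<pi>\<in>Alt m. q powi g (word m \<pi>)) = qpoch q q m * gf q (zigwords ds us p m)"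
    "(\<Sum>\<pi>\<in>Ralt m. q powi g (word m \<pi>)) = qpoch q q m * gf q (zigwords ds us p m)"
    unfolding sum.reindex_bij_betw[OF bij_betw_word_Alt, where g = "\<lambda>w. q powi g w"]
      sum.reindex_bij_betw[OF bij_betw_word_Ralt, where g = "\<lambda>w. q powi g w"] by blast+
qed

lemma series_altwords:
  assumes "\<And>n. gf q (altwords \<beta> (\<lambda>x y. \<not> \<alpha> x y) (2 * n)) = c n / qpoch q q (2 * n)" "c 0 = 1"
    and "\<And>n. gf q (altwords (\<lambda>x y. \<not> \<alpha> x y) \<beta> (2 * n + 1)) = d n / qpoch q q (2 * n + 1)"
  shows "odd_fps (\<lambda>n. gf q (altwords \<alpha> \<beta> (2 * n + 1))) =
    odd_fps (\<lambda>n. (-1) ^ n * d n / qpoch q q (2 * n + 1)) / even_fps (\<lambda>n. (-1) ^ n * c n / qpoch q q (2 * n))"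
proof -
  have "(\<Sum>k\<le>n. (-1) ^ k * (gf q (altwords \<alpha> \<beta> (2 * k + 1)) * (c (n - k) / qpoch q q (2 * (n - k)))))
      = d n / qpoch q q (2 * n + 1)" for n
    using alternating_words_recurrence[OF q, of \<alpha> \<beta> n] unfolding assms(1,3) .
  moreover have "c 0 / qpoch q q (2 * 0) \<noteq> 0" using assms(2) by (simp add: qpoch_def)
  ultimately show ?thesis
    using odd_fps_eq_divide[of "\<lambda>k. gf q (altwords \<alpha> \<beta> (2 * k + 1))" "\<lambda>k. c k / qpoch q q (2 * k)"
        "\<lambda>n. d n / qpoch q q (2 * n + 1)"] by simp
qed

lemma gf_altwords_reverse:
  "gf q (altwords \<alpha> \<beta> (2 * n + 1)) = gf q (altwords (\<lambda>x y. \<beta> y x) (\<lambda>x y. \<alpha> y x) (2 * n + 1))"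
  using rev_altwords_odd[of "2 * n + 1" \<alpha> \<beta>] gf_rev[OF q, of "altwords \<alpha> \<beta> (2 * n + 1)"] by simp

end

text \<open>The conclusion of the theorem for one row, with \<open>tau\<close> already replaced by the generating function of words.\<close>

definition row_identities where
  "row_identities q \<alpha> \<beta> TAB SH M I A B C D \<longleftrightarrow>
     (\<forall>n. ((\<lambda>\<pi>. q ^ filling_size (SH n) \<pi>) has_sum gf q (altwords \<alpha> \<beta> (2 * n + 1))) (TAB (SH n)) \<and>
          gf q (altwords \<alpha> \<beta> (2 * n + 1)) = M n / qpoch q q (2 * n + 1) \<and>
          gf q (altwords \<alpha> \<beta> (2 * n + 1)) = I Alt n / qpoch q q (2 * n + 1) \<and>
          gf q (altwords \<alpha> \<beta> (2 * n + 1)) = I Ralt n / qpoch q q (2 * n + 1)) \<and>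
     odd_fps (\<lambda>n. gf q (altwords \<alpha> \<beta> (2 * n + 1))) =
       odd_fps (\<lambda>n. (-1) ^ n * q powi (A * (int n)\<^sup>2 + B * int n) / qpoch q q (2 * n + 1)) /
       even_fps (\<lambda>n. (-1) ^ n * q powi (C * (int n)\<^sup>2 + D * int n) / qpoch q q (2 * n))"

text \<open>The series is computed for the reversed words, whose relations are first \<open>\<lambda>x y. C y x\<close> and then \<open>R\<close>. The
recurrence negates the first relation: for weak falls and strict rises the original words would lead to
strict chains and hence to other exponents.\<close>

lemma row_identities_outer:
  fixes q :: real and R C :: "nat \<Rightarrow> nat \<Rightarrow> bool" and \<omega> :: "nat \<Rightarrow> nat \<Rightarrow> nat" and g :: "nat list \<Rightarrow> int"
  assumes q: "0 < q" "q < 1"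
    and \<omega>: "\<And>n. inj (\<omega> n)"
      "\<And>n k x y. k < n \<Longrightarrow> R y x \<longleftrightarrow> x > y \<or> x = y \<and> \<omega> n (2 * k + 1) < \<omega> n (2 * k + 2)"
      "\<And>n k x y. k < n \<Longrightarrow> C x y \<longleftrightarrow> x < y \<or> x = y \<and> \<omega> n (2 * k + 3) < \<omega> n (2 * k + 2)"
    and zig: "us \<longrightarrow> ds"
      "\<And>n. gf q (altwords (\<lambda>x y. R y x) C (2 * n + 1)) = gf q (zigwords ds us True (2 * n + 1))"
    and g: "\<And>n w. w \<in> zigperms True {1..2 * n + 1} \<Longrightarrow> vstat ds us True w = g w"
      "\<And>n w. distinct w \<Longrightarrow> set w = {1..2 * n + 1} \<Longrightarrow> g (rev_compl (2 * n + 1) w) = g w"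
    and c: "\<And>n. gf q (altwords (\<lambda>x y. R x y) (\<lambda>x y. \<not> C y x) (2 * n)) = q powi (C' * (int n)\<^sup>2 + D' * int n) / qpoch q q (2 * n)"
    and d: "\<And>n. gf q (altwords (\<lambda>x y. \<not> C y x) (\<lambda>x y. R x y) (2 * n + 1)) = q powi (A' * (int n)\<^sup>2 + B' * int n) / qpoch q q (2 * n + 1)"
  shows "row_identities q (\<lambda>x y. R y x) C (tableaux R C) outer_strip
    (\<lambda>n. \<Sum>\<pi>\<in>Alt (2 * n + 1). q ^ maj (word (2 * n + 1) (\<omega> n \<circ> inv \<pi>)))
    (\<lambda>Alts n. \<Sum>\<pi>\<in>Alts (2 * n + 1). q powi g (word (2 * n + 1) \<pi>)) A' B' C' D'"
proof -
  let ?F = "\<lambda>n. gf q (altwords (\<lambda>x y. R y x) C (2 * n + 1))"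
  have pos: "qpoch q q m > 0" for m by (rule qpoch_pos[OF q])
  have maj: "?F n = (\<Sum>\<pi>\<in>Alt (2 * n + 1). q ^ maj (word (2 * n + 1) (\<omega> n \<circ> inv \<pi>))) / qpoch q q (2 * n + 1)" for n
    by (rule gf_altwords_maj_Alt[OF q \<omega>(1)]) (rule \<omega>(2,3), assumption)+
  have inv: "?F n = (\<Sum>\<pi>\<in>Alt (2 * n + 1). q powi g (word (2 * n + 1) \<pi>)) / qpoch q q (2 * n + 1)"
    "?F n = (\<Sum>\<pi>\<in>Ralt (2 * n + 1). q powi g (word (2 * n + 1) \<pi>)) / qpoch q q (2 * n + 1)" for n
    using sum_stat_alternating[OF q zig(1), of "2 * n + 1" True g] g[of _ n] pos[of "2 * n + 1"] zig(2)[of n]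
    by simp_all
  have "odd_fps (\<lambda>n. gf q (altwords (\<lambda>x y. C y x) R (2 * n + 1))) =
     odd_fps (\<lambda>n. (-1) ^ n * q powi (A' * (int n)\<^sup>2 + B' * int n) / qpoch q q (2 * n + 1)) /
     even_fps (\<lambda>n. (-1) ^ n * q powi (C' * (int n)\<^sup>2 + D' * int n) / qpoch q q (2 * n))"
    by (rule series_altwords[OF q c _ d]) simp
  then have "odd_fps ?F =
     odd_fps (\<lambda>n. (-1) ^ n * q powi (A' * (int n)\<^sup>2 + B' * int n) / qpoch q q (2 * n + 1)) /
     even_fps (\<lambda>n. (-1) ^ n * q powi (C' * (int n)\<^sup>2 + D' * int n) / qpoch q q (2 * n))"
    unfolding gf_altwords_reverse[OF q, of "\<lambda>x y. R y x" C] .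
  then show ?thesis
    unfolding row_identities_def using maj inv has_sum_outer_tableaux[OF q]
    by (intro conjI allI) assumption+
qed

lemma row_identities_inner:
  fixes q :: real and R C :: "nat \<Rightarrow> nat \<Rightarrow> bool" and \<omega> :: "nat \<Rightarrow> nat \<Rightarrow> nat" and g :: "nat list \<Rightarrow> int"
  assumes q: "0 < q" "q < 1"
    and \<omega>: "\<And>n. inj (\<omega> n)"
      "\<And>n k x y. k < n \<Longrightarrow> C x y \<longleftrightarrow> x < y \<or> x = y \<and> \<omega> n (2 * k + 2) < \<omega> n (2 * k + 1)"
      "\<And>n k x y. k < n \<Longrightarrow> R y x \<longleftrightarrow> x > y \<or> x = y \<and> \<omega> n (2 * k + 2) < \<omega> n (2 * k + 3)"
    and zig: "us \<longrightarrow> ds"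
      "\<And>n. gf q (altwords C (\<lambda>x y. R y x) (2 * n + 1)) = gf q (zigwords ds us False (2 * n + 1))"
    and g: "\<And>n w. w \<in> zigperms False {1..2 * n + 1} \<Longrightarrow> vstat ds us False w = g w"
      "\<And>n w. distinct w \<Longrightarrow> set w = {1..2 * n + 1} \<Longrightarrow> g (rev_compl (2 * n + 1) w) = g w"
    and c: "\<And>n. gf q (altwords (\<lambda>x y. R y x) (\<lambda>x y. \<not> C x y) (2 * n)) = q powi (C' * (int n)\<^sup>2 + D' * int n) / qpoch q q (2 * n)"
    and d: "\<And>n. gf q (altwords (\<lambda>x y. \<not> C x y) (\<lambda>x y. R y x) (2 * n + 1)) = q powi (A' * (int n)\<^sup>2 + B' * int n) / qpoch q q (2 * n + 1)"
  shows "row_identities q C (\<lambda>x y. R y x) (tableaux R C) inner_strip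
    (\<lambda>n. \<Sum>\<pi>\<in>Ralt (2 * n + 1). q ^ maj (word (2 * n + 1) (\<omega> n \<circ> inv \<pi>)))
    (\<lambda>Alts n. \<Sum>\<pi>\<in>Alts (2 * n + 1). q powi g (word (2 * n + 1) \<pi>)) A' B' C' D'"
proof -
  let ?F = "\<lambda>n. gf q (altwords C (\<lambda>x y. R y x) (2 * n + 1))"
  have pos: "qpoch q q m > 0" for m by (rule qpoch_pos[OF q])
  have maj: "?F n = (\<Sum>\<pi>\<in>Ralt (2 * n + 1). q ^ maj (word (2 * n + 1) (\<omega> n \<circ> inv \<pi>))) / qpoch q q (2 * n + 1)" for n
    by (rule gf_altwords_maj_Ralt[OF q \<omega>(1)]) (rule \<omega>(2,3), assumption)+
  have inv: "?F n = (\<Sum>\<pi>\<in>Alt (2 * n + 1). q powi g (word (2 * n + 1) \<pi>)) / qpoch q q (2 * n + 1)"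
    "?F n = (\<Sum>\<pi>\<in>Ralt (2 * n + 1). q powi g (word (2 * n + 1) \<pi>)) / qpoch q q (2 * n + 1)" for n
    using sum_stat_alternating[OF q zig(1), of "2 * n + 1" False g] g[of _ n] pos[of "2 * n + 1"] zig(2)[of n]
    by simp_all
  have "odd_fps ?F =
     odd_fps (\<lambda>n. (-1) ^ n * q powi (A' * (int n)\<^sup>2 + B' * int n) / qpoch q q (2 * n + 1)) /
     even_fps (\<lambda>n. (-1) ^ n * q powi (C' * (int n)\<^sup>2 + D' * int n) / qpoch q q (2 * n))"
    by (rule series_altwords[OF q c _ d]) simp
  then show ?thesis
    unfolding row_identities_def using maj inv has_sum_inner_tableaux[OF q]
    by (intro conjI allI) assumption+
qed

lemma zigwords_eq_altwords:
  "zigwords ds us True m = altwords (fall ds) (rise us) m"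
  "zigwords ds us False m = altwords (rise us) (fall ds) m"
  by (simp_all add: zigwords_def altwords_def zigzag_def)

lemma quadratic_exponents:
  fixes q :: real
  shows "q powi (0 * (int n)\<^sup>2 + 0 * int n) = 1"
    "q powi (1 * (int n)\<^sup>2 + 0 * int n) = q ^ (n ^ 2)"
    "q powi (1 * (int n)\<^sup>2 + 1 * int n) = q ^ (n * (n + 1))"
    "q powi (1 * (int n)\<^sup>2 + -1 * int n) = q ^ ((n - 1) * n)"
proof -
  have "1 * (int n)\<^sup>2 + 0 * int n = int (n ^ 2)" "1 * (int n)\<^sup>2 + 1 * int n = int (n * (n + 1))"
    "1 * (int n)\<^sup>2 + -1 * int n = int ((n - 1) * n)"
    by (auto simp: power2_eq_square algebra_simps of_nat_diff)
  then show "q powi (0 * (int n)\<^sup>2 + 0 * int n) = 1"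
    "q powi (1 * (int n)\<^sup>2 + 0 * int n) = q ^ (n ^ 2)"
    "q powi (1 * (int n)\<^sup>2 + 1 * int n) = q ^ (n * (n + 1))"
    "q powi (1 * (int n)\<^sup>2 + -1 * int n) = q ^ ((n - 1) * n)"
    by (simp_all only: power_int_of_nat) simp
qed

lemma rev_compl_stats:
  assumes "distinct w" "set w = {1..2 * n + 1}"
  shows "invs (rev_compl (2 * n + 1) w) = invs w"
    "des (valleys p (rev_compl (2 * n + 1) w)) = des (valleys p w)"
    "asc (valleys p (rev_compl (2 * n + 1) w)) = asc (valleys p w)"
    "ndes (valleys p (rev_compl (2 * n + 1) w)) = ndes (valleys p w)"
    "nasc (valleys p (rev_compl (2 * n + 1) w)) = nasc (valleys p w)"
proof -
  have "length w = 2 * n + 1" using distinct_card[OF assms(1)] unfolding assms(2) by simp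
  then have len: "odd (length w)" by simp
  have sub: "set (valleys p w) \<subseteq> {1..2 * n + 1}" using set_valleys[of p w] assms(2) by simp
  show "invs (rev_compl (2 * n + 1) w) = invs w" by (rule invs_rev_compl) (simp add: assms(2))
  show "des (valleys p (rev_compl (2 * n + 1) w)) = des (valleys p w)"
    "asc (valleys p (rev_compl (2 * n + 1) w)) = asc (valleys p w)"
    "ndes (valleys p (rev_compl (2 * n + 1) w)) = ndes (valleys p w)"
    "nasc (valleys p (rev_compl (2 * n + 1) w)) = nasc (valleys p w)"
    unfolding ndes_def nasc_def valleys_rev_compl[OF len] des_rev_compl[OF sub] asc_rev_compl[OF sub]
    by simp_all
qed

lemma vstat_peak_first:
  assumes "w \<in> zigperms True {1..2 * n + 1}"
  shows "vstat True False True w = int (invs w)"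
    "vstat False False True w = int (invs w) - int (ndes (valleys True w))"
    "vstat True True True w = int (invs w) + int (nasc (valleys True w))"
  using length_zigperms[OF assms] by (auto simp: vstat_def)

text \<open>There are \<open>n + 1\<close> valley letters and their \<open>n\<close> steps are ascents or descents, so \<open>ndes\<close> is \<open>asc + 1\<close> and
\<open>nasc\<close> is \<open>des + 1\<close>. The normalization of \<open>vstat\<close> removes the additional one.\<close>

lemma vstat_valley_first:
  assumes w: "w \<in> zigperms False {1..2 * n + 1}"
  shows "vstat True False False w = int (invs w)"
    "vstat False False False w = int (invs w) - int (asc (valleys False w))"
    "vstat True True False w = int (invs w) + int (des (valleys False w))"
proof -
  have len: "length w = 2 * n + 1" using length_zigperms[OF w] by simp
  then have len_valleys: "length (valleys False w) = n + 1" by (simp add: length_valleys)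
  then have "valleys False w \<noteq> []" by auto
  moreover have "distinct (valleys False w)" using w by (intro distinct_valleys) (simp add: zigperms_def)
  ultimately have "des (valleys False w) + asc (valleys False w) = n"
    using des_plus_asc len_valleys by fastforce
  then have "int (ndes (valleys False w)) = int (asc (valleys False w)) + 1"
    "int (nasc (valleys False w)) = int (des (valleys False w)) + 1"
    unfolding ndes_def nasc_def len_valleys by auto
  then show "vstat True False False w = int (invs w)"
    "vstat False False False w = int (invs w) - int (asc (valleys False w))"
    "vstat True True False w = int (invs w) + int (des (valleys False w))"
    using len by (auto simp: vstat_def)
qed

context
  fixes q :: real
  assumes q: "0 < q" "q < 1"
begin

lemma gf_chains:
  "gf q (altwords (\<ge>) (\<ge>) m) = 1 / qpoch q q m"
  "gf q (altwords (>) (\<ge>) (2 * n)) = q ^ (n ^ 2) / qpoch q q (2 * n)"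
  "gf q (altwords (>) (\<ge>) (2 * n + 1)) = q ^ (n ^ 2) / qpoch q q (2 * n + 1)"
  "gf q (altwords (\<ge>) (>) (2 * n)) = q ^ ((n - 1) * n) / qpoch q q (2 * n)"
  "gf q (altwords (\<ge>) (>) (2 * n + 1)) = q ^ (n * (n + 1)) / qpoch q q (2 * n + 1)"
proof -
  have "(2 * n - 1) div 2 = n - 1" "(2 * n + 1) div 2 = n" "(2 * n + 2) div 2 = n + 1" by auto
  then show "gf q (altwords (\<ge>) (>) (2 * n)) = q ^ ((n - 1) * n) / qpoch q q (2 * n)"
    "gf q (altwords (\<ge>) (>) (2 * n + 1)) = q ^ (n * (n + 1)) / qpoch q q (2 * n + 1)"
    by (simp_all add: gf_weak_strict_chain[OF q])
qed (simp_all add: gf_weak_chain[OF q] gf_strict_weak_chain[OF q])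

text \<open>For semistandard fillings the words fall weakly and rise strictly, the combination that the recurrence at
zeros excludes; reversed words fall strictly and rise weakly.\<close>

lemma row_SSYT_outer:
  "row_identities q (\<ge>) (<) SSYT outer_strip
    (\<lambda>n. \<Sum>\<pi>\<in>Alt (2 * n + 1). q ^ maj (word (2 * n + 1) (inv \<pi>)))
    (\<lambda>Alts n. \<Sum>\<pi>\<in>Alts (2 * n + 1). q powi (int (invs (word (2 * n + 1) \<pi>))))
    0 0 0 0"
  unfolding SSYT_def
proof (rule row_identities_outer[OF q, where R = "(\<le>)" and C = "(<)" and \<omega> = "\<lambda>_. id"
      and ds = True and us = False and g = "\<lambda>w. int (invs w)", unfolded id_comp])
  fix n :: nat
  show "inj (id :: nat => nat)" by (rule inj_on_id)
  show "gf q (altwords (\<lambda>x y. (\<le>) y x) (<) (2 * n + 1)) = gf q (zigwords True False True (2 * n + 1))"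
    by (subst gf_altwords_reverse[OF q]) (simp add: zigwords_eq_altwords fall_def rise_def)
  show "gf q (altwords (\<lambda>x y. (\<le>) x y) (\<lambda>x y. \<not> (<) y x) (2 * n)) =
      q powi (0 * (int n)\<^sup>2 + 0 * int n) / qpoch q q (2 * n)"
    unfolding quadratic_exponents by (simp add: not_less not_le gf_chains gf_ascending_chains[OF q])
  show "gf q (altwords (\<lambda>x y. \<not> (<) y x) (\<lambda>x y. (\<le>) x y) (2 * n + 1)) =
      q powi (0 * (int n)\<^sup>2 + 0 * int n) / qpoch q q (2 * n + 1)"
    unfolding quadratic_exponents using gf_chains(3,5)[of n] gf_ascending_chains[OF q, of "2 * n + 1"]
    by (simp add: not_less not_le gf_chains(1))
qed (auto simp: le_less vstat_peak_first rev_compl_stats[simplified])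

lemma row_RPP_outer:
  "row_identities q (\<ge>) (\<le>) RPP outer_strip
    (\<lambda>n. \<Sum>\<pi>\<in>Alt (2 * n + 1). q ^ maj (word (2 * n + 1) (kappa n \<circ> inv \<pi>)))
    (\<lambda>Alts n. \<Sum>\<pi>\<in>Alts (2 * n + 1). q powi (int (invs (word (2 * n + 1) \<pi>)) - int (ndes (even_word (2 * n + 1) \<pi>))))
    1 1 1 (-1)"
  unfolding RPP_def even_word_eq_valleys
proof (rule row_identities_outer[OF q, where R = "(\<le>)" and C = "(\<le>)" and \<omega> = "kappa"
      and ds = False and us = False and g = "\<lambda>w. int (invs w) - int (ndes (valleys True w))"])
  fix n :: nat
  show "inj (kappa n)" by (rule inj_kappa)
  show "gf q (altwords (\<lambda>x y. (\<le>) y x) (\<le>) (2 * n + 1)) = gf q (zigwords False False True (2 * n + 1))"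
    by (simp add: zigwords_eq_altwords fall_def rise_def)
  show "gf q (altwords (\<lambda>x y. (\<le>) x y) (\<lambda>x y. \<not> (\<le>) y x) (2 * n)) =
      q powi (1 * (int n)\<^sup>2 + (-1) * int n) / qpoch q q (2 * n)"
    unfolding quadratic_exponents by (simp add: not_less not_le gf_chains gf_ascending_chains[OF q])
  show "gf q (altwords (\<lambda>x y. \<not> (\<le>) y x) (\<lambda>x y. (\<le>) x y) (2 * n + 1)) =
      q powi (1 * (int n)\<^sup>2 + 1 * int n) / qpoch q q (2 * n + 1)"
    unfolding quadratic_exponents using gf_chains(3,5)[of n] gf_ascending_chains[OF q, of "2 * n + 1"]
    by (simp add: not_less not_le gf_chains(1))
qed (auto simp: kappa_apply le_less vstat_peak_first rev_compl_stats[simplified])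

lemma row_ST_outer:
  "row_identities q (>) (<) ST outer_strip
    (\<lambda>n. \<Sum>\<pi>\<in>Alt (2 * n + 1). q ^ maj (word (2 * n + 1) (eta n \<circ> inv \<pi>)))
    (\<lambda>Alts n. \<Sum>\<pi>\<in>Alts (2 * n + 1). q powi (int (invs (word (2 * n + 1) \<pi>)) + int (nasc (even_word (2 * n + 1) \<pi>))))
    1 0 1 0"
  unfolding ST_def even_word_eq_valleys
proof (rule row_identities_outer[OF q, where R = "(<)" and C = "(<)" and \<omega> = "eta"
      and ds = True and us = True and g = "\<lambda>w. int (invs w) + int (nasc (valleys True w))"])
  fix n :: nat
  show "inj (eta n)" by (rule inj_eta)
  show "gf q (altwords (\<lambda>x y. (<) y x) (<) (2 * n + 1)) = gf q (zigwords True True True (2 * n + 1))"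
    by (simp add: zigwords_eq_altwords fall_def rise_def)
  show "gf q (altwords (\<lambda>x y. (<) x y) (\<lambda>x y. \<not> (<) y x) (2 * n)) =
      q powi (1 * (int n)\<^sup>2 + 0 * int n) / qpoch q q (2 * n)"
    unfolding quadratic_exponents by (simp add: not_less not_le gf_chains gf_ascending_chains[OF q])
  show "gf q (altwords (\<lambda>x y. \<not> (<) y x) (\<lambda>x y. (<) x y) (2 * n + 1)) =
      q powi (1 * (int n)\<^sup>2 + 0 * int n) / qpoch q q (2 * n + 1)"
    unfolding quadratic_exponents using gf_chains(3,5)[of n] gf_ascending_chains[OF q, of "2 * n + 1"]
    by (simp add: not_less not_le gf_chains(1))
qed (auto simp: eta_apply le_less vstat_peak_first rev_compl_stats[simplified])

lemma row_SSYT_inner: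
  "row_identities q (<) (\<ge>) SSYT inner_strip
    (\<lambda>n. \<Sum>\<pi>\<in>Ralt (2 * n + 1). q ^ maj (word (2 * n + 1) (inv \<pi>)))
    (\<lambda>Alts n. \<Sum>\<pi>\<in>Alts (2 * n + 1). q powi (int (invs (word (2 * n + 1) \<pi>))))
    0 0 0 0"
  unfolding SSYT_def
proof (rule row_identities_inner[OF q, where R = "(\<le>)" and C = "(<)" and \<omega> = "\<lambda>_. id"
      and ds = True and us = False and g = "\<lambda>w. int (invs w)", unfolded id_comp])
  fix n :: nat
  show "inj (id :: nat => nat)" by (rule inj_on_id)
  show "gf q (altwords (<) (\<lambda>x y. (\<le>) y x) (2 * n + 1)) = gf q (zigwords True False False (2 * n + 1))"
    by (subst gf_altwords_reverse[OF q]) (simp add: zigwords_eq_altwords fall_def rise_def)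
  show "gf q (altwords (\<lambda>x y. (\<le>) y x) (\<lambda>x y. \<not> (<) x y) (2 * n)) =
      q powi (0 * (int n)\<^sup>2 + 0 * int n) / qpoch q q (2 * n)"
    unfolding quadratic_exponents by (simp add: not_less not_le gf_chains)
  show "gf q (altwords (\<lambda>x y. \<not> (<) x y) (\<lambda>x y. (\<le>) y x) (2 * n + 1)) =
      q powi (0 * (int n)\<^sup>2 + 0 * int n) / qpoch q q (2 * n + 1)"
    unfolding quadratic_exponents using gf_chains(3,5)[of n] gf_ascending_chains[OF q, of "2 * n + 1"]
    by (simp add: not_less not_le gf_chains(1))
qed (auto simp: le_less vstat_valley_first rev_compl_stats[simplified])

lemma row_RPP_inner:
  "row_identities q (\<le>) (\<ge>) RPP inner_strip
    (\<lambda>n. \<Sum>\<pi>\<in>Ralt (2 * n + 1). q ^ maj (word (2 * n + 1) (eta n \<circ> inv \<pi>)))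
    (\<lambda>Alts n. \<Sum>\<pi>\<in>Alts (2 * n + 1). q powi (int (invs (word (2 * n + 1) \<pi>)) - int (asc (odd_word (2 * n + 1) \<pi>))))
    1 0 1 (-1)"
  unfolding RPP_def odd_word_eq_valleys
proof (rule row_identities_inner[OF q, where R = "(\<le>)" and C = "(\<le>)" and \<omega> = "eta"
      and ds = False and us = False and g = "\<lambda>w. int (invs w) - int (asc (valleys False w))"])
  fix n :: nat
  show "inj (eta n)" by (rule inj_eta)
  show "gf q (altwords (\<le>) (\<lambda>x y. (\<le>) y x) (2 * n + 1)) = gf q (zigwords False False False (2 * n + 1))"
    by (simp add: zigwords_eq_altwords fall_def rise_def)
  show "gf q (altwords (\<lambda>x y. (\<le>) y x) (\<lambda>x y. \<not> (\<le>) x y) (2 * n)) =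
      q powi (1 * (int n)\<^sup>2 + (-1) * int n) / qpoch q q (2 * n)"
    unfolding quadratic_exponents by (simp add: not_less not_le gf_chains)
  show "gf q (altwords (\<lambda>x y. \<not> (\<le>) x y) (\<lambda>x y. (\<le>) y x) (2 * n + 1)) =
      q powi (1 * (int n)\<^sup>2 + 0 * int n) / qpoch q q (2 * n + 1)"
    unfolding quadratic_exponents using gf_chains(3,5)[of n] gf_ascending_chains[OF q, of "2 * n + 1"]
    by (simp add: not_less not_le gf_chains(1))
qed (auto simp: eta_apply le_less vstat_valley_first rev_compl_stats[simplified])

lemma row_ST_inner:
  "row_identities q (<) (>) ST inner_strip
    (\<lambda>n. \<Sum>\<pi>\<in>Ralt (2 * n + 1). q ^ maj (word (2 * n + 1) (kappa n \<circ> inv \<pi>)))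
    (\<lambda>Alts n. \<Sum>\<pi>\<in>Alts (2 * n + 1). q powi (int (invs (word (2 * n + 1) \<pi>)) + int (des (odd_word (2 * n + 1) \<pi>))))
    1 1 1 0"
  unfolding ST_def odd_word_eq_valleys
proof (rule row_identities_inner[OF q, where R = "(<)" and C = "(<)" and \<omega> = "kappa"
      and ds = True and us = True and g = "\<lambda>w. int (invs w) + int (des (valleys False w))"])
  fix n :: nat
  show "inj (kappa n)" by (rule inj_kappa)
  show "gf q (altwords (<) (\<lambda>x y. (<) y x) (2 * n + 1)) = gf q (zigwords True True False (2 * n + 1))"
    by (simp add: zigwords_eq_altwords fall_def rise_def)
  show "gf q (altwords (\<lambda>x y. (<) y x) (\<lambda>x y. \<not> (<) x y) (2 * n)) =
      q powi (1 * (int n)\<^sup>2 + 0 * int n) / qpoch q q (2 * n)"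
    unfolding quadratic_exponents by (simp add: not_less not_le gf_chains)
  show "gf q (altwords (\<lambda>x y. \<not> (<) x y) (\<lambda>x y. (<) y x) (2 * n + 1)) =
      q powi (1 * (int n)\<^sup>2 + 1 * int n) / qpoch q q (2 * n + 1)"
    unfolding quadratic_exponents using gf_chains(3,5)[of n] gf_ascending_chains[OF q, of "2 * n + 1"]
    by (simp add: not_less not_le gf_chains(1))
qed (auto simp: kappa_apply le_less vstat_valley_first rev_compl_stats[simplified])

end

theorem theorem4p2:
  fixes q :: real
    and \<alpha> \<beta> :: "nat \<Rightarrow> nat \<Rightarrow> bool"
    and SH :: "nat \<Rightarrow> (nat \<times> nat) set"
    and TAB :: "(nat \<times> nat) set \<Rightarrow> (nat \<times> nat \<Rightarrow> nat) set"
    and M :: "nat \<Rightarrow> real"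
    and I :: "(nat \<Rightarrow> (nat \<Rightarrow> nat) set) \<Rightarrow> nat \<Rightarrow> real"
    and A B C D :: int
    and f :: "nat \<Rightarrow> real"
  assumes q: "0 < q" "q < 1"
    and row: "(\<alpha>, \<beta>, TAB, SH, M, I, (A, B), (C, D)) \<in> {
      ((\<ge>), (<), SSYT, outer_strip,
        \<lambda>n. \<Sum>\<pi>\<in>Alt (2 * n + 1). q ^ maj (word (2 * n + 1) (inv \<pi>)),
        \<lambda>Alts n. \<Sum>\<pi>\<in>Alts (2 * n + 1). q powi (int (invs (word (2 * n + 1) \<pi>))),
        (0, 0), (0, 0)),
      ((\<ge>), (\<le>), RPP, outer_strip,
        \<lambda>n. \<Sum>\<pi>\<in>Alt (2 * n + 1). q ^ maj (word (2 * n + 1) (kappa n \<circ> inv \<pi>)),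
        \<lambda>Alts n. \<Sum>\<pi>\<in>Alts (2 * n + 1). q powi (int (invs (word (2 * n + 1) \<pi>)) - int (ndes (even_word (2 * n + 1) \<pi>))),
        (1, 1), (1, -1)),
      ((>), (<), ST, outer_strip,
        \<lambda>n. \<Sum>\<pi>\<in>Alt (2 * n + 1). q ^ maj (word (2 * n + 1) (eta n \<circ> inv \<pi>)),
        \<lambda>Alts n. \<Sum>\<pi>\<in>Alts (2 * n + 1). q powi (int (invs (word (2 * n + 1) \<pi>)) + int (nasc (even_word (2 * n + 1) \<pi>))),
        (1, 0), (1, 0)),
      ((<), (\<ge>), SSYT, inner_strip,
        \<lambda>n. \<Sum>\<pi>\<in>Ralt (2 * n + 1). q ^ maj (word (2 * n + 1) (inv \<pi>)),
        \<lambda>Alts n. \<Sum>\<pi>\<in>Alts (2 * n + 1). q powi (int (invs (word (2 * n + 1) \<pi>))),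
        (0, 0), (0, 0)),
      ((\<le>), (\<ge>), RPP, inner_strip,
        \<lambda>n. \<Sum>\<pi>\<in>Ralt (2 * n + 1). q ^ maj (word (2 * n + 1) (eta n \<circ> inv \<pi>)),
        \<lambda>Alts n. \<Sum>\<pi>\<in>Alts (2 * n + 1). q powi (int (invs (word (2 * n + 1) \<pi>)) - int (asc (odd_word (2 * n + 1) \<pi>))),
        (1, 0), (1, -1)),
      ((<), (>), ST, inner_strip,
        \<lambda>n. \<Sum>\<pi>\<in>Ralt (2 * n + 1). q ^ maj (word (2 * n + 1) (kappa n \<circ> inv \<pi>)),
        \<lambda>Alts n. \<Sum>\<pi>\<in>Alts (2 * n + 1). q powi (int (invs (word (2 * n + 1) \<pi>)) + int (des (odd_word (2 * n + 1) \<pi>))),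
        (1, 1), (1, 0))}"
    and f: "\<And>n. f n = tau \<alpha> \<beta> (2 * n + 1) q / (1 - q) ^ (2 * n + 1)"
  shows "(\<forall>n. ((\<lambda>\<pi>. q ^ filling_size (SH n) \<pi>) has_sum f n) (TAB (SH n)) \<and>
              f n = M n / qpoch q q (2 * n + 1) \<and>
              f n = I Alt n / qpoch q q (2 * n + 1) \<and>
              f n = I Ralt n / qpoch q q (2 * n + 1)) \<and>
         odd_fps f =
           odd_fps (\<lambda>n. (-1) ^ n * q powi (A * (int n)\<^sup>2 + B * int n) / qpoch q q (2 * n + 1)) /
           even_fps (\<lambda>n. (-1) ^ n * q powi (C * (int n)\<^sup>2 + D * int n) / qpoch q q (2 * n))"
proof -
  have row_id: "row_identities q \<alpha> \<beta> TAB SH M I A B C D"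
    using row row_SSYT_outer[OF q] row_RPP_outer[OF q] row_ST_outer[OF q]
      row_SSYT_inner[OF q] row_RPP_inner[OF q] row_ST_inner[OF q]
    unfolding insert_iff empty_iff prod.inject by (elim disjE conjE FalseE) (simp_all only:)
  have "\<alpha> (Suc x) (Suc y) = \<alpha> x y" "\<beta> (Suc x) (Suc y) = \<beta> x y" for x y
    using row unfolding insert_iff empty_iff prod.inject
    by (elim disjE conjE FalseE; simp only: Suc_le_mono Suc_less_eq)+
  then have f_eq: "f = (\<lambda>n. gf q (altwords \<alpha> \<beta> (2 * n + 1)))"
    unfolding f by (intro ext tau_eq_gf[OF q]) auto
  show ?thesis using row_id unfolding row_identities_def f_eq .
qed

end
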